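(* Let $E_1$ and $E_2$ be elliptic curves over $\mathbb{Q}$ with surjective mod $3$ Galois representations $\bar\rho_{E_1,3},\bar\rho_{E_2,3}:\mathrm{Gal}(\bar{\mathbb{Q}}/\mathbb{Q})\to\mathrm{GL}_2(\mathbb{F}_3)$, and let $\Delta_{E_1},\Delta_{E_2}$ be their discriminants. The pair $(E_1,E_2)$ realizes $H_Q$ if and only if both of the following hold: the representations are not (trivial or quadratic) twists of one another, i.e. there is no character $\psi:\mathrm{Gal}(\bar{\mathbb{Q}}/\mathbb{Q})\to\{\pm1\}$ (trivial or quadratic) with $\bar\rho_{E_2,3}\simeq\psi\otimes\bar\rho_{E_1,3}$; and $\Delta_{E_1}\Delta_{E_2}^{\pm1}\in(\mathbb{Q}^\times)^3$ for at least one choice of sign.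
   Context: For an elliptic curve $E/\mathbb{Q}$, $\bar\rho_{E,3}$ is the representation given by the Galois action on $E[3]$ (after a choice of basis); two such representations are isomorphic ($\simeq$) if they are conjugate by a single matrix in $\mathrm{GL}_2(\mathbb{F}_3)$. Let $Q_8$ be the unique normal subgroup of order $8$ of $\mathrm{GL}_2(\mathbb{F}_3)$ and $$H_Q=\{(g_1,g_2)\in\mathrm{GL}_2(\mathbb{F}_3)\times\mathrm{GL}_2(\mathbb{F}_3): g_1g_2^{-1}\in Q_8\}.$$ The pair $(E_1,E_2)$ realizes $H_Q$ if the image of the product representation $\sigma\mapsto(\bar\rho_{E_1,3}(\sigma),\bar\rho_{E_2,3}(\sigma))$ is conjugate to $H_Q$ in $\mathrm{GL}_2(\mathbb{F}_3)\times\mathrm{GL}_2(\mathbb{F}_3)$. (The discriminant of $E/\mathbb{Q}$ is that of any Weierstrass model; its class in $\mathbb{Q}^\times/(\mathbb{Q}^\times)^3$ does not depend on the model.) *)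

theory Defs
  imports
    "HOL-Analysis.Analysis"
    "HOL-Algebra.Coset"
    "HOL-Algebra.Sym_Groups"
    "HOL-Algebra.Algebraic_Closure_Type"
begin

section \<open>Weierstrass equations and elliptic curves\<close>

text \<open>
  The equation \<open>y\<^sup>2 + a1 x y + a3 y = x\<^sup>3 + a2 x\<^sup>2 + a4 x + a6\<close>. The datatype functor
  \<open>map_weierstrass\<close> provides base change.
\<close>

datatype 'a weierstrass =
  Weierstrass (wa1: 'a) (wa2: 'a) (wa3: 'a) (wa4: 'a) (wa6: 'a)

definition wb2 :: "'a :: comm_ring_1 weierstrass \<Rightarrow> 'a" where
  "wb2 E = wa1 E ^ 2 + 4 * wa2 E"

definition wb4 :: "'a :: comm_ring_1 weierstrass \<Rightarrow> 'a" where
  "wb4 E = 2 * wa4 E + wa1 E * wa3 E"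

definition wb6 :: "'a :: comm_ring_1 weierstrass \<Rightarrow> 'a" where
  "wb6 E = wa3 E ^ 2 + 4 * wa6 E"

definition wb8 :: "'a :: comm_ring_1 weierstrass \<Rightarrow> 'a" where
  "wb8 E = wa1 E ^ 2 * wa6 E + 4 * wa2 E * wa6 E - wa1 E * wa3 E * wa4 E
             + wa2 E * wa3 E ^ 2 - wa4 E ^ 2"

definition discriminant :: "'a :: comm_ring_1 weierstrass \<Rightarrow> 'a" where
  "discriminant E =
     - (wb2 E ^ 2 * wb8 E) - 8 * wb4 E ^ 3 - 27 * wb6 E ^ 2 + 9 * wb2 E * wb4 E * wb6 E"

definition elliptic_curve :: "'a :: field weierstrass \<Rightarrow> bool" where
  "elliptic_curve E \<longleftrightarrow> discriminant E \<noteq> 0"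

datatype 'a ec_point = Infinity | Affine 'a 'a

definition ec_points :: "'a :: field weierstrass \<Rightarrow> 'a ec_point set" where
  "ec_points E = insert Infinity {Affine x y |x y.
     y ^ 2 + wa1 E * x * y + wa3 E * y = x ^ 3 + wa2 E * x ^ 2 + wa4 E * x + wa6 E}"

text \<open>
  The chord and tangent law: \<open>y = l x + m\<close> is the line through the two points (the tangent line
  if they coincide), and the sum is the negative of its third point of intersection with the curve,
  where \<open>-(x, y) = (x, -y - a1 x - a3)\<close>.
\<close>

fun ec_add :: "'a :: field weierstrass \<Rightarrow> 'a ec_point \<Rightarrow> 'a ec_point \<Rightarrow> 'a ec_point" where
  "ec_add E Infinity Q = Q"
| "ec_add E P Infinity = P"
| "ec_add E (Affine x1 y1) (Affine x2 y2) =
     (if x1 = x2 \<and> y1 + y2 + wa1 E * x2 + wa3 E = 0 then Infinity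
      else
        let l = (if x1 = x2
                 then (3 * x1 ^ 2 + 2 * wa2 E * x1 + wa4 E - wa1 E * y1)
                        / (2 * y1 + wa1 E * x1 + wa3 E)
                 else (y2 - y1) / (x2 - x1));
            m = y1 - l * x1;
            x3 = l ^ 2 + wa1 E * l - wa2 E - x1 - x2
        in Affine x3 (- (l + wa1 E) * x3 - m - wa3 E))"

definition ec_group :: "'a :: field weierstrass \<Rightarrow> 'a ec_point monoid" where
  "ec_group E = \<lparr>carrier = ec_points E, mult = ec_add E, one = Infinity\<rparr>"


section \<open>The absolute Galois group of the rationals\<close>

type_synonym Qbar = "rat alg_closure"

definition gal_Q :: "(Qbar \<Rightarrow> Qbar) monoid" where
  "gal_Q = \<lparr>carrier = {\<sigma>. bij \<sigma> \<and> (\<forall>x y. \<sigma> (x + y) = \<sigma> x + \<sigma> y) \<and> (\<forall>x y. \<sigma> (x * y) = \<sigma> x * \<sigma> y)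
                         \<and> (\<forall>q. \<sigma> (to_ac q) = to_ac q)},
            mult = (\<circ>), one = id\<rparr>"

text \<open>
  The Krull topology: a basis of neighbourhoods of \<open>\<sigma>\<close> is given by the sets of all \<open>\<tau>\<close> which agree
  with \<open>\<sigma>\<close> on a given finite set, i.e. it is the topology of pointwise convergence.
\<close>

definition krull_topology :: "(Qbar \<Rightarrow> Qbar) topology" where
  "krull_topology =
     subtopology (product_topology (\<lambda>_. discrete_topology UNIV) UNIV) (carrier gal_Q)"

text \<open>
  Characters with values in \<open>{\<plusminus>1}\<close> (the group \<open>sign_img\<close>); as always for characters of Galois
  groups, they are continuous. The trivial character is included.
\<close>

definition sign_character :: "((Qbar \<Rightarrow> Qbar) \<Rightarrow> int) \<Rightarrow> bool" where
  "sign_character \<psi> \<longleftrightarrow> \<psi> \<in> hom gal_Q sign_img \<and>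
     continuous_map krull_topology (discrete_topology (carrier sign_img)) \<psi>"


section \<open>Subgroups of \<open>GL\<^sub>2(F\<^sub>3)\<close>\<close>

text \<open>The numeral type \<open>3\<close> is the ring of integers modulo 3.\<close>

type_synonym F3 = 3

definition GL2_F3 :: "(F3 ^ 2 ^ 2) monoid" where
  "GL2_F3 = \<lparr>carrier = {A. invertible A}, mult = (**), one = mat 1\<rparr>"

definition Q8 :: "(F3 ^ 2 ^ 2) set" where
  "Q8 = (THE N. N \<lhd> GL2_F3 \<and> card N = 8)"

definition HQ :: "((F3 ^ 2 ^ 2) \<times> (F3 ^ 2 ^ 2)) set" where
  "HQ = {(g1, g2). g1 \<in> carrier GL2_F3 \<and> g2 \<in> carrier GL2_F3 \<and>
                   g1 \<otimes>\<^bsub>GL2_F3\<^esub> inv\<^bsub>GL2_F3\<^esub> g2 \<in> Q8}"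

definition conjugate_in :: "('g, 'm) monoid_scheme \<Rightarrow> 'g set \<Rightarrow> 'g set \<Rightarrow> bool" where
  "conjugate_in G H K \<longleftrightarrow>
     (\<exists>g \<in> carrier G. H = (\<lambda>h. g \<otimes>\<^bsub>G\<^esub> h \<otimes>\<^bsub>G\<^esub> inv\<^bsub>G\<^esub> g) ` K)"


section \<open>Mod 3 Galois representations\<close>

type_synonym F3_rep = "(Qbar \<Rightarrow> Qbar) \<Rightarrow> F3 ^ 2 ^ 2"

text \<open>The group \<open>E(Qbar)\<close>, written multiplicatively in the library's notation for groups.\<close>

definition Qbar_points :: "rat weierstrass \<Rightarrow> Qbar ec_point monoid" where
  "Qbar_points E = ec_group (map_weierstrass to_ac E)"

definition torsion3 :: "rat weierstrass \<Rightarrow> Qbar ec_point set" where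
  "torsion3 E =
     {P \<in> carrier (Qbar_points E). P [^]\<^bsub>Qbar_points E\<^esub> (3::nat) = \<one>\<^bsub>Qbar_points E\<^esub>}"

text \<open>
  Scalar multiplication by \<open>c\<close> on \<open>E[3]\<close> is multiplication by an integer representing \<open>c\<close>; we take
  the one in \<open>{0, 1, 2}\<close>.
\<close>

definition F3_smult :: "rat weierstrass \<Rightarrow> F3 \<Rightarrow> Qbar ec_point \<Rightarrow> Qbar ec_point" where
  "F3_smult E c P = P [^]\<^bsub>Qbar_points E\<^esub> (LEAST n::nat. of_nat n = c)"

definition lin_comb3 :: "rat weierstrass \<Rightarrow> Qbar ec_point ^ 2 \<Rightarrow> F3 ^ 2 \<Rightarrow> Qbar ec_point" where
  "lin_comb3 E B v = F3_smult E (v $ 1) (B $ 1) \<otimes>\<^bsub>Qbar_points E\<^esub> F3_smult E (v $ 2) (B $ 2)"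

definition torsion3_basis :: "rat weierstrass \<Rightarrow> Qbar ec_point ^ 2 \<Rightarrow> bool" where
  "torsion3_basis E B \<longleftrightarrow>
     (\<forall>i. B $ i \<in> torsion3 E) \<and> bij_betw (lin_comb3 E B) UNIV (torsion3 E)"

text \<open>
  The matrix of \<open>\<sigma>\<close> acting on \<open>E[3]\<close> with respect to the basis \<open>B\<close>: its \<open>j\<close>-th column consists of
  the coordinates of the image of the \<open>j\<close>-th basis vector. The functor \<open>map_ec_point\<close> applies \<open>\<sigma>\<close>
  to the coordinates of a point.
\<close>

definition mod3_rep :: "rat weierstrass \<Rightarrow> Qbar ec_point ^ 2 \<Rightarrow> F3_rep" where
  "mod3_rep E B \<sigma> =
     (THE A. \<forall>j. map_ec_point \<sigma> (B $ j) = lin_comb3 E B (column j A))"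

definition surjective_rep :: "F3_rep \<Rightarrow> bool" where
  "surjective_rep \<rho> \<longleftrightarrow> \<rho> ` carrier gal_Q = carrier GL2_F3"

definition isomorphic_reps :: "F3_rep \<Rightarrow> F3_rep \<Rightarrow> bool" where
  "isomorphic_reps \<rho> \<rho>' \<longleftrightarrow>
     (\<exists>g \<in> carrier GL2_F3. \<forall>\<sigma> \<in> carrier gal_Q.
        \<rho>' \<sigma> = g \<otimes>\<^bsub>GL2_F3\<^esub> \<rho> \<sigma> \<otimes>\<^bsub>GL2_F3\<^esub> inv\<^bsub>GL2_F3\<^esub> g)"

definition twist_rep :: "((Qbar \<Rightarrow> Qbar) \<Rightarrow> int) \<Rightarrow> F3_rep \<Rightarrow> F3_rep" where
  "twist_rep \<psi> \<rho> \<sigma> = (\<chi> i j. of_int (\<psi> \<sigma>) * \<rho> \<sigma> $ i $ j)"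

definition realizes_HQ :: "F3_rep \<Rightarrow> F3_rep \<Rightarrow> bool" where
  "realizes_HQ \<rho>1 \<rho>2 \<longleftrightarrow>
     conjugate_in (GL2_F3 \<times>\<times> GL2_F3) ((\<lambda>\<sigma>. (\<rho>1 \<sigma>, \<rho>2 \<sigma>)) ` carrier gal_Q) HQ"

definition nonzero_cubes :: "'a :: field set" where
  "nonzero_cubes = {c ^ 3 |c. c \<noteq> 0}"

end

theory Submission
  imports Defs
begin

text \<open>
  The four \<open>x\<close>-coordinates of the nonzero 3-torsion points of \<open>E\<close> are the roots of the 3-division
  polynomial, and for each of the three ways to split them into two pairs the resolvent
  \<open>b4 - 3 (x1 x2 + x3 x4)\<close> is a cube root of \<open>\<Delta>\<close>. The group \<open>GL\<^sub>2(F\<^sub>3)\<close> acts on the three pairings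
  through its quotient \<open>S\<^sub>3\<close> by \<open>Q\<^sub>8\<close>, so \<open>\<sigma>\<close> fixes all cube roots of \<open>\<Delta>\<close> if and only if \<open>\<rho>(\<sigma>)\<close> lies in \<open>Q\<^sub>8\<close>.

  If the pair realizes \<open>H\<^sub>Q\<close>, there is a Galois-equivariant bijection between the cube roots \<open>x\<^sub>k\<close> of
  \<open>\<Delta>\<^sub>1\<close> and \<open>y\<^sub>k\<close> of \<open>\<Delta>\<^sub>2\<close>. Either \<open>x\<^sub>k y\<^sub>k\<close> or \<open>x\<^sub>k / y\<^sub>k\<close> does not depend on \<open>k\<close>; it is then fixed by
  the Galois group, hence rational. Conversely, \<open>\<Delta>\<^sub>1 \<Delta>\<^sub>2 = c\<^sup>3\<close> (or \<open>\<Delta>\<^sub>1 / \<Delta>\<^sub>2 = c\<^sup>3\<close>) provides such a bijection, so after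
  conjugation the two representations agree modulo \<open>Q\<^sub>8\<close>. By Goursat's lemma the image of the
  product representation is then the full group \<open>H\<^sub>Q\<close>, unless it is so small that the
  representations are twists of one another.
\<close>

text \<open>The addition on E[3] is the obstacle behind the geometric part. A basis is only given as
  a bijection from F_3^2 to the points with 2P = -P, so the linearity of the Galois action has to
  come from the addition table of these nine points. Associativity of the chord and tangent law is
  bypassed: a point with 2P = -P is a flex, the table is determined by the lines through three
  flexes, and these lines are found by explicit coordinates.

  The resolvents are indexed by matrices rather than by pairings. The Galois action then becomes
  left multiplication by \<open>\<rho> \<sigma>\<close>, and every question about pairings becomes a
  finite check over F_3.

  The sign in the condition on the discriminants reflects the two primitive cube roots of unity: the
  ratio of two cube roots of \<open>\<Delta>1\<close> and the ratio of the corresponding cube roots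
  of \<open>\<Delta>2\<close> are either equal or inverse to each other. That a Galois-invariant
  product or quotient of such roots is rational rests on extending an embedding of conjugates to all
  of Qbar by Zorn's lemma.\<close>

section \<open>The fixed field of the absolute Galois group\<close>

text \<open>
  A homomorphism from a subring of the algebraic closure to the algebraic closure is represented by
  its graph. The domain contains the base field, and the algebraic closure is algebraic over it, so
  the domain is a field and the homomorphism is injective.
\<close>

definition partial_hom :: "('a :: field alg_closure \<times> 'a alg_closure) set \<Rightarrow> bool" where
  "partial_hom R \<longleftrightarrow> (\<forall>a. (to_ac a, to_ac a) \<in> R) \<and>
     (\<forall>x y x' y'. (x, y) \<in> R \<longrightarrow> (x', y') \<in> R \<longrightarrow> (x + x', y + y') \<in> R \<and> (x * x', y * y') \<in> R) \<and>
     (\<forall>y. (0, y) \<in> R \<longrightarrow> y = 0)"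

text \<open>This is the relational form of applying the partial homomorphism to all coefficients; it
  avoids inventing values outside the domain.\<close>

definition coeffs_related ::
    "('a :: zero \<times> 'b :: zero) set \<Rightarrow> 'a poly \<Rightarrow> 'b poly \<Rightarrow> bool" where
  "coeffs_related R p q \<longleftrightarrow> (\<forall>i. (Polynomial.coeff p i, Polynomial.coeff q i) \<in> R)"

lemma degree_pos_if_root:
  fixes p :: "'a :: comm_semiring_0 poly"
  assumes "p \<noteq> 0" "poly p x = 0"
  shows "Polynomial.degree p > 0"
proof (rule ccontr)
  assume "\<not> Polynomial.degree p > 0"
  then obtain a where "p = [:a:]" by (auto elim: degree_eq_zeroE)
  then show False using assms by simp
qed

lemma map_poly_to_ac_mult: "map_poly to_ac (p * q) = map_poly to_ac p * map_poly to_ac q"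
  by (rule poly_eqI) (simp add: coeff_map_poly coeff_mult to_ac_sum)

lemma map_poly_to_ac_power: "map_poly to_ac (p ^ n) = map_poly to_ac p ^ n"
  by (induction n) (auto simp: map_poly_to_ac_mult)

context
  fixes R :: "('a :: field_char_0 alg_closure \<times> 'a alg_closure) set"
  assumes R: "partial_hom R"
begin

lemma partial_hom_base: "(to_ac a, to_ac a) \<in> R"
  and partial_hom_add: "(x, y) \<in> R \<Longrightarrow> (x', y') \<in> R \<Longrightarrow> (x + x', y + y') \<in> R"
  and partial_hom_mult: "(x, y) \<in> R \<Longrightarrow> (x', y') \<in> R \<Longrightarrow> (x * x', y * y') \<in> R"
  and partial_hom_zeroD: "(0, y) \<in> R \<Longrightarrow> y = 0"
  using R by (simp_all add: partial_hom_def)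

lemma partial_hom_zero: "(0, 0) \<in> R" and partial_hom_one: "(1, 1) \<in> R"
  using partial_hom_base[of 0] partial_hom_base[of 1] by simp_all

lemma partial_hom_uminus: "(x, y) \<in> R \<Longrightarrow> (- x, - y) \<in> R"
  using partial_hom_mult[of "-1" "-1" x y] partial_hom_base[of "-1"] by simp

lemma partial_hom_diff: "(x, y) \<in> R \<Longrightarrow> (x', y') \<in> R \<Longrightarrow> (x - x', y - y') \<in> R"
  using partial_hom_add[of x y "-x'" "-y'"] partial_hom_uminus by simp

lemma partial_hom_unique: "(x, y) \<in> R \<Longrightarrow> (x, y') \<in> R \<Longrightarrow> y = y'"
  using partial_hom_diff[of x y x y'] partial_hom_zeroD[of "y - y'"] by simp

lemma partial_hom_sum:
  assumes "\<And>i. i \<in> A \<Longrightarrow> (f i, g i) \<in> R"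
  shows "(sum f A, sum g A) \<in> R"
  using assms by (induction A rule: infinite_finite_induct) (auto intro: partial_hom_zero partial_hom_add)

lemma partial_hom_power: "(x, y) \<in> R \<Longrightarrow> (x ^ n, y ^ n) \<in> R"
  by (induction n) (auto intro: partial_hom_one partial_hom_mult)

lemma coeffs_related_of_base: "coeffs_related R (map_poly to_ac p) (map_poly to_ac p)"
  by (simp add: coeffs_related_def coeff_map_poly partial_hom_base)

lemma coeffs_related_add:
  "coeffs_related R p p' \<Longrightarrow> coeffs_related R q q' \<Longrightarrow> coeffs_related R (p + q) (p' + q')"
  by (simp add: coeffs_related_def partial_hom_add)

lemma coeffs_related_diff:
  "coeffs_related R p p' \<Longrightarrow> coeffs_related R q q' \<Longrightarrow> coeffs_related R (p - q) (p' - q')"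
  by (simp add: coeffs_related_def partial_hom_diff)

lemma coeffs_related_mult:
  "coeffs_related R p p' \<Longrightarrow> coeffs_related R q q' \<Longrightarrow> coeffs_related R (p * q) (p' * q')"
  by (auto simp: coeffs_related_def coeff_mult intro!: partial_hom_sum partial_hom_mult)

lemma coeffs_related_monom: "(x, y) \<in> R \<Longrightarrow> coeffs_related R (Polynomial.monom x n) (Polynomial.monom y n)"
  by (auto simp: coeffs_related_def intro: partial_hom_zero)

lemma partial_hom_poly:
  assumes "coeffs_related R p q" "(x, y) \<in> R"
  shows "(poly p x, poly q y) \<in> R"
proof -
  define n where "n = max (Polynomial.degree p) (Polynomial.degree q)"
  have *: "poly r z = (\<Sum>i\<le>n. Polynomial.coeff r i * z ^ i)"
    if "Polynomial.degree r \<le> n" for r :: "'a alg_closure poly" and z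
    unfolding poly_altdef using that
    by (intro sum.mono_neutral_left) (auto simp: coeff_eq_0)
  have "poly p x = (\<Sum>i\<le>n. Polynomial.coeff p i * x ^ i)" "poly q y = (\<Sum>i\<le>n. Polynomial.coeff q i * y ^ i)"
    by (rule *, simp add: n_def)+
  then show ?thesis
    using assms by (auto simp: coeffs_related_def intro!: partial_hom_sum partial_hom_mult partial_hom_power)
qed

text \<open>Some polynomial over the base field vanishes at x. If x is nonzero, powers of X can be
  divided out until the constant term is nonzero. Evaluating at the related pair (x, 0) then relates
  0 to that constant term, against the last clause of \<open>partial_hom\<close>.\<close>

lemma partial_hom_inj:
  assumes "(x, 0) \<in> R"
  shows "x = 0"
proof (rule ccontr)
  assume x: "x \<noteq> 0"
  obtain p where p: "p \<noteq> 0" "poly (map_poly to_ac p) x = 0"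
    by (rule alg_closure_algebraic)
  obtain q k where q: "p = [:0, 1:] ^ k * q" "\<not> [:0, 1:] dvd q"
    using order_decomp[OF p(1), of 0] by auto
  have X: "map_poly to_ac [:0, 1 :: 'a:] = [:0, 1:]"
    by (rule poly_eqI) (simp add: coeff_map_poly coeff_pCons split: nat.split)
  have "map_poly to_ac p = map_poly to_ac ([:0, 1:] ^ k * q)"
    using q(1) by (rule arg_cong)
  then have eq: "map_poly to_ac p = [:0, 1:] ^ k * map_poly to_ac q"
    unfolding map_poly_to_ac_mult map_poly_to_ac_power X .
  have q0: "poly (map_poly to_ac q) x = 0"
    using p(2) x unfolding eq by simp
  have "poly q 0 \<noteq> 0"
    using q(2) by (simp add: poly_eq_0_iff_dvd)
  then have "poly (map_poly to_ac q) 0 \<noteq> 0"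
    by (simp add: poly_0_coeff_0 coeff_map_poly)
  moreover have "(0, poly (map_poly to_ac q) 0) \<in> R"
    using partial_hom_poly[OF coeffs_related_of_base assms, of q] q0 by simp
  ultimately show False
    using partial_hom_zeroD by blast
qed

lemma coeffs_related_degree:
  assumes "coeffs_related R p q"
  shows "Polynomial.degree p = Polynomial.degree q"
proof -
  have "Polynomial.coeff p i = 0 \<longleftrightarrow> Polynomial.coeff q i = 0" for i
    using assms partial_hom_inj partial_hom_zeroD unfolding coeffs_related_def by metis
  then show ?thesis
    by (simp add: Polynomial.degree_def)
qed

text \<open>Here m acts as the minimal polynomial of x over the domain of R, and the induction is
  division by m. It is a pseudo-division, scaling by the leading coefficient of m instead of
  dividing by it, because \<open>partial_hom\<close> does not mention inverses.\<close>

lemma coeffs_related_root: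
  assumes m: "coeffs_related R m m'" "m \<noteq> 0" "poly m x = 0" "poly m' y = 0"
    and min: "\<And>q q'. coeffs_related R q q' \<Longrightarrow> q \<noteq> 0 \<Longrightarrow> poly q x = 0 \<Longrightarrow>
                Polynomial.degree m \<le> Polynomial.degree q"
    and "coeffs_related R p p'" "poly p x = 0"
  shows "poly p' y = 0"
  using assms(6,7)
proof (induction "Polynomial.degree p" arbitrary: p p' rule: less_induct)
  case less
  show ?case
  proof (cases "p = 0")
    case True
    have "Polynomial.coeff p' i = 0" for i
      using less.prems(1) partial_hom_zeroD unfolding True coeffs_related_def by simp
    then have "p' = 0" by (simp add: poly_eq_iff)
    then show ?thesis by simp
  next
    case False
    define k where "k = Polynomial.degree p - Polynomial.degree m"
    have deg: "Polynomial.degree p = k + Polynomial.degree m"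
      using min[OF less.prems(1) False less.prems(2)] by (simp add: k_def)
    let ?c = "Polynomial.lead_coeff"
    have rel: "(?c m, ?c m') \<in> R" "(?c p, ?c p') \<in> R"
      using m(1) less.prems(1) coeffs_related_degree[OF m(1)] coeffs_related_degree[OF less.prems(1)]
      unfolding coeffs_related_def by metis+
    have c0: "?c m' \<noteq> 0"
      using rel(1) partial_hom_inj[of "?c m"] m(2) by (metis leading_coeff_0_iff)
    define q where "q = Polynomial.monom (?c m) 0 * p - Polynomial.monom (?c p) k * m"
    define q' where "q' = Polynomial.monom (?c m') 0 * p' - Polynomial.monom (?c p') k * m'"
    have qq: "coeffs_related R q q'"
      unfolding q_def q'_def
      by (intro coeffs_related_diff coeffs_related_mult coeffs_related_monom rel m(1) less.prems(1))
    have qx: "poly q x = 0"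
      using less.prems(2) m(3) by (simp add: q_def)
    have "poly q' y = 0"
    proof (cases "q = 0")
      case True
      have "Polynomial.coeff q' i = 0" for i
        using qq partial_hom_zeroD unfolding True coeffs_related_def by simp
      then have "q' = 0" by (simp add: poly_eq_iff)
      then show ?thesis by simp
    next
      case nz: False
      have le: "Polynomial.degree q \<le> Polynomial.degree p"
        unfolding q_def
        by (rule degree_diff_le; rule order.trans[OF degree_mult_le])
           (simp_all add: deg monom_0 degree_monom_le)
      have "Polynomial.coeff q (Polynomial.degree p) = 0"
      proof -
        have "Polynomial.coeff (Polynomial.monom (?c p) k * m) (Polynomial.degree p) = ?c p * ?c m"
          unfolding coeff_monom_mult by (simp add: deg)
        then show ?thesis by (simp add: q_def coeff_monom_mult)
      qed
      then have "Polynomial.degree q \<noteq> Polynomial.degree p"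
        using nz leading_coeff_0_iff by metis
      then show ?thesis
        using less.hyps[OF _ qq qx] le by simp
    qed
    \<comment> \<open>Since y is a root of m', the value of q' at y is the leading coefficient of m'
      times the value of p' at y.\<close>
    then show ?thesis
      using m(4) c0 by (simp add: q'_def poly_monom)
  qed
qed

text \<open>The usual extension to a simple algebraic extension: p(x) is sent to p'(y), which is
  well defined by \<open>coeffs_related_root\<close>.\<close>

lemma partial_hom_extend:
  assumes m: "coeffs_related R m m'" "m \<noteq> 0" "poly m x = 0" "poly m' y = 0"
    and min: "\<And>q q'. coeffs_related R q q' \<Longrightarrow> q \<noteq> 0 \<Longrightarrow> poly q x = 0 \<Longrightarrow>
                Polynomial.degree m \<le> Polynomial.degree q"
  shows "\<exists>S. partial_hom S \<and> R \<subseteq> S \<and> (x, y) \<in> S"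
proof -
  define S where "S = {(poly p x, poly p' y) |p p'. coeffs_related R p p'}"
  have SI: "(u, v) \<in> S" if "coeffs_related R p p'" "poly p x = u" "poly p' y = v" for p p' u v
    using that unfolding S_def by blast
  have sub: "R \<subseteq> S"
  proof (clarify)
    fix u v assume "(u, v) \<in> R"
    then show "(u, v) \<in> S"
      by (intro SI[OF coeffs_related_monom[of u v 0]]) (auto simp: poly_monom)
  qed
  have "(x, y) \<in> S"
    by (rule SI[OF coeffs_related_monom[of 1 1 1]]) (auto simp: poly_monom partial_hom_one)
  moreover have "partial_hom S"
    unfolding partial_hom_def
  proof (intro conjI allI impI)
    show "(to_ac a, to_ac a) \<in> S" for a
      using sub partial_hom_base by blast
  next
    fix u v u' v'
    assume "(u, v) \<in> S" "(u', v') \<in> S"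
    then obtain p p' q q' where "coeffs_related R p p'" "coeffs_related R q q'"
        and "u = poly p x" "v = poly p' y" "u' = poly q x" "v' = poly q' y"
      unfolding S_def by blast
    then show "(u + u', v + v') \<in> S" "(u * u', v * v') \<in> S"
      using SI[OF coeffs_related_add] SI[OF coeffs_related_mult] by simp_all
  next
    fix v assume "(0, v) \<in> S"
    then obtain p p' where "coeffs_related R p p'" "poly p x = 0" "v = poly p' y"
      unfolding S_def by auto
    then show "v = 0"
      using coeffs_related_root[OF m] min by simp
  qed
  ultimately show ?thesis
    using sub by blast
qed

lemma obtains_minimal_related:
  obtains m m' where "coeffs_related R m m'" "m \<noteq> 0" "poly m x = 0"
    "\<And>q q'. coeffs_related R q q' \<Longrightarrow> q \<noteq> 0 \<Longrightarrow> poly q x = 0 \<Longrightarrow>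
       Polynomial.degree m \<le> Polynomial.degree q"
proof -
  define P where "P = (\<lambda>p. p \<noteq> 0 \<and> poly p x = 0 \<and> (\<exists>p'. coeffs_related R p p'))"
  obtain p where p: "p \<noteq> 0" "poly (map_poly to_ac p) x = 0"
    by (rule alg_closure_algebraic)
  have "P (map_poly to_ac p)"
    using p coeffs_related_of_base by (auto simp: P_def poly_eq_iff coeff_map_poly)
  then obtain m where m: "P m" "\<And>q. P q \<Longrightarrow> Polynomial.degree m \<le> Polynomial.degree q"
    using ex_has_least_nat[of P _ Polynomial.degree] by blast
  then show ?thesis
    using that unfolding P_def by blast
qed

lemma partial_hom_extend_domain: "\<exists>S y. partial_hom S \<and> R \<subseteq> S \<and> (x, y) \<in> S"
proof -
  obtain m m' where m: "coeffs_related R m m'" "m \<noteq> 0" "poly m x = 0"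
    "\<And>q q'. coeffs_related R q q' \<Longrightarrow> q \<noteq> 0 \<Longrightarrow> poly q x = 0 \<Longrightarrow>
       Polynomial.degree m \<le> Polynomial.degree q"
    by (rule obtains_minimal_related[of x]) blast
  have "Polynomial.degree m' > 0"
    using coeffs_related_degree[OF m(1)] degree_pos_if_root[OF m(2,3)] by simp
  then obtain y where "poly m' y = 0"
    using alg_closed_imp_poly_has_root by blast
  then show ?thesis
    using partial_hom_extend[OF m(1-3), of y] m(4) by blast
qed

end

section \<open>Extension of partial homomorphisms to the whole algebraic closure\<close>

lemma partial_hom_Union:
  fixes C :: "('a :: field_char_0 alg_closure \<times> 'a alg_closure) set set"
  assumes "C \<noteq> {}" "\<And>R. R \<in> C \<Longrightarrow> partial_hom R" "subset.chain A C"
  shows "partial_hom (\<Union>C)"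
proof -
  obtain R0 where R0: "R0 \<in> C" using assms(1) by blast
  have chain: "\<exists>R\<in>C. u \<in> R \<and> v \<in> R" if uv: "u \<in> \<Union>C" "v \<in> \<Union>C" for u v
  proof -
    obtain R1 R2 where "R1 \<in> C" "u \<in> R1" "R2 \<in> C" "v \<in> R2"
      using uv by blast
    moreover from this have "R1 \<subseteq> R2 \<or> R2 \<subseteq> R1"
      using assms(3) by (auto simp: subset_chain_def)
    ultimately show ?thesis by blast
  qed
  show ?thesis
    unfolding partial_hom_def
  proof (intro conjI allI impI)
    show "(to_ac a, to_ac a) \<in> \<Union>C" for a
      using UnionI[OF R0] partial_hom_base[OF assms(2)[OF R0]] .
  next
    fix y assume "(0, y) \<in> \<Union>C"
    then obtain R where "R \<in> C" "(0, y) \<in> R" by (rule UnionE)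
    then show "y = 0" using partial_hom_zeroD[OF assms(2)] by simp
  next
    fix x y x' y'
    assume "(x, y) \<in> \<Union>C" "(x', y') \<in> \<Union>C"
    then obtain R where R: "R \<in> C" "(x, y) \<in> R" "(x', y') \<in> R"
      using chain by metis
    show "(x + x', y + y') \<in> \<Union>C"
      using UnionI[OF R(1)] partial_hom_add[OF assms(2)[OF R(1)] R(2,3)] .
    show "(x * x', y * y') \<in> \<Union>C"
      using UnionI[OF R(1)] partial_hom_mult[OF assms(2)[OF R(1)] R(2,3)] .
  qed
qed

lemma partial_hom_total_extension:
  fixes R :: "('a :: field_char_0 alg_closure \<times> 'a alg_closure) set"
  assumes "partial_hom R"
  obtains S where "partial_hom S" "R \<subseteq> S" "Domain S = UNIV"
proof -
  define A where "A = {S. partial_hom S \<and> R \<subseteq> S}"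
  have "\<exists>M\<in>A. \<forall>Y\<in>A. M \<subseteq> Y \<longrightarrow> Y = M"
  proof (rule subset_Zorn_nonempty)
    show "A \<noteq> {}" using assms by (auto simp: A_def)
    show "\<Union>C \<in> A" if "C \<noteq> {}" "subset.chain A C" for C
      using that partial_hom_Union[OF that(1) _ that(2)] unfolding A_def subset_chain_def by blast
  qed
  then obtain M where "M \<in> A" and max: "\<And>S. S \<in> A \<Longrightarrow> M \<subseteq> S \<Longrightarrow> S = M"
    by meson
  then have M: "partial_hom M" "R \<subseteq> M"
    by (simp_all add: A_def)
  have "x \<in> Domain M" for x
  proof -
    obtain S y where S: "partial_hom S" "M \<subseteq> S" "(x, y) \<in> S"
      using partial_hom_extend_domain[OF M(1), of x] by metis
    then have "S = M"
      using M(2) by (intro max) (auto simp: A_def)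
    then show ?thesis using S(3) by blast
  qed
  then show ?thesis
    using that M by blast
qed

text \<open>A total extension maps the finite set of roots of any polynomial over the base field
  injectively to itself, hence onto itself. Every element is such a root, so the extension is
  surjective.\<close>

lemma partial_hom_in_gal_Q:
  fixes R :: "(Qbar \<times> Qbar) set"
  assumes "partial_hom R"
  obtains \<sigma> where "\<sigma> \<in> carrier gal_Q" "\<And>x y. (x, y) \<in> R \<Longrightarrow> \<sigma> x = y"
proof -
  obtain S where S: "partial_hom S" "R \<subseteq> S" "Domain S = UNIV"
    using partial_hom_total_extension[OF assms] .
  note unique = partial_hom_unique[OF S(1)]
  define \<sigma> where "\<sigma> x = (SOME y. (x, y) \<in> S)" for x
  have \<sigma>: "(x, \<sigma> x) \<in> S" for x
    unfolding \<sigma>_def using S(3) by (metis DomainE UNIV_I someI)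
  have \<sigma>_eq: "\<sigma> x = y" if "(x, y) \<in> S" for x y
    using unique[OF \<sigma> that] .
  have inj: "inj \<sigma>"
  proof (rule injI)
    fix x y assume "\<sigma> x = \<sigma> y"
    then have "(x - y, 0) \<in> S"
      using partial_hom_diff[OF S(1) \<sigma> \<sigma>, of x y] by simp
    then show "x = y"
      using partial_hom_inj[OF S(1), of "x - y"] by simp
  qed
  have "\<exists>x. \<sigma> x = y" for y
  proof -
    obtain p where p: "p \<noteq> 0" "poly (map_poly to_ac p) y = 0"
      by (rule alg_closure_algebraic)
    define Z where "Z = {z. poly (map_poly to_ac p) z = 0}"
    have "finite Z"
      unfolding Z_def using p(1) by (intro poly_roots_finite) (auto simp: poly_eq_iff coeff_map_poly)
    moreover have "\<sigma> ` Z \<subseteq> Z"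
    proof (clarsimp simp: Z_def)
      fix z assume "poly (map_poly to_ac p) z = 0"
      then show "poly (map_poly to_ac p) (\<sigma> z) = 0"
        using partial_hom_poly[OF S(1) coeffs_related_of_base[OF S(1)] \<sigma>, of p z]
          partial_hom_zeroD[OF S(1), of "poly (map_poly to_ac p) (\<sigma> z)"] by simp
    qed
    ultimately have "\<sigma> ` Z = Z"
      using inj by (meson endo_inj_surj inj_on_subset subset_UNIV)
    moreover have "y \<in> Z"
      using p(2) by (simp add: Z_def)
    ultimately show ?thesis
      by (metis imageE)
  qed
  then have "bij \<sigma>"
    using inj by (metis bijI surjI surj_def)
  then have "\<sigma> \<in> carrier gal_Q"
    unfolding gal_Q_def
    by (auto intro!: \<sigma>_eq partial_hom_add[OF S(1)] partial_hom_mult[OF S(1)] partial_hom_base[OF S(1)] \<sigma>)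
  then show ?thesis
    using that \<sigma>_eq S(2) by blast
qed

text \<open>If x is not rational, its minimal polynomial has another root y, and the embedding
  taking x to y extends to an automorphism that moves x.\<close>

theorem gal_Q_fixed_field:
  assumes fixed: "\<And>\<sigma>. \<sigma> \<in> carrier gal_Q \<Longrightarrow> \<sigma> x = x"
  shows "x \<in> range to_ac"
proof -
  define R :: "(Qbar \<times> Qbar) set" where "R = range (\<lambda>a. (to_ac a, to_ac a))"
  have mem: "(u, v) \<in> R \<longleftrightarrow> (\<exists>a. u = to_ac a \<and> v = to_ac a)" for u v
    unfolding R_def by (rule iffI) (erule imageE, simp, blast)
  have R: "partial_hom R"
    unfolding partial_hom_def mem
  proof (intro conjI allI impI)
    fix x y x' y' :: Qbar
    assume "\<exists>a. x = to_ac a \<and> y = to_ac a" "\<exists>a. x' = to_ac a \<and> y' = to_ac a"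
    then obtain a b where "x = to_ac a" "y = to_ac a" "x' = to_ac b" "y' = to_ac b"
      by blast
    then have "x + x' = to_ac (a + b) \<and> y + y' = to_ac (a + b)"
      "x * x' = to_ac (a * b) \<and> y * y' = to_ac (a * b)" by simp_all
    then show "\<exists>a. x + x' = to_ac a \<and> y + y' = to_ac a" "\<exists>a. x * x' = to_ac a \<and> y * y' = to_ac a"
      by blast+
  next
    fix y :: Qbar assume "\<exists>a. 0 = to_ac a \<and> y = to_ac a"
    then show "y = 0" by auto
  qed blast
  obtain m m' where m: "coeffs_related R m m'" "m \<noteq> 0" "poly m x = 0"
    and min: "\<And>q q'. coeffs_related R q q' \<Longrightarrow> q \<noteq> 0 \<Longrightarrow> poly q x = 0 \<Longrightarrow>
       Polynomial.degree m \<le> Polynomial.degree q"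
    by (rule obtains_minimal_related[OF R, of x]) blast
  have mm: "Polynomial.coeff m i = Polynomial.coeff m' i \<and> Polynomial.coeff m i \<in> range to_ac" for i
    using m(1) unfolding coeffs_related_def mem by (metis rangeI)
  \<comment> \<open>\<open>R\<close> is the identity on the base field, so related coefficients are
    equal.\<close>
  have m': "m' = m"
    by (rule poly_eqI) (use mm in metis)
  obtain q where q: "m = [:- x, 1:] * q"
    using m(3) unfolding poly_eq_0_iff_dvd by (rule dvdE)
  show ?thesis
  proof (cases "Polynomial.degree q = 0")
    case True
    then obtain c where "q = [:c:]" by (rule degree_eq_zeroE)
    with q m(2) have c: "c \<noteq> 0" "m = [:- x * c, c:]" by auto
    have "Polynomial.coeff m 1 = c" "Polynomial.coeff m 0 = - x * c"
      by (simp_all add: c(2))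
    then obtain a b where ab: "c = to_ac a" "- x * c = to_ac b"
      using mm[of 0] mm[of 1] by (metis imageE)
    have "x = - (- x * c) / c"
      using c(1) by simp
    then have "x = to_ac (- b / a)"
      unfolding ab(2) unfolding ab(1) by simp
    then show ?thesis by blast
  next
    case False
    then obtain y where y: "poly q y = 0"
      using alg_closed_imp_poly_has_root[of q] by blast
    \<comment> \<open>Separability: a double root of m would also be a root of its derivative, a
      nonzero polynomial of smaller degree over the base field.\<close>
    have "y \<noteq> x"
    proof
      assume "y = x"
      have "poly (pderiv m) x = 0"
        using y unfolding \<open>y = x\<close> q pderiv_mult by (simp add: pderiv_pCons)
      moreover have "coeffs_related R (pderiv m) (pderiv m)"
      proof -
        have "\<exists>a. Polynomial.coeff (pderiv m) i = to_ac a" for i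
        proof -
          obtain a where "Polynomial.coeff m (Suc i) = to_ac a" using mm by blast
          then have "Polynomial.coeff (pderiv m) i = to_ac (of_nat (Suc i) * a)"
            unfolding coeff_pderiv to_ac_mult to_ac_of_nat by simp
          then show ?thesis by blast
        qed
        then show ?thesis
          unfolding coeffs_related_def mem by simp
      qed
      moreover have "Polynomial.degree m \<noteq> 0"
        using degree_pos_if_root[OF m(2,3)] by simp
      ultimately show False
        using min[of "pderiv m" "pderiv m"] degree_pderiv[of m] by (simp add: pderiv_eq_0_iff)
    qed
    moreover have "poly m' y = 0"
      using y by (simp add: m' q)
    then obtain S where "partial_hom S" "(x, y) \<in> S"
      using partial_hom_extend[OF R m, of y] min by blast
    then obtain \<sigma> where "\<sigma> \<in> carrier gal_Q" "\<sigma> x = y"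
      using partial_hom_in_gal_Q by blast
    ultimately show ?thesis
      using fixed by blast
  qed
qed

section \<open>Chords and flexes of a Weierstrass curve\<close>

definition ec_neg :: "'a :: field weierstrass \<Rightarrow> 'a ec_point \<Rightarrow> 'a ec_point" where
  "ec_neg E P = (case P of Infinity \<Rightarrow> Infinity | Affine x y \<Rightarrow> Affine x (- y - wa1 E * x - wa3 E))"

lemma ec_neg_simps [simp]:
  "ec_neg E Infinity = Infinity"
  "ec_neg E (Affine x y) = Affine x (- y - wa1 E * x - wa3 E)"
  by (simp_all add: ec_neg_def)

lemma ec_neg_neg [simp]: "ec_neg E (ec_neg E P) = P"
  by (cases P) simp_all

lemma ec_add_Infinity_right [simp]: "ec_add E P Infinity = P"
  by (cases P) simp_all

lemma Infinity_in_ec_points [simp]: "Infinity \<in> ec_points E"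
  by (simp add: ec_points_def)

lemma Affine_in_ec_points:
  "Affine x y \<in> ec_points E \<longleftrightarrow>
     y ^ 2 + wa1 E * x * y + wa3 E * y = x ^ 3 + wa2 E * x ^ 2 + wa4 E * x + wa6 E"
  by (auto simp: ec_points_def)

lemma ec_neg_in_ec_points: "P \<in> ec_points E \<Longrightarrow> ec_neg E P \<in> ec_points E"
proof (cases P)
  case (Affine x y)
  assume "P \<in> ec_points E"
  then have "(- y - wa1 E * x - wa3 E) ^ 2 + wa1 E * x * (- y - wa1 E * x - wa3 E) + wa3 E * (- y - wa1 E * x - wa3 E) =
      x ^ 3 + wa2 E * x ^ 2 + wa4 E * x + wa6 E"
    unfolding Affine Affine_in_ec_points by Groebner_Basis.algebra
  then show ?thesis
    by (simp add: Affine Affine_in_ec_points)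
qed simp

lemma ec_add_neg [simp]: "ec_add E P (ec_neg E P) = Infinity" "ec_add E (ec_neg E P) P = Infinity"
  by (cases P; simp)+

lemma ec_add_eq_Infinity: "ec_add E P Q = Infinity \<Longrightarrow> P = ec_neg E Q"
  by (cases P; cases Q) (auto simp: Let_def algebra_simps eq_neg_iff_add_eq_0 split: if_splits)

lemma ec_points_same_x:
  assumes "Affine x y \<in> ec_points E" "Affine x y' \<in> ec_points E"
  shows "Affine x y' = Affine x y \<or> Affine x y' = ec_neg E (Affine x y)"
proof -
  have "(y - y') * (y + y' + wa1 E * x + wa3 E) = 0"
    using assms unfolding Affine_in_ec_points by Groebner_Basis.algebra
  then consider "y' = y" | "y + y' + wa1 E * x + wa3 E = 0"
    by auto
  then show ?thesis
  proof cases
    case 2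
    then have "y' = - y - wa1 E * x - wa3 E"
      by Groebner_Basis.algebra
    then show ?thesis by simp
  qed simp
qed

text \<open>The second point enters only through its x-coordinate, so that the chord and the tangent
  case become instances of one formula in the slope l.\<close>

definition ec_line :: "'a :: field weierstrass \<Rightarrow> 'a \<Rightarrow> 'a \<Rightarrow> 'a \<Rightarrow> 'a \<Rightarrow> 'a ec_point" where
  "ec_line E l x1 y1 x2 = (let x3 = l ^ 2 + wa1 E * l - wa2 E - x1 - x2
     in Affine x3 (- (l + wa1 E) * x3 - (y1 - l * x1) - wa3 E))"

lemma ec_add_chord:
  "x1 \<noteq> x2 \<Longrightarrow> ec_add E (Affine x1 y1) (Affine x2 y2) = ec_line E ((y2 - y1) / (x2 - x1)) x1 y1 x2"
  by (simp add: ec_line_def Let_def)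

lemma ec_add_tangent:
  assumes "2 * y1 + wa1 E * x1 + wa3 E \<noteq> 0"
  shows "ec_add E (Affine x1 y1) (Affine x1 y1) =
    ec_line E ((3 * x1 ^ 2 + 2 * wa2 E * x1 + wa4 E - wa1 E * y1) / (2 * y1 + wa1 E * x1 + wa3 E)) x1 y1 x1"
proof -
  have "y1 + y1 + wa1 E * x1 + wa3 E \<noteq> 0"
    using assms unfolding mult_2 .
  then show ?thesis
    by (simp only: ec_add.simps ec_line_def Let_def simp_thms if_False if_True)
qed

lemma ec_add_flex_nonzero:
  assumes "ec_add E (Affine x y) (Affine x y) = ec_neg E (Affine x y)"
  shows "2 * y + wa1 E * x + wa3 E \<noteq> 0"
proof
  assume "2 * y + wa1 E * x + wa3 E = 0"
  then have "y + y + wa1 E * x + wa3 E = 0"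
    unfolding mult_2 .
  then have "ec_add E (Affine x y) (Affine x y) = Infinity"
    unfolding ec_add.simps by (simp only: simp_thms if_True)
  then show False
    using assms by simp
qed

text \<open>Negation is an affine linear map of the plane, so it takes the line of slope l to a
  line, of slope -l - a1.\<close>

lemma ec_neg_line:
  "ec_neg E (ec_line E l x1 y1 x2) = ec_line E (- l - wa1 E) x1 (- y1 - wa1 E * x1 - wa3 E) x2"
proof -
  have "(- l - wa1 E) ^ 2 + wa1 E * (- l - wa1 E) = l ^ 2 + wa1 E * l"
    by Groebner_Basis.algebra
  then show ?thesis
    unfolding ec_line_def Let_def ec_neg_simps by (simp only: ec_point.inject) (simp add: algebra_simps)
qed

lemma ec_add_neg_neg:
  assumes "P \<in> ec_points E" "Q \<in> ec_points E"
  shows "ec_add E (ec_neg E P) (ec_neg E Q) = ec_neg E (ec_add E P Q)"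
proof (cases P; cases Q)
  fix x1 y1 x2 y2
  assume eq: "P = Affine x1 y1" "Q = Affine x2 y2"
  let ?n = "\<lambda>x y. - y - wa1 E * x - wa3 E"
  show ?thesis
  proof (cases "x1 = x2")
    case True
    from assms consider "Q = P" | "Q = ec_neg E P"
      using ec_points_same_x unfolding eq True by blast
    then show ?thesis
    proof cases
      case 1
      define D where "D = 2 * y1 + wa1 E * x1 + wa3 E"
      define N where "N = 3 * x1 ^ 2 + 2 * wa2 E * x1 + wa4 E - wa1 E * y1"
      have *: "2 * ?n x1 y1 + wa1 E * x1 + wa3 E = - D"
        "3 * x1 ^ 2 + 2 * wa2 E * x1 + wa4 E - wa1 E * ?n x1 y1 = N + wa1 E * D"
        unfolding D_def N_def by Groebner_Basis.algebra+
      show ?thesis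
      proof (cases "D = 0")
        case True
        then have "?n x1 y1 = y1"
          unfolding D_def by Groebner_Basis.algebra
        then have "ec_neg E P = P" by (simp add: eq)
        then show ?thesis
          using ec_add_neg(1)[of E P] unfolding 1 by simp
      next
        case False
        then have l: "(N + wa1 E * D) / - D = - (N / D) - wa1 E"
          by (simp add: field_simps)
        have "ec_add E P P = ec_line E (N / D) x1 y1 x1"
          using ec_add_tangent[of y1 E x1] False unfolding eq N_def D_def by blast
        moreover have "ec_add E (ec_neg E P) (ec_neg E P) = ec_line E ((N + wa1 E * D) / - D) x1 (?n x1 y1) x1"
          using ec_add_tangent[of "?n x1 y1" E x1] False unfolding eq ec_neg_simps * by simp
        ultimately show ?thesis
          unfolding 1 by (simp only: ec_neg_line l)
      qed
    qed simp
  next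
    case False
    have "(?n x2 y2 - ?n x1 y1) / (x2 - x1) = - ((y2 - y1) / (x2 - x1)) - wa1 E"
      using False by (simp add: field_simps)
    then show ?thesis
      unfolding eq ec_neg_simps ec_add_chord[OF False] ec_neg_line by simp
  qed
qed simp_all

text \<open>Distinct x-coordinates are part of the notion: they exclude vertical lines and tangents,
  so that every sum of two of the points is given by the chord formula.\<close>

fun ec_collinear :: "'a :: field ec_point \<Rightarrow> 'a ec_point \<Rightarrow> 'a ec_point \<Rightarrow> bool" where
  "ec_collinear (Affine x1 y1) (Affine x2 y2) (Affine x3 y3) \<longleftrightarrow>
     x1 \<noteq> x2 \<and> x1 \<noteq> x3 \<and> x2 \<noteq> x3 \<and> (y2 - y1) * (x3 - x1) = (y3 - y1) * (x2 - x1)"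
| "ec_collinear _ _ _ \<longleftrightarrow> False"

lemma ec_collinear_sym:
  assumes "ec_collinear P Q R"
  shows "ec_collinear Q P R" "ec_collinear P R Q"
  using assms by (cases P; cases Q; cases R; auto simp: algebra_simps)+

lemma ec_collinear_neg:
  assumes "ec_collinear P Q R"
  shows "ec_collinear (ec_neg E P) (ec_neg E Q) (ec_neg E R)"
  using assms by (cases P; cases Q; cases R; auto simp: algebra_simps)

text \<open>Substituting the line into the curve gives a cubic with roots x1, x2, x3. Successive
  divided differences yield the sum of the roots, from which the chord formula computes its third
  point.\<close>

lemma ec_collinear_add:
  assumes "ec_collinear P Q R" "P \<in> ec_points E" "Q \<in> ec_points E" "R \<in> ec_points E"
  shows "ec_add E P Q = ec_neg E R"
proof -
  from assms(1) obtain x1 y1 x2 y2 x3 y3 where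
    eq: "P = Affine x1 y1" "Q = Affine x2 y2" "R = Affine x3 y3" and
    ne: "x1 \<noteq> x2" "x1 \<noteq> x3" "x2 \<noteq> x3" and
    col: "(y2 - y1) * (x3 - x1) = (y3 - y1) * (x2 - x1)"
    by (cases P; cases Q; cases R; auto)
  define l where "l = (y2 - y1) / (x2 - x1)"
  define m where "m = y1 - l * x1"
  have l: "l * (x2 - x1) = y2 - y1"
    using ne by (simp add: l_def)
  then have "(x2 - x1) * (y3 - (l * x3 + m)) = 0"
    using col unfolding m_def by Groebner_Basis.algebra
  then have "y3 = l * x3 + m"
    using ne by simp
  moreover have "y1 = l * x1 + m"
    by (simp add: m_def)
  moreover have "y2 = l * x2 + m"
    using l unfolding m_def by Groebner_Basis.algebra
  ultimately have y: "y1 = l * x1 + m" "y2 = l * x2 + m" "y3 = l * x3 + m"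
    by blast+
  define s where "s = l ^ 2 + wa1 E * l - wa2 E"
  define t where "t = 2 * l * m + wa1 E * m + wa3 E * l - wa4 E"
  have pt: "x ^ 3 - s * x ^ 2 - t * x = m ^ 2 + wa3 E * m - wa6 E"
    if "Affine x (l * x + m) \<in> ec_points E" for x
    using that unfolding Affine_in_ec_points s_def t_def by Groebner_Basis.algebra
  have c: "x1 ^ 3 - s * x1 ^ 2 - t * x1 = m ^ 2 + wa3 E * m - wa6 E"
    "x2 ^ 3 - s * x2 ^ 2 - t * x2 = m ^ 2 + wa3 E * m - wa6 E"
    "x3 ^ 3 - s * x3 ^ 2 - t * x3 = m ^ 2 + wa3 E * m - wa6 E"
    using assms(2-4) pt unfolding eq y by blast+
  have "(x1 - x2) * (x1 ^ 2 + x1 * x2 + x2 ^ 2 - s * (x1 + x2) - t) = 0"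
    using c by Groebner_Basis.algebra
  then have d: "x1 ^ 2 + x1 * x2 + x2 ^ 2 - s * (x1 + x2) - t = 0"
    using ne by simp
  have "(x1 - x3) * (x1 ^ 2 + x1 * x3 + x3 ^ 2 - s * (x1 + x3) - t) = 0"
    using c by Groebner_Basis.algebra
  then have "x1 ^ 2 + x1 * x3 + x3 ^ 2 - s * (x1 + x3) - t = 0"
    using ne by simp
  with d have "(x2 - x3) * (x1 + x2 + x3 - s) = 0"
    by Groebner_Basis.algebra
  then have "x1 + x2 + x3 - s = 0"
    using ne by simp
  then have x3: "s - x1 - x2 = x3"
    by Groebner_Basis.algebra
  show ?thesis
    unfolding eq ec_add_chord[OF ne(1)] l_def[symmetric] ec_line_def Let_def ec_neg_simps
      x3[unfolded s_def] m_def[symmetric]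
    by (simp add: y(3) algebra_simps)
qed

lemma ec_add_collinear:
  assumes "x1 \<noteq> x2" "x1 \<noteq> x3" "x2 \<noteq> x3" "ec_add E (Affine x1 y1) (Affine x2 y2) = Affine x3 y3"
  shows "ec_collinear (Affine x1 y1) (Affine x2 y2) (ec_neg E (Affine x3 y3))"
proof -
  define l where "l = (y2 - y1) / (x2 - x1)"
  have l: "y2 - y1 = l * (x2 - x1)"
    using assms(1) by (simp add: l_def)
  have "y3 = - (l + wa1 E) * x3 - (y1 - l * x1) - wa3 E"
    using assms(4) unfolding ec_add_chord[OF assms(1)] l_def[symmetric] ec_line_def Let_def ec_point.inject
    by (elim conjE) (hypsubst, rule refl)
  then have "- y3 - wa1 E * x3 - wa3 E - y1 = l * (x3 - x1)"
    by Groebner_Basis.algebra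
  then have "(y2 - y1) * (x3 - x1) = (- y3 - wa1 E * x3 - wa3 E - y1) * (x2 - x1)"
    using l by Groebner_Basis.algebra
  then show ?thesis
    using assms(1-3) by simp
qed

text \<open>
  In coordinates in which the flex \<open>P\<close> is the origin and its tangent is the \<open>x\<close>-axis, the curve is
  \<open>v (v + \<alpha> u + \<beta>) = u\<^sup>3\<close>; the chords through \<open>\<plusminus>Q = (u, v), (u, v')\<close> are then explicit since \<open>v v' = - u\<^sup>3\<close>.
\<close>

lemma flex_collinear:
  assumes P: "Affine x1 y1 \<in> ec_points E" and Q: "Affine x2 y2 \<in> ec_points E"
    and flex: "ec_add E (Affine x1 y1) (Affine x1 y1) = ec_neg E (Affine x1 y1)"
    and R: "ec_add E (Affine x1 y1) (Affine x2 y2) = Affine x3 y3"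
    and S: "ec_add E (Affine x1 y1) (ec_neg E (Affine x2 y2)) = Affine x4 y4"
    and ne: "x1 \<noteq> x2" "x1 \<noteq> x3" "x1 \<noteq> x4" "x3 \<noteq> x4"
  shows "ec_collinear (Affine x1 y1) (Affine x3 y3) (Affine x4 y4)"
proof -
  define D where "D = 2 * y1 + wa1 E * x1 + wa3 E"
  define l where "l = (3 * x1 ^ 2 + 2 * wa2 E * x1 + wa4 E - wa1 E * y1) / D"
  have D: "D \<noteq> 0"
    using ec_add_flex_nonzero[OF flex] by (simp add: D_def)
  then have l: "D * l = 3 * x1 ^ 2 + 2 * wa2 E * x1 + wa4 E - wa1 E * y1"
    by (simp add: l_def)
  \<comment> \<open>The tangent at a flex meets the curve there three times, so the x-coordinates of
    the intersection points sum to 3 \<open>x1\<close>.\<close>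
  have x1: "l ^ 2 + wa1 E * l - wa2 E = 3 * x1"
  proof -
    have "l ^ 2 + wa1 E * l - wa2 E - x1 - x1 = x1"
      using flex unfolding ec_add_tangent[OF D[unfolded D_def]] D_def[symmetric] l_def[symmetric]
        ec_line_def Let_def ec_neg_simps by (simp only: ec_point.inject)
    then show ?thesis by (simp add: algebra_simps)
  qed
  define u where "u = x2 - x1"
  define v where "v = y2 - y1 - l * u"
  define v' where "v' = - v - (wa1 E + 2 * l) * u - D"
  have u: "u \<noteq> 0" using ne by (simp add: u_def)
  have vv': "v * v' = - (u ^ 3)"
  proof -
    have "y2 = y1 + l * u + v" "x2 = x1 + u"
      by (simp_all add: u_def v_def)
    then show ?thesis
      using P Q x1 l unfolding Affine_in_ec_points v'_def D_def by Groebner_Basis.algebra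
  qed
  define k where "k = (y2 - y1) / u"
  define k' where "k' = (- y2 - wa1 E * x2 - wa3 E - y1) / u"
  have "u * k = v + l * u"
    using u by (simp add: k_def v_def)
  moreover have "u * k' = v' + l * u"
  proof -
    have "u * k' = - y2 - wa1 E * x2 - wa3 E - y1"
      using u by (simp add: k'_def)
    also have "\<dots> = v' + l * u"
      unfolding v'_def v_def D_def u_def by Groebner_Basis.algebra
    finally show ?thesis .
  qed
  ultimately have k: "u * k = v + l * u" "u * k' = v' + l * u"
    by blast+
  have x3: "x3 = k ^ 2 + wa1 E * k - wa2 E - x1 - x2" and y3: "y3 = - (k + wa1 E) * x3 - (y1 - k * x1) - wa3 E"
    using R unfolding ec_add_chord[OF ne(1)] u_def[symmetric] k_def[symmetric] ec_line_def Let_def ec_point.inject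
    by (elim conjE, hypsubst, intro refl)+
  have x4: "x4 = k' ^ 2 + wa1 E * k' - wa2 E - x1 - x2" and y4: "y4 = - (k' + wa1 E) * x4 - (y1 - k' * x1) - wa3 E"
    using S unfolding ec_neg_simps ec_add_chord[OF ne(1)] u_def[symmetric] k'_def[symmetric] ec_line_def Let_def ec_point.inject
    by (elim conjE, hypsubst, intro refl)+
  have X3: "u ^ 2 * (x3 - x1) = - D * v"
  proof -
    have "u ^ 2 * (x3 - x1) = (u * k) ^ 2 + wa1 E * u * (u * k) - (wa2 E + 3 * x1 + u) * u ^ 2"
      unfolding x3 by (simp add: u_def algebra_simps power2_eq_square)
    then show ?thesis
      using vv' x1 unfolding k v'_def by Groebner_Basis.algebra
  qed
  have X4: "u ^ 2 * (x4 - x1) = - D * v'"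
  proof -
    have "u ^ 2 * (x4 - x1) = (u * k') ^ 2 + wa1 E * u * (u * k') - (wa2 E + 3 * x1 + u) * u ^ 2"
      unfolding x4 by (simp add: u_def algebra_simps power2_eq_square)
    then show ?thesis
      using vv' x1 unfolding k v'_def by Groebner_Basis.algebra
  qed
  have Y: "y3 - y1 = - (k + wa1 E) * (x3 - x1) - D" "y4 - y1 = - (k' + wa1 E) * (x4 - x1) - D"
    unfolding D_def using y3 y4 by Groebner_Basis.algebra+
  \<comment> \<open>Collinearity amounts to this identity between the slopes k and k'. The factor
    u^5 clears the denominator u of k - k' and the denominators u^2 of x3 - x1 and x4 - x1.\<close>
  have "u ^ 5 * ((k - k') * (x3 - x1) * (x4 - x1)) = (u * k - u * k') * (u ^ 2 * (x3 - x1)) * (u ^ 2 * (x4 - x1))"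
    by Groebner_Basis.algebra
  also have "\<dots> = (v - v') * D ^ 2 * (v * v')"
    unfolding X3 X4 k by Groebner_Basis.algebra
  also have "\<dots> = u ^ 3 * (D * (- D * v - (- D * v')))"
    unfolding vv' by Groebner_Basis.algebra
  also have "\<dots> = u ^ 5 * (D * (x3 - x4))"
    unfolding X3 [symmetric] X4 [symmetric] by Groebner_Basis.algebra
  finally have "(k - k') * (x3 - x1) * (x4 - x1) = D * (x3 - x4)"
    using u by simp
  then have "(y3 - y1) * (x4 - x1) = (y4 - y1) * (x3 - x1)"
    unfolding Y by Groebner_Basis.algebra
  then show ?thesis
    using ne by simp
qed

section \<open>Arithmetic in F_3 and in the plane F_3^2\<close>

lemma F3_cases: "(a :: F3) = 0 \<or> a = 1 \<or> a = 2"
  using exhaust_3[of a] by auto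

lemma F3_all: "(\<forall>a :: F3. P a) \<longleftrightarrow> P 0 \<and> P 1 \<and> P 2"
  using F3_cases by metis

lemma F3_reduce: "(3 :: F3) = 0" "(4 :: F3) = 1" "(- 1 :: F3) = 2" "(- 2 :: F3) = 1"
  by simp_all

definition v2 :: "'a \<Rightarrow> 'a \<Rightarrow> 'a ^ 2" where
  "v2 a b = (\<chi> i. if i = 1 then a else b)"

lemma v2_nth [simp]: "v2 a b $ 1 = a" "v2 a b $ 2 = b"
  by (simp_all add: v2_def)

lemma v2_eta [simp]: "v2 (u $ 1) (u $ 2) = u"
  by (simp add: v2_def vec_eq_iff forall_2)

lemma v2_eq_iff [simp]: "v2 a b = v2 c d \<longleftrightarrow> a = c \<and> b = d"
  by (auto simp: vec_eq_iff forall_2)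

lemma v2_add: "v2 a b + v2 c d = v2 (a + c) (b + d)"
  by (simp add: vec_eq_iff forall_2)

lemma v2_all: "(\<forall>u. P u) \<longleftrightarrow> (\<forall>a b. P (v2 a b))"
  by (metis v2_eta)

text \<open>The scalar 2 is -1 in F_3 and is read as negation; for a point with 2P = -P this agrees
  with doubling.\<close>

definition ec_mul3 :: "'a :: field weierstrass \<Rightarrow> F3 \<Rightarrow> 'a ec_point \<Rightarrow> 'a ec_point" where
  "ec_mul3 E c P = (if c = 0 then Infinity else if c = 1 then P else ec_neg E P)"

definition ec_comb :: "'a :: field weierstrass \<Rightarrow> 'a ec_point \<Rightarrow> 'a ec_point \<Rightarrow> F3 ^ 2 \<Rightarrow> 'a ec_point" where
  "ec_comb E P Q u = ec_add E (ec_mul3 E (u $ 1) P) (ec_mul3 E (u $ 2) Q)"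

lemma ec_collinear_sums:
  assumes "ec_collinear A B C" "A \<in> ec_points E" "B \<in> ec_points E" "C \<in> ec_points E"
  shows "ec_add E A B = ec_neg E C" "ec_add E B A = ec_neg E C"
    "ec_add E A C = ec_neg E B" "ec_add E C A = ec_neg E B"
    "ec_add E B C = ec_neg E A" "ec_add E C B = ec_neg E A"
proof -
  note c = assms(1) ec_collinear_sym[OF assms(1)]
  note c' = c ec_collinear_sym[OF c(2)] ec_collinear_sym[OF c(3)]
  note c'' = c' ec_collinear_sym[OF c'(5)] ec_collinear_sym[OF c'(6)]
  show "ec_add E A B = ec_neg E C" "ec_add E B A = ec_neg E C"
    "ec_add E A C = ec_neg E B" "ec_add E C A = ec_neg E B"
    "ec_add E B C = ec_neg E A" "ec_add E C B = ec_neg E A"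
    using c'' assms(2-4) by (metis ec_collinear_add)+
qed

lemma ec_add_commute:
  assumes "P \<in> ec_points E" "Q \<in> ec_points E"
  shows "ec_add E P Q = ec_add E Q P"
proof (cases P; cases Q)
  fix x1 y1 x2 y2
  assume eq: "P = Affine x1 y1" "Q = Affine x2 y2"
  show ?thesis
  proof (cases "x1 = x2")
    case True
    then have "Q = P \<or> Q = ec_neg E P"
      using assms ec_points_same_x unfolding eq by blast
    then show ?thesis by auto
  next
    case False
    define l where "l = (y2 - y1) / (x2 - x1)"
    have l: "(y1 - y2) / (x1 - x2) = l"
      using False by (simp add: l_def field_simps)
    have "l * (x2 - x1) = y2 - y1"
      using False by (simp add: l_def)
    then have "y1 - l * x1 = y2 - l * x2"
      by Groebner_Basis.algebra
    then show ?thesis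
      unfolding eq ec_add_chord[OF False] ec_add_chord[OF False[symmetric]] l l_def[symmetric] ec_line_def Let_def
      by (simp add: algebra_simps)
  qed
qed simp_all

lemma ec_add_same_x:
  assumes "P \<in> ec_points E" "Q \<in> ec_points E" "P = Affine x y" "Q = Affine x' y'" "Q \<noteq> P" "Q \<noteq> ec_neg E P"
  shows "x \<noteq> x'"
  using assms ec_points_same_x by blast

text \<open>This is what a basis of E[3] provides before any group structure is known: nine distinct
  points of the curve, each the negative of its own double.\<close>

locale flex_basis =
  fixes E :: "'a :: field_char_0 weierstrass" and P Q :: "'a ec_point"
  assumes inj: "inj (ec_comb E P Q)"
    and pts: "\<And>u. ec_comb E P Q u \<in> ec_points E"
    and flex: "\<And>u. ec_add E (ec_comb E P Q u) (ec_comb E P Q u) = ec_neg E (ec_comb E P Q u)"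
begin

lemma ec_comb_table:
  defines "R \<equiv> ec_add E P Q" and "S \<equiv> ec_add E P (ec_neg E Q)"
  shows "ec_comb E P Q (v2 0 0) = Infinity" 
    "ec_comb E P Q (v2 1 0) = P" "ec_comb E P Q (v2 2 0) = ec_neg E P"
    "ec_comb E P Q (v2 0 1) = Q" "ec_comb E P Q (v2 0 2) = ec_neg E Q"
    "ec_comb E P Q (v2 1 1) = R" "ec_comb E P Q (v2 2 2) = ec_neg E R"
    "ec_comb E P Q (v2 1 2) = S" "ec_comb E P Q (v2 2 1) = ec_neg E S"
proof -
  have PQ: "P \<in> ec_points E" "Q \<in> ec_points E"
    using pts[of "v2 1 0"] pts[of "v2 0 1"] by (simp_all add: ec_comb_def ec_mul3_def)
  show "ec_comb E P Q (v2 0 0) = Infinity" 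
    "ec_comb E P Q (v2 1 0) = P" "ec_comb E P Q (v2 2 0) = ec_neg E P"
    "ec_comb E P Q (v2 0 1) = Q" "ec_comb E P Q (v2 0 2) = ec_neg E Q"
    "ec_comb E P Q (v2 1 1) = R" "ec_comb E P Q (v2 1 2) = S"
    by (simp_all add: ec_comb_def ec_mul3_def R_def S_def)
  show "ec_comb E P Q (v2 2 2) = ec_neg E R"
    unfolding R_def ec_add_neg_neg[OF PQ, symmetric] by (simp add: ec_comb_def ec_mul3_def)
  show "ec_comb E P Q (v2 2 1) = ec_neg E S"
    unfolding S_def ec_add_neg_neg[OF PQ(1) ec_neg_in_ec_points[OF PQ(2)], symmetric]
    by (simp add: ec_comb_def ec_mul3_def)
qed

lemma ec_comb_distinct:
  "ec_comb E P Q (v2 a b) = ec_comb E P Q (v2 c d) \<longleftrightarrow> a = c \<and> b = d"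
  using inj by (auto dest: injD)

text \<open>Three of the points add up to zero when their coordinate vectors form an affine line of
  F_3^2. Of the twelve lines, the four through the origin are the triples \<open>Infinity\<close>,
  X, -X. The other eight are \<open>c1\<close> to \<open>c4\<close> and their negatives. Together
  with 2X = -X they fill the whole addition table.\<close>

lemma ec_comb_add: "ec_comb E P Q (u + v) = ec_add E (ec_comb E P Q u) (ec_comb E P Q v)"
proof -
  define R where "R = ec_add E P Q"
  define S where "S = ec_add E P (ec_neg E Q)"
  note tab = ec_comb_table[folded R_def S_def]
  have P: "P \<in> ec_points E" and Q: "Q \<in> ec_points E" and R: "R \<in> ec_points E" and S: "S \<in> ec_points E"
    using pts[of "v2 1 0"] pts[of "v2 0 1"] pts[of "v2 1 1"] pts[of "v2 1 2"] unfolding tab by blast+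
  note neg = ec_neg_in_ec_points
  have dbl: "ec_add E P P = ec_neg E P" "ec_add E Q Q = ec_neg E Q"
    "ec_add E R R = ec_neg E R" "ec_add E S S = ec_neg E S"
    using flex[of "v2 1 0"] flex[of "v2 0 1"] flex[of "v2 1 1"] flex[of "v2 1 2"] unfolding tab by blast+
  have dbl': "ec_add E (ec_neg E P) (ec_neg E P) = P" "ec_add E (ec_neg E Q) (ec_neg E Q) = Q"
    "ec_add E (ec_neg E R) (ec_neg E R) = R" "ec_add E (ec_neg E S) (ec_neg E S) = S"
    using P Q R S dbl by (simp_all add: ec_add_neg_neg)
  have ne: "P \<noteq> Infinity" "Q \<noteq> Infinity" "R \<noteq> Infinity" "S \<noteq> Infinity"
    using ec_comb_distinct[of 1 0 0 0] ec_comb_distinct[of 0 1 0 0]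
      ec_comb_distinct[of 1 1 0 0] ec_comb_distinct[of 1 2 0 0] unfolding tab by simp_all
  obtain xp yp xq yq xr yr xs ys where eq: "P = Affine xp yp" "Q = Affine xq yq" "R = Affine xr yr" "S = Affine xs ys"
    using ne by (metis ec_point.exhaust)
  have x: "xp \<noteq> xq" "xp \<noteq> xr" "xp \<noteq> xs" "xq \<noteq> xr" "xq \<noteq> xs" "xr \<noteq> xs"
    using ec_comb_distinct[of 0 1 1 0] ec_comb_distinct[of 0 1 2 0]
      ec_add_same_x[OF P Q eq(1,2)]
      ec_comb_distinct[of 1 1 1 0] ec_comb_distinct[of 1 1 2 0]
      ec_add_same_x[OF P R eq(1,3)]
      ec_comb_distinct[of 1 2 1 0] ec_comb_distinct[of 1 2 2 0]
      ec_add_same_x[OF P S eq(1,4)]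
      ec_comb_distinct[of 1 1 0 1] ec_comb_distinct[of 1 1 0 2]
      ec_add_same_x[OF Q R eq(2,3)]
      ec_comb_distinct[of 1 2 0 1] ec_comb_distinct[of 1 2 0 2]
      ec_add_same_x[OF Q S eq(2,4)]
      ec_comb_distinct[of 1 2 1 1] ec_comb_distinct[of 1 2 2 2]
      ec_add_same_x[OF R S eq(3,4)] unfolding tab by simp_all
  \<comment> \<open>This prepares \<open>flex_collinear\<close> with the roles of P and Q exchanged:
    Q + P = R and Q - P = -S.\<close>
  have SN: "ec_add E Q (ec_neg E P) = ec_neg E S"
    using P Q ec_add_neg_neg[of P E "ec_neg E Q"] ec_add_commute[of Q E "ec_neg E P"] neg[of P E] neg[of Q E]
    unfolding S_def by simp
  have c1: "ec_collinear P Q (ec_neg E R)"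
    unfolding eq by (rule ec_add_collinear) (use x R_def[unfolded eq] in auto)
  have c2: "ec_collinear P (ec_neg E Q) (ec_neg E S)"
    unfolding eq ec_neg_simps(2)[of E xq] by (rule ec_add_collinear) (use x S_def[unfolded eq] in auto)
  \<comment> \<open>\<open>c1\<close> and \<open>c2\<close> restate the definitions of R and S.
    \<open>c3\<close> and \<open>c4\<close> express 3P = 0 and 3Q = 0 and are where the flex
    property enters.\<close>
  have c3: "ec_collinear P R S"
    unfolding eq by (rule flex_collinear[OF P[unfolded eq] Q[unfolded eq]])
      (use x dbl(1) R_def S_def in \<open>auto simp: eq\<close>)
  have c4: "ec_collinear Q R (ec_neg E S)"
    unfolding eq ec_neg_simps
    by (rule flex_collinear[OF Q[unfolded eq] P[unfolded eq]])
      (use x dbl(2) R_def ec_add_commute[OF P Q] SN in \<open>auto simp: eq\<close>)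
  note sums =
    ec_collinear_sums[OF c1 P Q neg[OF R]] ec_collinear_sums[OF ec_collinear_neg[OF c1] neg[OF P] neg[OF Q] neg[OF neg[OF R]]]
    ec_collinear_sums[OF c2 P neg[OF Q] neg[OF S]] ec_collinear_sums[OF ec_collinear_neg[OF c2] neg[OF P] neg[OF neg[OF Q]] neg[OF neg[OF S]]]
    ec_collinear_sums[OF c3 P R S] ec_collinear_sums[OF ec_collinear_neg[OF c3] neg[OF P] neg[OF R] neg[OF S]]
    ec_collinear_sums[OF c4 Q R neg[OF S]] ec_collinear_sums[OF ec_collinear_neg[OF c4] neg[OF Q] neg[OF R] neg[OF neg[OF S]]]
  have "\<forall>u v. ec_comb E P Q (u + v) = ec_add E (ec_comb E P Q u) (ec_comb E P Q v)"
    unfolding v2_all v2_add F3_all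
    by (simp add: F3_reduce tab dbl dbl' sums[unfolded ec_neg_neg])
  then show ?thesis by blast
qed

lemma ec_comb_neg: "ec_comb E P Q (- u) = ec_neg E (ec_comb E P Q u)"
proof -
  have "ec_add E (ec_comb E P Q (- u)) (ec_comb E P Q u) = Infinity"
    using ec_comb_add[of "- u" u] ec_comb_table(1) by (simp add: v2_def zero_vec_def)
  then show ?thesis by (rule ec_add_eq_Infinity)
qed

end

section \<open>The resolvents of the 3-division polynomial\<close>

text \<open>Divided differences replace a factorization: \<open>g\<close> and \<open>h\<close> are
  the first and second divided differences of the quartic, and the third one gives the sum of the
  roots.\<close>

lemma quartic_vieta:
  fixes c0 :: "'a :: field"
  assumes f: "\<forall>x\<in>{x1, x2, x3, x4}. c4 * x ^ 4 + c3 * x ^ 3 + c2 * x ^ 2 + c1 * x + c0 = 0"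
    and ne: "x1 \<noteq> x2" "x1 \<noteq> x3" "x1 \<noteq> x4" "x2 \<noteq> x3" "x2 \<noteq> x4" "x3 \<noteq> x4"
  shows "c3 = - c4 * (x1 + x2 + x3 + x4)"
    and "c2 = c4 * (x1 * x2 + x1 * x3 + x1 * x4 + x2 * x3 + x2 * x4 + x3 * x4)"
    and "c1 = - c4 * (x1 * x2 * x3 + x1 * x2 * x4 + x1 * x3 * x4 + x2 * x3 * x4)"
    and "c0 = c4 * (x1 * x2 * x3 * x4)"
proof -
  define g where "g x y = c4 * (x ^ 3 + x ^ 2 * y + x * y ^ 2 + y ^ 3) + c3 * (x ^ 2 + x * y + y ^ 2) + c2 * (x + y) + c1" for x y
  have g: "g x y = 0" if "x \<in> {x1, x2, x3, x4}" "y \<in> {x1, x2, x3, x4}" "x \<noteq> y" for x y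
  proof -
    have "(x - y) * g x y = 0"
      using f[rule_format, OF that(1)] f[rule_format, OF that(2)] unfolding g_def by Groebner_Basis.algebra
    then show ?thesis using that by simp
  qed
  define h where "h x y z = c4 * (x ^ 2 + y ^ 2 + z ^ 2 + x * y + x * z + y * z) + c3 * (x + y + z) + c2" for x y z
  have h: "h x1 x2 z = 0" if "z \<in> {x3, x4}" for z
  proof -
    have "g x1 x2 = 0" "g x1 z = 0" "x2 \<noteq> z"
      using that ne by (auto intro!: g)
    then have "(x2 - z) * h x1 x2 z = 0"
      unfolding g_def h_def by Groebner_Basis.algebra
    then show ?thesis using \<open>x2 \<noteq> z\<close> by simp
  qed
  have "(x3 - x4) * (c4 * (x1 + x2 + x3 + x4) + c3) = 0"
    using h[of x3] h[of x4] unfolding h_def by simp Groebner_Basis.algebra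
  then have "c4 * (x1 + x2 + x3 + x4) + c3 = 0"
    using ne by simp
  then show c3: "c3 = - c4 * (x1 + x2 + x3 + x4)"
    by Groebner_Basis.algebra
  show c2: "c2 = c4 * (x1 * x2 + x1 * x3 + x1 * x4 + x2 * x3 + x2 * x4 + x3 * x4)"
    using h[of x3] unfolding h_def c3 by simp Groebner_Basis.algebra
  show c1: "c1 = - c4 * (x1 * x2 * x3 + x1 * x2 * x4 + x1 * x3 * x4 + x2 * x3 * x4)"
    using g[of x1 x2] ne unfolding g_def c3 c2 by simp Groebner_Basis.algebra
  show "c0 = c4 * (x1 * x2 * x3 * x4)"
    using f[rule_format, of x1] unfolding c3 c2 c1 by simp Groebner_Basis.algebra
qed

text \<open>The tangent slope l = N / D of a flex satisfies l^2 + a1 l - a2 = 3 x. Multiplying by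
  D^2 and reducing modulo the equation of the curve leaves the 3-division polynomial.\<close>

lemma flex_division_poly:
  assumes P: "Affine x y \<in> ec_points E"
    and flex: "ec_add E (Affine x y) (Affine x y) = ec_neg E (Affine x y)"
  shows "3 * x ^ 4 + wb2 E * x ^ 3 + 3 * wb4 E * x ^ 2 + 3 * wb6 E * x + wb8 E = 0"
proof -
  define D where "D = 2 * y + wa1 E * x + wa3 E"
  define N where "N = 3 * x ^ 2 + 2 * wa2 E * x + wa4 E - wa1 E * y"
  define l where "l = N / D"
  have D: "D \<noteq> 0"
    using ec_add_flex_nonzero[OF flex] by (simp add: D_def)
  have "l ^ 2 + wa1 E * l - wa2 E - x - x = x"
    using flex unfolding ec_add_tangent[OF D[unfolded D_def]] D_def[symmetric] N_def[symmetric] l_def[symmetric]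
      ec_line_def Let_def ec_neg_simps by (simp only: ec_point.inject)
  then have "l ^ 2 + wa1 E * l - wa2 E = 3 * x"
    by (simp add: algebra_simps)
  then have "(l * D) ^ 2 + wa1 E * (l * D) * D - wa2 E * D ^ 2 = 3 * x * D ^ 2"
    by Groebner_Basis.algebra
  moreover have "l * D = N"
    using D by (simp add: l_def)
  ultimately have "N ^ 2 + wa1 E * N * D - wa2 E * D ^ 2 = 3 * x * D ^ 2"
    by simp
  then show ?thesis
    using P unfolding Affine_in_ec_points D_def N_def wb2_def wb4_def wb6_def wb8_def
    by Groebner_Basis.algebra
qed

text \<open>
  With \<open>e1, \<dots>, e4\<close> the elementary symmetric functions of the roots \<open>x1, \<dots>, x4\<close> of the 3-division
  polynomial, the relation \<open>4 b8 = b2 b6 - b4\<^sup>2\<close> kills the linear term of the resolvent cubic of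
  \<open>x1 x2 + x3 x4\<close> after the shift by \<open>e2 / 3\<close>.
\<close>

lemma resolvent_cube:
  fixes E :: "'a :: field_char_0 weierstrass"
  assumes roots: "\<forall>x\<in>{x1, x2, x3, x4}.
      3 * x ^ 4 + wb2 E * x ^ 3 + 3 * wb4 E * x ^ 2 + 3 * wb6 E * x + wb8 E = 0"
    and ne: "x1 \<noteq> x2" "x1 \<noteq> x3" "x1 \<noteq> x4" "x2 \<noteq> x3" "x2 \<noteq> x4" "x3 \<noteq> x4"
  shows "(wb4 E - 3 * (x1 * x2 + x3 * x4)) ^ 3 = discriminant E"
proof -
  note v = quartic_vieta[OF roots ne]
  have b4: "wb4 E = x1 * x2 + x1 * x3 + x1 * x4 + x2 * x3 + x2 * x4 + x3 * x4"
    using v(2) unfolding mult_cancel_left by simp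
  have "3 * wb6 E = 3 * (- (x1 * x2 * x3 + x1 * x2 * x4 + x1 * x3 * x4 + x2 * x3 * x4))"
    using v(3) by Groebner_Basis.algebra
  then have b6: "wb6 E = - (x1 * x2 * x3 + x1 * x2 * x4 + x1 * x3 * x4 + x2 * x3 * x4)"
    unfolding mult_cancel_left by simp
  have "4 * wb8 E = wb2 E * wb6 E - wb4 E ^ 2"
    unfolding wb2_def wb4_def wb6_def wb8_def by Groebner_Basis.algebra
  then show ?thesis
    unfolding discriminant_def v(1) v(4) b4 b6 by Groebner_Basis.algebra
qed

lemma v2_eq_0_iff: "v2 a b = 0 \<longleftrightarrow> a = 0 \<and> b = 0"
  by (simp add: vec_eq_iff forall_2)

definition mat22 :: "'a \<Rightarrow> 'a \<Rightarrow> 'a \<Rightarrow> 'a \<Rightarrow> 'a ^ 2 ^ 2" where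
  "mat22 a b c d = v2 (v2 a b) (v2 c d)"

lemma mat22_vec: "mat22 a b c d *v v2 x y = v2 (a * x + b * y) (c * x + d * y)"
  by (simp add: vec_eq_iff forall_2 mat22_def matrix_vector_mult_def sum_2)

lemma mat22_all: "(\<forall>A. P A) \<longleftrightarrow> (\<forall>a b c d. P (mat22 a b c d))"
proof -
  have "A = mat22 (A $ 1 $ 1) (A $ 1 $ 2) (A $ 2 $ 1) (A $ 2 $ 2)" for A :: "'a ^ 2 ^ 2"
    by (simp add: mat22_def)
  then show ?thesis by metis
qed

text \<open>The default value 0 at \<open>Infinity\<close> is Galois-invariant, so that taking the
  x-coordinate commutes with the Galois action without exception.\<close>

definition ec_x :: "'a :: field ec_point \<Rightarrow> 'a" where
  "ec_x P = (case P of Infinity \<Rightarrow> 0 | Affine x y \<Rightarrow> x)"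

context flex_basis
begin

definition xc :: "F3 ^ 2 \<Rightarrow> 'a" where
  "xc u = ec_x (ec_comb E P Q u)"

text \<open>
  The lines spanned by \<open>e1\<close>, \<open>e2\<close>, \<open>e1 + e2\<close>, \<open>e1 - e2\<close> are all the lines of the plane, so an
  invertible matrix \<open>A\<close> selects one of their three pairings.
\<close>

definition resolvent :: "F3 ^ 2 ^ 2 \<Rightarrow> 'a" where
  "resolvent A = wb4 E - 3 * (xc (A *v v2 1 0) * xc (A *v v2 0 1) + xc (A *v v2 1 1) * xc (A *v v2 1 2))"

lemma ec_comb_affine:
  assumes "u \<noteq> 0"
  obtains y where "ec_comb E P Q u = Affine (xc u) y"
proof -
  have "ec_comb E P Q 0 = Infinity"
    using ec_comb_table(1) by (simp add: v2_def zero_vec_def)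
  then have "ec_comb E P Q u \<noteq> Infinity"
    using assms inj by (metis injD)
  then show ?thesis
    using that by (cases "ec_comb E P Q u") (simp_all add: xc_def ec_x_def)
qed

lemma xc_eqD:
  assumes "u \<noteq> 0" "v \<noteq> 0" "xc u = xc v"
  shows "u = v \<or> u = - v"
proof -
  obtain y z where "ec_comb E P Q u = Affine (xc u) y" "ec_comb E P Q v = Affine (xc v) z"
    using assms ec_comb_affine by metis
  then have "ec_comb E P Q u = ec_comb E P Q v \<or> ec_comb E P Q u = ec_neg E (ec_comb E P Q v)"
    using ec_points_same_x[of "xc v" z E y] pts[of u] pts[of v] assms(3) by simp
  then show ?thesis
    using inj ec_comb_neg[of v] by (metis injD)
qed

lemma xc_minus: "xc (- u) = xc u"
  unfolding xc_def ec_comb_neg by (cases "ec_comb E P Q u") (simp_all add: ec_x_def)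

lemma xc_root: "u \<noteq> 0 \<Longrightarrow> 3 * xc u ^ 4 + wb2 E * xc u ^ 3 + 3 * wb4 E * xc u ^ 2 + 3 * wb6 E * xc u + wb8 E = 0"
  using pts[of u] flex[of u] by (elim ec_comb_affine) (auto intro: flex_division_poly)

lemma xc_distinct:
  "xc (v2 1 0) \<noteq> xc (v2 0 1)" "xc (v2 1 0) \<noteq> xc (v2 1 1)" "xc (v2 1 0) \<noteq> xc (v2 1 2)"
  "xc (v2 0 1) \<noteq> xc (v2 1 1)" "xc (v2 0 1) \<noteq> xc (v2 1 2)" "xc (v2 1 1) \<noteq> xc (v2 1 2)"
proof -
  have m: "- v2 a b = v2 (- a) (- b)" for a b :: F3
    by (simp add: vec_eq_iff forall_2)
  have "xc (v2 a b) \<noteq> xc (v2 c d)"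
    if "a \<noteq> 0 \<or> b \<noteq> 0" "c \<noteq> 0 \<or> d \<noteq> 0" "a \<noteq> c \<or> b \<noteq> d" "a \<noteq> - c \<or> b \<noteq> - d" for a b c d
    using xc_eqD[of "v2 a b" "v2 c d"] that by (auto simp: m v2_eq_0_iff)
  note this[simp]
  show "xc (v2 1 0) \<noteq> xc (v2 0 1)" "xc (v2 1 0) \<noteq> xc (v2 1 1)" "xc (v2 1 0) \<noteq> xc (v2 1 2)"
    "xc (v2 0 1) \<noteq> xc (v2 1 1)" "xc (v2 0 1) \<noteq> xc (v2 1 2)" "xc (v2 1 1) \<noteq> xc (v2 1 2)"
    by simp_all
qed

lemma resolvent_1_cube: "resolvent (mat22 1 0 0 1) ^ 3 = discriminant E"
proof -
  have "resolvent (mat22 1 0 0 1) =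
      wb4 E - 3 * (xc (v2 1 0) * xc (v2 0 1) + xc (v2 1 1) * xc (v2 1 2))"
    unfolding resolvent_def mat22_vec by simp
  also have "\<dots> ^ 3 = discriminant E"
    by (rule resolvent_cube[OF _ xc_distinct]) (auto intro!: xc_root simp: v2_eq_0_iff)
  finally show ?thesis .
qed

text \<open>A column of the matrix lies on a coordinate axis if and only if the product of its
  entries vanishes. So the condition says that the images of e1 and e2 are both on the axes or both
  off them, that is, the pairing of the two axes with each other is preserved.\<close>

lemma resolvent_eq_1_iff:
  assumes "a * d - b * c \<noteq> 0"
  shows "resolvent (mat22 a b c d) = resolvent (mat22 1 0 0 1) \<longleftrightarrow> (a * c = 0 \<longleftrightarrow> b * d = 0)"
proof -
  have m: "v2 2 0 = - v2 1 (0 :: F3)" "v2 0 2 = - v2 0 (1 :: F3)" "v2 2 2 = - v2 1 (1 :: F3)" "v2 2 1 = - v2 1 (2 :: F3)"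
    by (simp_all add: vec_eq_iff forall_2)
  define p q r s where "p = xc (v2 1 0)" and "q = xc (v2 0 1)" and "r = xc (v2 1 1)" and "s = xc (v2 1 2)"
  have vals: "xc (v2 1 0) = p" "xc (v2 0 1) = q" "xc (v2 1 1) = r" "xc (v2 1 2) = s"
    "xc (v2 2 0) = p" "xc (v2 0 2) = q" "xc (v2 2 2) = r" "xc (v2 2 1) = s"
    unfolding m xc_minus p_def q_def r_def s_def by simp_all
  have ne: "p \<noteq> q" "p \<noteq> r" "p \<noteq> s" "q \<noteq> r" "q \<noteq> s" "r \<noteq> s"
    using xc_distinct unfolding vals by simp_all
  \<comment> \<open>The difference of two of the sums p q + r s, p r + q s, p s + q r factors into
    differences of distinct x-coordinates.\<close>
  have "(p - s) * (q - r) \<noteq> 0" "(p - r) * (q - s) \<noteq> 0"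
    using ne by simp_all
  then have z: "p * q + r * s \<noteq> p * r + q * s" "p * q + r * s \<noteq> p * s + q * r"
    by (simp_all add: algebra_simps)
  have w: "w - 3 * x = w - 3 * y \<longleftrightarrow> x = y" for w x y :: 'a
    by simp
  have "\<forall>a b c d :: F3. a * d - b * c \<noteq> 0 \<longrightarrow>
      (resolvent (mat22 a b c d) = resolvent (mat22 1 0 0 1) \<longleftrightarrow> (a * c = 0 \<longleftrightarrow> b * d = 0))"
    unfolding F3_all resolvent_def mat22_vec w
    using z z[symmetric] by (simp add: F3_reduce vals ac_simps)
  then show ?thesis
    using assms by blast
qed

end

section \<open>The Galois action on the 3-torsion\<close>

context
  fixes \<sigma> :: "Qbar \<Rightarrow> Qbar"
  assumes \<sigma>: "\<sigma> \<in> carrier gal_Q"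
begin

lemma gal_Q_add: "\<sigma> (x + y) = \<sigma> x + \<sigma> y"
  and gal_Q_mult: "\<sigma> (x * y) = \<sigma> x * \<sigma> y"
  and gal_Q_to_ac: "\<sigma> (to_ac q) = to_ac q"
  and gal_Q_bij: "bij \<sigma>"
  using \<sigma> by (simp_all add: gal_Q_def)

lemma gal_Q_eq_iff: "\<sigma> x = \<sigma> y \<longleftrightarrow> x = y"
  using gal_Q_bij by (simp add: bij_def inj_eq)

lemma gal_Q_0: "\<sigma> 0 = 0" and gal_Q_1: "\<sigma> 1 = 1" and gal_Q_numeral: "\<sigma> (numeral n) = numeral n"
  using gal_Q_to_ac[of 0] gal_Q_to_ac[of 1] gal_Q_to_ac[of "numeral n"] by simp_all

lemma gal_Q_uminus: "\<sigma> (- x) = - \<sigma> x"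
  using gal_Q_add[of x "- x"] by (simp add: gal_Q_0 eq_neg_iff_add_eq_0 add.commute)

lemma gal_Q_diff: "\<sigma> (x - y) = \<sigma> x - \<sigma> y"
  using gal_Q_add[of x "- y"] by (simp add: gal_Q_uminus)

lemma gal_Q_divide: "\<sigma> (x / y) = \<sigma> x / \<sigma> y"
proof (cases "y = 0")
  case False
  then have "\<sigma> y \<noteq> 0"
    using gal_Q_eq_iff[of y 0] by (simp add: gal_Q_0)
  then show ?thesis
    using gal_Q_mult[of "x / y" y] False by (simp add: field_simps)
qed (simp add: gal_Q_0)

lemma gal_Q_power: "\<sigma> (x ^ n) = \<sigma> x ^ n"
  by (induction n) (simp_all add: gal_Q_1 gal_Q_mult)

lemmas gal_Q_simps = gal_Q_add gal_Q_mult gal_Q_to_ac gal_Q_0 gal_Q_1 gal_Q_numeral gal_Q_uminus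
  gal_Q_diff gal_Q_divide gal_Q_power weierstrass.map_sel

lemma map_ec_add:
  fixes E defines "E' \<equiv> map_weierstrass to_ac E"
  shows "map_ec_point \<sigma> (ec_add E' P Q) = ec_add E' (map_ec_point \<sigma> P) (map_ec_point \<sigma> Q)"
proof (cases P; cases Q)
  fix x1 y1 x2 y2
  assume eq: "P = Affine x1 y1" "Q = Affine x2 y2"
  have "y1 + y2 + wa1 E' * x2 + wa3 E' = 0 \<longleftrightarrow> \<sigma> y1 + \<sigma> y2 + wa1 E' * \<sigma> x2 + wa3 E' = 0"
    using gal_Q_eq_iff[of "y1 + y2 + wa1 E' * x2 + wa3 E'" 0] by (simp add: gal_Q_simps E'_def)
  then show ?thesis
    unfolding eq ec_point.map ec_add.simps Let_def if_distrib[of "map_ec_point \<sigma>"] if_distrib[of \<sigma>] gal_Q_eq_iff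
    by (simp add: gal_Q_simps gal_Q_eq_iff E'_def if_distrib[of \<sigma>] cong: if_cong)
qed simp_all

lemma map_ec_neg:
  "map_ec_point \<sigma> (ec_neg (map_weierstrass to_ac E) P) = ec_neg (map_weierstrass to_ac E) (map_ec_point \<sigma> P)"
  by (cases P) (simp_all add: gal_Q_simps)

lemma map_in_ec_points:
  assumes "P \<in> ec_points (map_weierstrass to_ac E)"
  shows "map_ec_point \<sigma> P \<in> ec_points (map_weierstrass to_ac E)"
proof (cases P)
  case (Affine x y)
  then show ?thesis
    using arg_cong[OF assms[unfolded Affine Affine_in_ec_points], of \<sigma>]
    by (simp add: Affine_in_ec_points gal_Q_simps)
qed simp

lemma map_ec_mul3:
  "map_ec_point \<sigma> (ec_mul3 (map_weierstrass to_ac E) c P) = ec_mul3 (map_weierstrass to_ac E) c (map_ec_point \<sigma> P)"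
  by (simp add: ec_mul3_def map_ec_neg)

lemma ec_x_map: "ec_x (map_ec_point \<sigma> P) = \<sigma> (ec_x P)"
  by (cases P) (simp_all add: ec_x_def gal_Q_0)

end

lemma gal_Q_comp: "\<sigma> \<in> carrier gal_Q \<Longrightarrow> \<tau> \<in> carrier gal_Q \<Longrightarrow> \<sigma> \<circ> \<tau> \<in> carrier gal_Q"
  by (simp add: gal_Q_def bij_comp)

text \<open>The library's power unfolds to (P + P) + P, and a sum is \<open>Infinity\<close> only
  for mutually negative points, so no associativity enters.\<close>

lemma torsion3_iff:
  "P \<in> torsion3 E \<longleftrightarrow> P \<in> ec_points (map_weierstrass to_ac E) \<and>
     ec_add (map_weierstrass to_ac E) P P = ec_neg (map_weierstrass to_ac E) P"
proof -
  let ?E = "map_weierstrass to_ac E"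
  have "P [^]\<^bsub>Qbar_points E\<^esub> (3 :: nat) = ec_add ?E (ec_add ?E P P) P"
    by (simp add: numeral_3_eq_3 Qbar_points_def ec_group_def nat_pow_def)
  then have "P \<in> torsion3 E \<longleftrightarrow> P \<in> ec_points ?E \<and> ec_add ?E (ec_add ?E P P) P = Infinity"
    unfolding torsion3_def mem_Collect_eq by (simp only: Qbar_points_def ec_group_def partial_object.simps monoid.simps)
  moreover have "ec_add ?E (ec_add ?E P P) P = Infinity \<longleftrightarrow> ec_add ?E P P = ec_neg ?E P"
    using ec_add_eq_Infinity[of ?E "ec_add ?E P P" P] ec_add_neg(2)[of ?E P] by metis
  ultimately show ?thesis by (simp only:)
qed

lemma F3_smult_eq:
  assumes "P \<in> torsion3 E"
  shows "F3_smult E c P = ec_mul3 (map_weierstrass to_ac E) c P"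
proof -
  have l: "(LEAST n. of_nat n = (0 :: F3)) = 0" "(LEAST n. of_nat n = (1 :: F3)) = 1"
    "(LEAST n. of_nat n = (2 :: F3)) = 2"
  proof -
    show "(LEAST n. of_nat n = (0 :: F3)) = 0"
      by (rule Least_equality) simp_all
    show "(LEAST n. of_nat n = (1 :: F3)) = 1"
    proof (rule Least_equality)
      fix n assume "of_nat n = (1 :: F3)"
      then have "n \<noteq> 0" by (intro notI) simp
      then show "1 \<le> n" by simp
    qed simp
    show "(LEAST n. of_nat n = (2 :: F3)) = 2"
    proof (rule Least_equality)
      fix n assume "of_nat n = (2 :: F3)"
      then have "n \<noteq> 0" "n \<noteq> 1" by (intro notI; simp)+
      then show "2 \<le> n" by simp
    qed simp
  qed
  show ?thesis
    using F3_cases[of c] assms unfolding torsion3_iff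
    by (auto simp: F3_smult_def ec_mul3_def l Qbar_points_def ec_group_def nat_pow_def numeral_2_eq_2)
qed

lemma lin_comb3_eq:
  fixes B :: "Qbar ec_point ^ 2"
  assumes "B $ 1 \<in> torsion3 E" "B $ 2 \<in> torsion3 E"
  shows "lin_comb3 E B u = ec_comb (map_weierstrass to_ac E) (B $ 1) (B $ 2) u"
  using assms by (simp add: lin_comb3_def ec_comb_def F3_smult_eq) (simp add: Qbar_points_def ec_group_def)

lemma discriminant_map: "discriminant (map_weierstrass to_ac E) = to_ac (discriminant E)"
  by (simp add: discriminant_def wb2_def wb4_def wb6_def wb8_def weierstrass.map_sel)

context
  fixes E :: "rat weierstrass" and B :: "Qbar ec_point ^ 2"
  assumes B: "torsion3_basis E B"
begin

abbreviation "E' \<equiv> map_weierstrass to_ac E :: Qbar weierstrass"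

abbreviation "comb \<equiv> ec_comb E' (B $ 1) (B $ 2)"

lemma lin_comb3_basis: "lin_comb3 E B = comb"
  using B by (intro ext lin_comb3_eq) (simp_all add: torsion3_basis_def)

lemma bij_comb: "bij_betw comb UNIV (torsion3 E)"
  using B lin_comb3_basis by (simp add: torsion3_basis_def)

lemma flex_basis_torsion3: "flex_basis E' (B $ 1) (B $ 2)"
proof
  show "inj comb"
    using bij_comb by (simp add: bij_betw_def)
  have "comb u \<in> torsion3 E" for u
    using bij_comb by (auto simp: bij_betw_def)
  then show "comb u \<in> ec_points E'" "ec_add E' (comb u) (comb u) = ec_neg E' (comb u)" for u
    by (simp_all add: torsion3_iff)
qed

interpretation flex_basis E' "B $ 1" "B $ 2"
  by (rule flex_basis_torsion3)

text \<open>This justifies the definite description in \<open>mod3_rep\<close>: the Galois action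
  preserves E[3], and coordinates in a basis exist and are unique.\<close>

lemma mod3_rep_basis:
  assumes \<sigma>: "\<sigma> \<in> carrier gal_Q"
  shows "map_ec_point \<sigma> (B $ j) = comb (column j (mod3_rep E B \<sigma>))"
proof -
  have "\<exists>u. map_ec_point \<sigma> (B $ j) = comb u" for j
  proof -
    have Bj: "B $ j \<in> torsion3 E"
      using B by (simp add: torsion3_basis_def)
    have "map_ec_point \<sigma> (B $ j) \<in> torsion3 E"
      using Bj map_in_ec_points[OF \<sigma>, of "B $ j" E]
      unfolding torsion3_iff by (simp add: map_ec_neg[OF \<sigma>] flip: map_ec_add[OF \<sigma>])
    then show ?thesis
      using bij_comb by (auto simp: bij_betw_def)
  qed
  then obtain u where u: "\<And>j. map_ec_point \<sigma> (B $ j) = comb (u j)"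
    by metis
  have "\<exists>!A. \<forall>j. map_ec_point \<sigma> (B $ j) = comb (column j A)"
  proof
    show "\<forall>j. map_ec_point \<sigma> (B $ j) = comb (column j (\<chi> i j. u j $ i))"
      by (simp add: u column_def)
  next
    fix A assume A: "\<forall>j. map_ec_point \<sigma> (B $ j) = comb (column j A)"
    have "column j A = u j" for j
      using A u inj by (metis injD)
    then show "A = (\<chi> i j. u j $ i)"
      by (auto simp: vec_eq_iff column_def)
  qed
  then have "\<forall>j. map_ec_point \<sigma> (B $ j) = comb (column j (mod3_rep E B \<sigma>))"
    unfolding mod3_rep_def lin_comb3_basis by (rule theI')
  then show ?thesis by blast
qed

text \<open>The step from the two basis points to all of E[3]; it is here that the addition table
  \<open>ec_comb_add\<close> is needed.\<close>

lemma map_comb: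
  assumes \<sigma>: "\<sigma> \<in> carrier gal_Q"
  shows "map_ec_point \<sigma> (comb u) = comb (mod3_rep E B \<sigma> *v u)"
proof -
  let ?A = "mod3_rep E B \<sigma>"
  have mul: "ec_mul3 E' c (comb w) = comb (c *s w)" for c w
  proof -
    have "(0 :: F3) *s w = v2 0 0" "(1 :: F3) *s w = w" "(2 :: F3) *s w = - w"
      by (simp_all add: vec_eq_iff forall_2 flip: F3_reduce(3))
    then show ?thesis
      using F3_cases[of c] ec_comb_neg[of w] ec_comb_table(1) by (auto simp: ec_mul3_def)
  qed
  have "map_ec_point \<sigma> (comb u) =
      ec_add E' (ec_mul3 E' (u $ 1) (comb (column 1 ?A))) (ec_mul3 E' (u $ 2) (comb (column 2 ?A)))"
    unfolding ec_comb_def[of E' "B $ 1" "B $ 2" u] map_ec_add[OF \<sigma>] map_ec_mul3[OF \<sigma>]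
    by (simp only: mod3_rep_basis[OF \<sigma>])
  also have "\<dots> = comb (u $ 1 *s column 1 ?A + u $ 2 *s column 2 ?A)"
    unfolding mul ec_comb_add ..
  also have "u $ 1 *s column 1 ?A + u $ 2 *s column 2 ?A = ?A *v u"
    by (simp add: vec_eq_iff column_def matrix_vector_mult_def sum_2 mult.commute)
  finally show ?thesis .
qed

lemma mod3_rep_mult:
  assumes \<sigma>: "\<sigma> \<in> carrier gal_Q" and \<tau>: "\<tau> \<in> carrier gal_Q"
  shows "mod3_rep E B (\<sigma> \<circ> \<tau>) = mod3_rep E B \<sigma> ** mod3_rep E B \<tau>"
proof -
  have "mod3_rep E B (\<sigma> \<circ> \<tau>) *v u = (mod3_rep E B \<sigma> ** mod3_rep E B \<tau>) *v u" for u
  proof -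
    have "comb (mod3_rep E B (\<sigma> \<circ> \<tau>) *v u) = map_ec_point (\<sigma> \<circ> \<tau>) (comb u)"
      by (simp add: map_comb gal_Q_comp \<sigma> \<tau>)
    also have "\<dots> = map_ec_point \<sigma> (map_ec_point \<tau> (comb u))"
      by (simp add: ec_point.map_comp)
    also have "\<dots> = comb (mod3_rep E B \<sigma> *v (mod3_rep E B \<tau> *v u))"
      by (simp add: map_comb \<sigma> \<tau>)
    finally show ?thesis
      using inj by (simp add: inj_eq matrix_vector_mul_assoc)
  qed
  then show ?thesis
    by (simp add: matrix_eq)
qed

lemma gal_Q_resolvent:
  assumes \<sigma>: "\<sigma> \<in> carrier gal_Q"
  shows "\<sigma> (resolvent A) = resolvent (mod3_rep E B \<sigma> ** A)"
proof -
  have x: "\<sigma> (xc u) = xc (mod3_rep E B \<sigma> *v u)" for u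
    unfolding xc_def map_comb[OF \<sigma>, symmetric] ec_x_map[OF \<sigma>] ..
  have b4: "\<sigma> (wb4 E') = wb4 E'"
    by (simp add: wb4_def gal_Q_simps[OF \<sigma>])
  show ?thesis
    unfolding resolvent_def by (simp add: gal_Q_simps[OF \<sigma>] b4 x matrix_vector_mul_assoc)
qed

text \<open>The resolvents are exported as an abstract function on matrices, so that the remaining
  argument no longer mentions points of the curve.\<close>

lemma mod3_rep_resolvent:
  obtains T where "\<And>\<sigma> A. \<sigma> \<in> carrier gal_Q \<Longrightarrow> \<sigma> (T A) = T (mod3_rep E B \<sigma> ** A)"
    and "T (mat22 1 0 0 1) ^ 3 = to_ac (discriminant E)"
    and "\<And>a b c d. a * d - b * c \<noteq> 0 \<Longrightarrow>
           T (mat22 a b c d) = T (mat22 1 0 0 1) \<longleftrightarrow> (a * c = 0 \<longleftrightarrow> b * d = 0)"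
  using gal_Q_resolvent resolvent_1_cube resolvent_eq_1_iff discriminant_map by metis

text \<open>The finite set consists of the coordinates of the basis points. It will give the
  continuity of the twisting character.\<close>

lemma mod3_rep_finite_dependence:
  obtains F where "finite F" "\<And>\<sigma> \<tau>. (\<And>x. x \<in> F \<Longrightarrow> \<sigma> x = \<tau> x) \<Longrightarrow> mod3_rep E B \<sigma> = mod3_rep E B \<tau>"
proof
  let ?F = "set_ec_point (B $ 1) \<union> set_ec_point (B $ 2)"
  have "finite (set_ec_point P)" for P :: "Qbar ec_point"
    by (cases P) simp_all
  then show "finite ?F" by simp
  fix \<sigma> \<tau> :: "Qbar \<Rightarrow> Qbar"
  assume "\<And>x. x \<in> ?F \<Longrightarrow> \<sigma> x = \<tau> x"
  then have "map_ec_point \<sigma> (B $ j) = map_ec_point \<tau> (B $ j)" for j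
    using exhaust_2[of j] by (auto intro!: ec_point.map_cong0)
  then show "mod3_rep E B \<sigma> = mod3_rep E B \<tau>"
    by (simp add: mod3_rep_def)
qed

end

section \<open>The normal subgroup of order 8\<close>

lemma mat22_cases:
  obtains a b c d where "A = mat22 a b c d"
proof -
  have "A = mat22 (A $ 1 $ 1) (A $ 1 $ 2) (A $ 2 $ 1) (A $ 2 $ 2)"
    by (simp add: mat22_def)
  then show ?thesis by (rule that)
qed

lemma mat22_mult:
  "mat22 a b c d ** mat22 a' b' c' d' =
     mat22 (a * a' + b * c') (a * b' + b * d') (c * a' + d * c') (c * b' + d * d')"
  by (simp add: vec_eq_iff forall_2 mat22_def matrix_matrix_mult_def sum_2)

lemma mat22_eq_iff: "mat22 a b c d = mat22 a' b' c' d' \<longleftrightarrow> a = a' \<and> b = b' \<and> c = c' \<and> d = d'"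
  by (auto simp: mat22_def)

lemma mat22_uminus: "- mat22 a b c d = mat22 (- a) (- b) (- c) (- d)"
  by (simp add: vec_eq_iff forall_2 mat22_def)

lemma mat_1_eq: "mat 1 = mat22 1 0 0 1"
  by (simp add: vec_eq_iff forall_2 mat22_def mat_def)

lemma F3_square: "(x :: F3) \<noteq> 0 \<Longrightarrow> x * x = 1"
  using F3_cases[of x] by auto

text \<open>A nonzero D is its own inverse in F_3, so the inverse matrix is D times the
  adjugate.\<close>

lemma mat22_inverse:
  fixes a b c d :: F3
  defines "D \<equiv> a * d - b * c"
  assumes "D \<noteq> 0"
  shows "mat22 a b c d ** mat22 (D * d) (- D * b) (- D * c) (D * a) = mat 1"
    and "mat22 (D * d) (- D * b) (- D * c) (D * a) ** mat22 a b c d = mat 1"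
proof -
  have "D * (a * d - b * c) = 1"
    using F3_square[OF assms(2)] by (simp add: D_def)
  then show "mat22 a b c d ** mat22 (D * d) (- D * b) (- D * c) (D * a) = mat 1"
    "mat22 (D * d) (- D * b) (- D * c) (D * a) ** mat22 a b c d = mat 1"
    unfolding mat22_mult mat_1_eq mat22_eq_iff by (simp_all add: algebra_simps)
qed

lemma invertible_mat22_iff: "invertible (mat22 a b c d) \<longleftrightarrow> a * d - b * c \<noteq> (0 :: F3)"
proof
  assume "invertible (mat22 a b c d)"
  then obtain B where "mat22 a b c d ** B = mat 1"
    by (auto simp: invertible_def)
  moreover obtain a' b' c' d' where "B = mat22 a' b' c' d'"
    by (rule mat22_cases)
  ultimately have "a * a' + b * c' = 1 \<and> a * b' + b * d' = 0 \<and> c * a' + d * c' = 0 \<and> c * b' + d * d' = 1"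
    by (simp add: mat22_mult mat_1_eq mat22_eq_iff)
  then have "(a * a' + b * c') * (c * b' + d * d') - (a * b' + b * d') * (c * a' + d * c') = 1"
    by simp
  also have "(a * a' + b * c') * (c * b' + d * d') - (a * b' + b * d') * (c * a' + d * c') =
      (a * d - b * c) * (a' * d' - b' * c')"
    by (simp add: algebra_simps)
  finally show "a * d - b * c \<noteq> 0" by auto
next
  assume "a * d - b * c \<noteq> 0"
  then show "invertible (mat22 a b c d)"
    using mat22_inverse[of a d b c] unfolding invertible_def by metis
qed

lemma GL2_F3_simps:
  "carrier GL2_F3 = {A. invertible A}" "A \<otimes>\<^bsub>GL2_F3\<^esub> B = A ** B" "\<one>\<^bsub>GL2_F3\<^esub> = mat 1"
  by (simp_all add: GL2_F3_def)

lemma group_GL2_F3: "group GL2_F3"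
proof (rule groupI)
  fix A B C :: "F3 ^ 2 ^ 2"
  show "A \<otimes>\<^bsub>GL2_F3\<^esub> B \<in> carrier GL2_F3" if "A \<in> carrier GL2_F3" "B \<in> carrier GL2_F3"
    using that by (simp add: GL2_F3_simps invertible_mult)
  show "\<exists>B\<in>carrier GL2_F3. B \<otimes>\<^bsub>GL2_F3\<^esub> A = \<one>\<^bsub>GL2_F3\<^esub>" if "A \<in> carrier GL2_F3"
    using that by (auto simp: GL2_F3_simps invertible_def)
qed (simp_all add: GL2_F3_simps matrix_mul_assoc invertible_def exI[of _ "mat 1"])


interpretation GL: group GL2_F3
  by (rule group_GL2_F3)

lemma inv_mat22:
  fixes a b c d :: F3
  defines "D \<equiv> a * d - b * c"
  assumes "D \<noteq> 0"
  shows "inv\<^bsub>GL2_F3\<^esub> (mat22 a b c d) = mat22 (D * d) (- D * b) (- D * c) (D * a)"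
proof (rule GL.inv_equality)
  note inverse = mat22_inverse[of a d b c, folded D_def, OF assms(2)]
  show "mat22 (D * d) (- D * b) (- D * c) (D * a) \<otimes>\<^bsub>GL2_F3\<^esub> mat22 a b c d = \<one>\<^bsub>GL2_F3\<^esub>"
    using inverse by (simp add: GL2_F3_simps)
  show "mat22 a b c d \<in> carrier GL2_F3" "mat22 (D * d) (- D * b) (- D * c) (D * a) \<in> carrier GL2_F3"
    using inverse by (auto simp: GL2_F3_simps invertible_def)
qed

lemma GL2_F3_all:
  "(\<forall>A\<in>carrier GL2_F3. R A) \<longleftrightarrow> (\<forall>a b c d :: F3. a * d - b * c \<noteq> 0 \<longrightarrow> R (mat22 a b c d))"
proof -
  have "(\<forall>A\<in>carrier GL2_F3. R A) \<longleftrightarrow> (\<forall>A. A \<in> carrier GL2_F3 \<longrightarrow> R A)"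
    by blast
  also have "\<dots> \<longleftrightarrow> (\<forall>a b c d. a * d - b * c \<noteq> 0 \<longrightarrow> R (mat22 a b c d))"
    unfolding mat22_all GL2_F3_simps by (simp add: invertible_mat22_iff)
  finally show ?thesis .
qed

text \<open>The quaternions +-1, +-i, +-j, +-k, each next to its negative.\<close>

definition q8 :: "(F3 ^ 2 ^ 2) set" where
  "q8 = {mat22 1 0 0 1, mat22 2 0 0 2, mat22 0 1 2 0, mat22 0 2 1 0,
         mat22 1 1 1 2, mat22 2 2 2 1, mat22 1 2 2 2, mat22 2 1 1 1}"

lemma q8_all:
  "(\<forall>q\<in>q8. R q) \<longleftrightarrow> R (mat22 1 0 0 1) \<and> R (mat22 2 0 0 2) \<and> R (mat22 0 1 2 0) \<and> R (mat22 0 2 1 0) \<and>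
     R (mat22 1 1 1 2) \<and> R (mat22 2 2 2 1) \<and> R (mat22 1 2 2 2) \<and> R (mat22 2 1 1 1)"
  by (simp add: q8_def)

lemmas F3_eval = F3_all F3_reduce mat22_mult mat22_eq_iff mat22_uminus GL2_F3_simps(2)

text \<open>Determinant 1 and trace 0 mean A^2 = -1 by Cayley-Hamilton; the remaining elements are
  the scalars +-1. This test decides membership in the enumerations that follow.\<close>

lemma mat22_in_q8: "mat22 a b c d \<in> q8 \<longleftrightarrow> a * d - b * c = 1 \<and> (a + d = 0 \<or> b = 0 \<and> c = 0)"
proof -
  have "\<forall>a b c d. mat22 a b c d \<in> q8 \<longleftrightarrow> a * d - b * c = 1 \<and> (a + d = 0 \<or> b = 0 \<and> c = 0)"
    unfolding q8_def by (simp add: F3_eval)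
  then show ?thesis by blast
qed

lemma q8_subset: "q8 \<subseteq> carrier GL2_F3"
  by (auto simp: q8_def GL2_F3_simps(1) invertible_mat22_iff)

lemma q8_conj: "A \<in> carrier GL2_F3 \<Longrightarrow> q \<in> q8 \<Longrightarrow> A \<otimes>\<^bsub>GL2_F3\<^esub> q \<otimes>\<^bsub>GL2_F3\<^esub> inv\<^bsub>GL2_F3\<^esub> A \<in> q8"
proof -
  have "\<forall>A\<in>carrier GL2_F3. \<forall>q\<in>q8. A \<otimes>\<^bsub>GL2_F3\<^esub> q \<otimes>\<^bsub>GL2_F3\<^esub> inv\<^bsub>GL2_F3\<^esub> A \<in> q8"
    unfolding GL2_F3_all q8_all
    by (simp add: F3_eval inv_mat22 mat22_in_q8)
  then show "A \<in> carrier GL2_F3 \<Longrightarrow> q \<in> q8 \<Longrightarrow> ?thesis" by blast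
qed

lemma q8_mult: "p \<in> q8 \<Longrightarrow> q \<in> q8 \<Longrightarrow> p ** q \<in> q8"
proof -
  have "\<forall>p\<in>q8. \<forall>q\<in>q8. p ** q \<in> q8"
    unfolding q8_all by (simp add: F3_eval mat22_in_q8)
  then show "p \<in> q8 \<Longrightarrow> q \<in> q8 \<Longrightarrow> p ** q \<in> q8" by blast
qed

lemma q8_normal: "q8 \<lhd> GL2_F3"
proof -
  have "\<forall>q\<in>q8. inv\<^bsub>GL2_F3\<^esub> q \<in> q8"
    unfolding q8_all mat22_in_q8 by (simp add: F3_eval inv_mat22 mat22_in_q8)
  then have "subgroup q8 GL2_F3"
    using q8_subset by (intro GL.subgroupI) (auto simp: GL2_F3_simps q8_mult, simp add: q8_def)
  then show ?thesis
    by (simp add: GL.normal_inv_iff q8_conj)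
qed

lemma card_q8: "card q8 = 8"
  by (simp add: q8_def mat22_eq_iff)

text \<open>
  An element of a normal subgroup of order 8 which lies outside \<open>q8\<close> has determinant \<open>-1\<close>, and then it
  has at least five conjugates \<open>B\<close>; together with the products \<open>A B\<close>, of determinant 1, they are too many.
\<close>

lemma Q8_eq: "Q8 = q8"
  unfolding Q8_def
proof (rule the_equality)
  show "q8 \<lhd> GL2_F3 \<and> card q8 = 8"
    using q8_normal card_q8 by blast
next
  fix N assume N: "N \<lhd> GL2_F3 \<and> card N = 8"
  then interpret N: normal N GL2_F3 by blast
  have "A \<in> q8" if A: "A \<in> N" for A
  proof (rule ccontr)
    assume nq: "A \<notin> q8"
    interpret H: group "GL2_F3\<lparr>carrier := N\<rparr>"
      by (rule N.subgroup_is_group) (rule group_GL2_F3)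
    have "A [^]\<^bsub>GL2_F3\<lparr>carrier := N\<rparr>\<^esub> (8 :: nat) = \<one>\<^bsub>GL2_F3\<lparr>carrier := N\<rparr>\<^esub>"
      using H.pow_order_eq_1[of A] A N by (simp add: order_def)
    then have "A [^]\<^bsub>GL2_F3\<^esub> (8 :: nat) = mat 1"
      by (simp add: nat_pow_def GL2_F3_simps)
    then have A8: "((A ** A) ** (A ** A)) ** ((A ** A) ** (A ** A)) = mat 1"
      by (simp add: nat_pow_def GL2_F3_simps matrix_mul_assoc eval_nat_numeral)
    have AG: "A \<in> carrier GL2_F3"
      using A by (rule N.mem_carrier)
    obtain a b c d where [simp]: "A = mat22 a b c d"
      by (rule mat22_cases)
    \<comment> \<open>In SL_2(F_3) the elements of 2-power order form the normal Sylow 2-subgroup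
      \<open>q8\<close>; hence an element of order dividing 8 outside \<open>q8\<close> has
      determinant -1 = 2.\<close>
    have "\<forall>a b c d. a * d - b * c \<noteq> (0 :: F3) \<longrightarrow> mat22 a b c d \<notin> q8 \<longrightarrow>
       (let A = mat22 a b c d in ((A ** A) ** (A ** A)) ** ((A ** A) ** (A ** A)) = mat 1) \<longrightarrow> a * d - b * c = 2"
      unfolding mat22_in_q8 mat_1_eq Let_def by (simp add: F3_eval)
    then have det: "a * d - b * c = 2"
      using nq A8 AG by (simp add: GL2_F3_simps(1) invertible_mat22_iff Let_def)
    define con where "con g = g \<otimes>\<^bsub>GL2_F3\<^esub> A \<otimes>\<^bsub>GL2_F3\<^esub> inv\<^bsub>GL2_F3\<^esub> g" for g
    \<comment> \<open>These six conjugators already produce five different conjugates of every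
      matrix of determinant -1, and 5 + 5 exceeds 8.\<close>
    define g where "g = {mat22 1 0 0 1, mat22 0 1 1 0, mat22 0 1 1 (1 :: F3), mat22 1 0 0 2, mat22 1 0 2 2, mat22 1 1 0 2}"
    have "\<forall>a b c d :: F3. a * d - b * c = 2 \<longrightarrow>
       card ((\<lambda>g. g \<otimes>\<^bsub>GL2_F3\<^esub> mat22 a b c d \<otimes>\<^bsub>GL2_F3\<^esub> inv\<^bsub>GL2_F3\<^esub> g) ` g) \<ge> 5"
      unfolding g_def by (simp add: F3_eval inv_mat22 card_insert_if)
    then have card: "card (con ` g) \<ge> 5"
      using det unfolding con_def by simp
    have conN: "con ` g \<subseteq> N"
      using A N by (auto simp: con_def GL.normal_inv_iff g_def GL2_F3_simps(1) invertible_mat22_iff)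
    then have AN: "(\<lambda>B. A ** B) ` con ` g \<subseteq> N"
      using A N.m_closed by (auto simp: GL2_F3_simps)
    have disj: "con ` g \<inter> (\<lambda>B. A ** B) ` con ` g = {}"
    proof -
      define dt where "dt B = B $ 1 $ 1 * B $ 2 $ 2 - B $ 1 $ 2 * B $ 2 $ 1" for B :: "F3 ^ 2 ^ 2"
      have dt: "dt (B ** C) = dt B * dt C" for B C
        by (simp add: dt_def matrix_matrix_mult_def sum_2 algebra_simps)
      have "dt (con h) = 2" if "h \<in> carrier GL2_F3" for h
      proof -
        have "dt (con h) = dt A * (dt h * dt (inv\<^bsub>GL2_F3\<^esub> h))"
          by (simp add: con_def GL2_F3_simps dt)
        also have "dt h * dt (inv\<^bsub>GL2_F3\<^esub> h) = dt (mat 1)"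
          using that GL.r_inv[OF that] by (simp add: GL2_F3_simps flip: dt)
        finally show ?thesis
          using det by (simp add: dt_def mat_1_eq mat22_def)
      qed
      moreover have "g \<subseteq> carrier GL2_F3"
        by (simp add: g_def GL2_F3_simps(1) invertible_mat22_iff)
      moreover have "dt A = 2"
        using det by (simp add: dt_def mat22_def)
      ultimately have "dt B = 2" "dt (A ** B) = 1" if "B \<in> con ` g" for B
        using that by (auto simp: dt)
      then show ?thesis by fastforce
    qed
    have "card ((\<lambda>B. A ** B) ` con ` g) = card (con ` g)"
    proof (rule card_image)
      show "inj_on (\<lambda>B. A ** B) (con ` g)"
      proof (rule inj_onI)
        fix B C assume "B \<in> con ` g" "C \<in> con ` g" "A ** B = A ** C"
        then show "B = C"
          using GL.l_cancel[of A B C] AG conN N.subset by (auto simp: GL2_F3_simps)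
      qed
    qed
    then have "card (con ` g) + card (con ` g) = card (con ` g \<union> (\<lambda>B. A ** B) ` con ` g)"
      using disj by (subst card_Un_disjoint) simp_all
    also have "\<dots> \<le> card N"
      using conN AN by (intro card_mono) simp_all
    finally have "card (con ` g) + card (con ` g) \<le> card N" .
    with card N show False by linarith
  qed
  then show "N = q8"
    using N card_q8 by (intro card_subset_eq) (auto simp: q8_def)
qed

section \<open>Generators of GL_2(F_3) and subgroups of the fibre product over its quotient by
  \<open>q8\<close>\<close>

lemma matrix_mult_minus:
  fixes A B :: "'a :: ring_1 ^ 'n ^ 'n"
  shows "(- A) ** B = - (A ** B)" "A ** (- B) = - (A ** B)"
  by (simp_all add: matrix_matrix_mult_def vec_eq_iff sum_negf)

text \<open>A reflection s and a transvection t of order 3 generate a copy of S_3 that is a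
  complement of \<open>q8\<close>; i is one of the quaternions of order 4.\<close>

definition gl_s :: "F3 ^ 2 ^ 2" where "gl_s = mat22 1 0 0 2"
definition gl_t :: "F3 ^ 2 ^ 2" where "gl_t = mat22 1 1 0 1"
definition gl_i :: "F3 ^ 2 ^ 2" where "gl_i = mat22 0 1 2 0"

lemmas gl_defs = gl_s_def gl_t_def gl_i_def

lemma gl_in_carrier: "gl_s \<in> carrier GL2_F3" "gl_t \<in> carrier GL2_F3" "gl_i \<in> carrier GL2_F3"
  by (simp_all add: gl_defs GL2_F3_simps(1) invertible_mat22_iff)

lemma gl_i_in_q8: "gl_i \<in> q8"
  by (simp add: gl_i_def q8_def)

lemma gl_i_not_scalar: "gl_i \<noteq> mat 1" "gl_i \<noteq> - mat 1"
  by (simp_all add: gl_i_def mat_1_eq mat22_eq_iff mat22_uminus)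

text \<open>Here t^2 is the inverse of t, and conjugation by t permutes the three subgroups of order
  4 of \<open>q8\<close> cyclically. So q and its conjugate j generate \<open>q8\<close>; the eight
  words in q and j use products only, as L is not assumed to contain inverses.\<close>

lemma q8_generated:
  assumes L: "\<And>a b. a \<in> L \<Longrightarrow> b \<in> L \<Longrightarrow> a ** b \<in> L"
    and q: "q \<in> q8" "q \<noteq> mat 1" "q \<noteq> - mat 1" "q \<in> L" and j: "gl_t ** q ** (gl_t ** gl_t) \<in> L"
  shows "q8 \<subseteq> L"
proof
  fix b assume b: "b \<in> q8"
  define j where "j = gl_t ** q ** (gl_t ** gl_t)"
  have "\<forall>q\<in>q8. q \<noteq> mat 1 \<longrightarrow> q \<noteq> - mat 1 \<longrightarrow> (\<forall>b\<in>q8. let j = gl_t ** q ** (gl_t ** gl_t) in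
      b \<in> {(q ** q) ** (q ** q), q ** q, q, q ** (q ** q), j, j ** (j ** j), q ** j, (q ** (q ** q)) ** j})"
    unfolding q8_all Let_def gl_defs mat_1_eq by (simp add: F3_eval)
  then have "b \<in> {(q ** q) ** (q ** q), q ** q, q, q ** (q ** q), j, j ** (j ** j), q ** j, (q ** (q ** q)) ** j}"
    using q(1-3) b unfolding Let_def j_def by blast
  then show "b \<in> L"
    using L q(4) j[folded j_def] by auto
qed

lemma GL2_F3_generated:
  assumes K: "\<And>a b. a \<in> K \<Longrightarrow> b \<in> K \<Longrightarrow> a ** b \<in> K"
    and gens: "gl_s \<in> K" "gl_t \<in> K" "gl_i \<in> K"
  shows "carrier GL2_F3 \<subseteq> K"
proof
  fix b assume b: "b \<in> carrier GL2_F3"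
  have q8K: "q8 \<subseteq> K"
    by (rule q8_generated[of K gl_i]) (auto intro: K gens gl_i_in_q8 simp: gl_i_not_scalar)
  \<comment> \<open>The six elements of the complement S_3, each with its inverse; the three
    reflections are their own inverses.\<close>
  let ?H = "{(mat 1, mat 1), (gl_t, gl_t ** gl_t), (gl_t ** gl_t, gl_t), (gl_s, gl_s),
    (gl_s ** gl_t, gl_s ** gl_t), (gl_t ** gl_s, gl_t ** gl_s)}"
  have "\<forall>b\<in>carrier GL2_F3. \<exists>h\<in>?H. b ** fst h \<in> q8 \<and> fst h ** snd h = mat 1"
    unfolding GL2_F3_all gl_defs mat_1_eq by (simp add: F3_eval mat22_in_q8)
  then obtain h h' where h: "(h, h') \<in> ?H" "b ** h \<in> q8" "h ** h' = mat 1"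
    using b by fastforce
  have "mat 1 \<in> K"
    using q8K by (auto simp: mat_1_eq q8_def)
  then have "h' \<in> K"
    using h(1) gens K by auto
  then have "(b ** h) ** h' \<in> K"
    using h(2) q8K K by blast
  then show "b \<in> K"
    by (simp add: h(3) flip: matrix_mul_assoc)
qed

text \<open>
  The relations \<open>s t = t\<^sup>2 s\<close> and \<open>s i = i\<^sup>3 s\<close> force the partners of the generators \<open>t\<close>, \<open>s\<close>, \<open>i\<close>
  one after the other; the partner of \<open>i\<close> is not a scalar, for otherwise all of \<open>q8\<close> would be
  paired with scalars.
\<close>

lemma pairs_up_to_sign:
  assumes mult: "\<And>a b a' b'. (a, b) \<in> G \<Longrightarrow> (a', b') \<in> G \<Longrightarrow> (a ** a', b ** b') \<in> G"
    and rel: "\<And>a b. (a, b) \<in> G \<Longrightarrow> b \<in> carrier GL2_F3 \<and> (\<exists>q\<in>q8. a = b ** q)"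
    and pm: "\<And>a a' b. (a, b) \<in> G \<Longrightarrow> (a', b) \<in> G \<Longrightarrow> a = a' \<or> a = - a'"
    and surj1: "\<And>a. a \<in> carrier GL2_F3 \<Longrightarrow> \<exists>b. (a, b) \<in> G"
    and surj2: "\<And>b. b \<in> carrier GL2_F3 \<Longrightarrow> \<exists>a. (a, b) \<in> G"
    and t: "(u, gl_t) \<in> G" "u = gl_t \<or> u = - gl_t"
    and ab: "(a, b) \<in> G"
  shows "a = b \<or> a = - b"
proof -
  define K where "K = {b. \<exists>a. (a, b) \<in> G \<and> (a = b \<or> a = - b)}"
  have K_mult: "b ** b' \<in> K" if "b \<in> K" "b' \<in> K" for b b'
    using that mult unfolding K_def by (fastforce simp: matrix_mult_minus)
  have tK: "gl_t \<in> K"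
    using t by (auto simp: K_def)
  obtain r where r: "(r, gl_s) \<in> G"
    using surj2 gl_in_carrier by blast
  have rs: "r = gl_s \<or> r = - gl_s"
  proof -
    obtain q where q: "q \<in> q8" "r = gl_s ** q"
      using rel[OF r] by blast
    have "gl_s ** gl_t = gl_t ** gl_t ** gl_s"
      by (simp add: gl_defs F3_eval)
    then have "r ** u = u ** u ** r \<or> r ** u = - (u ** u ** r)"
      using pm mult[OF r t(1)] mult[OF mult[OF t(1) t(1)] r] by simp
    then have "gl_s ** q ** gl_t = gl_t ** gl_t ** (gl_s ** q) \<or>
        gl_s ** q ** gl_t = - (gl_t ** gl_t ** (gl_s ** q))"
      using t(2) unfolding q(2) by (auto simp: matrix_mult_minus) (metis minus_minus)+
    moreover have "\<forall>q\<in>q8. gl_s ** q ** gl_t = gl_t ** gl_t ** (gl_s ** q) \<or>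
        gl_s ** q ** gl_t = - (gl_t ** gl_t ** (gl_s ** q)) \<longrightarrow> gl_s ** q = gl_s \<or> gl_s ** q = - gl_s"
      unfolding q8_all gl_defs by (simp add: F3_eval)
    ultimately show ?thesis
      using q by blast
  qed
  then have sK: "gl_s \<in> K"
    using r by (auto simp: K_def)
  obtain p where p: "(p, gl_i) \<in> G"
    using surj2 gl_in_carrier by blast
  have "p = mat 1 \<or> p = - mat 1 \<or> p = gl_i \<or> p = - gl_i"
  proof -
    have pq: "p \<in> q8"
      using rel[OF p] gl_i_in_q8 q8_mult by blast
    have "gl_s ** gl_i = gl_i ** gl_i ** gl_i ** gl_s"
      by (simp add: gl_defs F3_eval)
    then have "r ** p = p ** p ** p ** r \<or> r ** p = - (p ** p ** p ** r)"
      using pm mult[OF r p] mult[OF mult[OF mult[OF p p] p] r] by simp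
    then have "gl_s ** p = p ** p ** p ** gl_s \<or> gl_s ** p = - (p ** p ** p ** gl_s)"
      using rs by (auto simp: matrix_mult_minus) (metis minus_minus)+
    moreover have "\<forall>p\<in>q8. gl_s ** p = p ** p ** p ** gl_s \<or> gl_s ** p = - (p ** p ** p ** gl_s) \<longrightarrow>
        p = mat 1 \<or> p = - mat 1 \<or> p = gl_i \<or> p = - gl_i"
      unfolding q8_all gl_defs mat_1_eq by (simp add: F3_eval)
    ultimately show ?thesis
      using pq by blast
  qed
  moreover have "\<not> (p = mat 1 \<or> p = - mat 1)"
  proof
    assume p1: "p = mat 1 \<or> p = - mat 1"
    define L where "L = {b. (mat 1, b) \<in> G \<or> (- mat 1, b) \<in> G}"
    have L_mult: "b ** b' \<in> L" if "b \<in> L" "b' \<in> L" for b b'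
      using that mult unfolding L_def by (fastforce simp: matrix_mult_minus)
    have "(u ** p ** (u ** u), gl_t ** gl_i ** (gl_t ** gl_t)) \<in> G"
      by (intro mult t p)
    moreover have "gl_t ** (gl_t ** gl_t) = mat 1"
      by (simp add: gl_defs F3_eval mat_1_eq)
    then have "u ** p ** (u ** u) = mat 1 \<or> u ** p ** (u ** u) = - mat 1"
      using t(2) p1 by (auto simp: matrix_mult_minus)
    ultimately have j: "gl_t ** gl_i ** (gl_t ** gl_t) \<in> L"
      by (auto simp: L_def)
    have "q8 \<subseteq> L"
      by (rule q8_generated[OF L_mult gl_i_in_q8 gl_i_not_scalar _ j]) (use p p1 in \<open>auto simp: L_def\<close>)
    moreover obtain b where b: "(gl_i, b) \<in> G"
      using surj1 gl_in_carrier by blast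
    have "b \<in> q8"
    proof -
      interpret subgroup q8 GL2_F3
        using q8_normal by (simp add: GL.normal_inv_iff)
      obtain q where q: "q \<in> q8" "gl_i = b ** q"
        using rel[OF b] by blast
      have "gl_i \<otimes>\<^bsub>GL2_F3\<^esub> inv\<^bsub>GL2_F3\<^esub> q = b ** (q ** inv\<^bsub>GL2_F3\<^esub> q)"
        by (simp add: q(2) GL2_F3_simps(2) matrix_mul_assoc)
      then have "b = gl_i \<otimes>\<^bsub>GL2_F3\<^esub> inv\<^bsub>GL2_F3\<^esub> q"
        using GL.r_inv[OF mem_carrier[OF q(1)]] by (simp add: GL2_F3_simps)
      then show ?thesis
        using gl_i_in_q8 q(1) by simp
    qed
    \<comment> \<open>Now b is paired both with \<open>gl_i\<close> and with one of +-1, and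
      partners of the same b agree up to sign.\<close>
    ultimately have "(mat 1, b) \<in> G \<or> (- mat 1, b) \<in> G"
      by (auto simp: L_def)
    then show False
      using pm[OF b] gl_i_not_scalar by fastforce
  qed
  ultimately have "gl_i \<in> K"
    using p by (auto simp: K_def)
  then have "carrier GL2_F3 \<subseteq> K"
    by (intro GL2_F3_generated K_mult sK tK)
  then obtain a' where "(a', b) \<in> G" "a' = b \<or> a' = - b"
    using rel[OF ab] by (auto simp: K_def)
  then show ?thesis
    using pm[OF ab] by fastforce
qed

text \<open>
  Goursat's lemma for the subgroups of the fibre product over \<open>GL\<^sub>2(F\<^sub>3)/Q\<^sub>8\<close>: the kernel of the second
  projection is \<open>Q\<^sub>8\<close> or contained in \<open>{\<plusminus>1}\<close>, since a single element of \<open>Q\<^sub>8\<close> outside \<open>{\<plusminus>1}\<close> generates \<open>Q\<^sub>8\<close> as a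
  normal subgroup. In the latter case, the elements of the coset \<open>t Q\<^sub>8\<close> are \<open>Q\<^sub>8\<close>-conjugate to \<open>\<plusminus>t\<close>, so
  we may assume that \<open>t\<close> is paired with \<open>\<plusminus>t\<close>.
\<close>

lemma pairs_mod_q8_cases:
  assumes sub: "subgroup G (GL2_F3 \<times>\<times> GL2_F3)"
    and rel: "\<And>a b. (a, b) \<in> G \<Longrightarrow> \<exists>q\<in>q8. a = b ** q"
    and surj1: "\<And>a. a \<in> carrier GL2_F3 \<Longrightarrow> \<exists>b. (a, b) \<in> G"
    and surj2: "\<And>b. b \<in> carrier GL2_F3 \<Longrightarrow> \<exists>a. (a, b) \<in> G"
  obtains "\<And>b q. b \<in> carrier GL2_F3 \<Longrightarrow> q \<in> q8 \<Longrightarrow> (b ** q, b) \<in> G"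
    | v where "v \<in> carrier GL2_F3" "\<And>a b. (a, b) \<in> G \<Longrightarrow>
        inv\<^bsub>GL2_F3\<^esub> v \<otimes>\<^bsub>GL2_F3\<^esub> a \<otimes>\<^bsub>GL2_F3\<^esub> v = b \<or> inv\<^bsub>GL2_F3\<^esub> v \<otimes>\<^bsub>GL2_F3\<^esub> a \<otimes>\<^bsub>GL2_F3\<^esub> v = - b"
proof -
  have mult: "(a ** a', b ** b') \<in> G" if "(a, b) \<in> G" "(a', b') \<in> G" for a b a' b'
    using subgroup.m_closed[OF sub that] by (simp add: GL2_F3_simps)
  have car: "a \<in> carrier GL2_F3" "b \<in> carrier GL2_F3" if "(a, b) \<in> G" for a b
    using subgroup.mem_carrier[OF sub that] by simp_all
  have inv: "(inv\<^bsub>GL2_F3\<^esub> a, inv\<^bsub>GL2_F3\<^esub> b) \<in> G" if "(a, b) \<in> G" for a b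
    using subgroup.m_inv_closed[OF sub that] car[OF that] by (simp add: inv_DirProd group_GL2_F3)
  \<comment> \<open>The kernel of the second projection, seen in the first factor. It is normal
    there because the first projection is onto.\<close>
  define N where "N = {a. (a, mat 1) \<in> G}"
  have N_mult: "a ** b \<in> N" if "a \<in> N" "b \<in> N" for a b
    using mult[of a "mat 1" b "mat 1"] that by (simp add: N_def)
  have conj: "x \<otimes>\<^bsub>GL2_F3\<^esub> a \<otimes>\<^bsub>GL2_F3\<^esub> inv\<^bsub>GL2_F3\<^esub> x \<in> N" if x: "x \<in> carrier GL2_F3" and aN: "a \<in> N" for x a
  proof -
    obtain y where y: "(x, y) \<in> G" using surj1[OF x] by blast
    have a: "(a, mat 1) \<in> G" using aN unfolding N_def mem_Collect_eq .
    have "((x ** a) ** inv\<^bsub>GL2_F3\<^esub> x, (y ** mat 1) ** inv\<^bsub>GL2_F3\<^esub> y) \<in> G"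
      by (rule mult[OF mult[OF y a] inv[OF y]])
    moreover have "(y ** mat 1) ** inv\<^bsub>GL2_F3\<^esub> y = mat 1"
      using GL.r_inv[OF car(2)[OF y]] unfolding GL2_F3_simps(2,3) matrix_mul_rid .
    ultimately show ?thesis
      unfolding N_def mem_Collect_eq GL2_F3_simps(2) by metis
  qed
  have N_q8: "N \<subseteq> q8"
    using rel unfolding N_def by fastforce
  interpret q8: subgroup q8 GL2_F3
    using q8_normal by (simp add: GL.normal_inv_iff)
  show thesis
  proof (cases "N \<subseteq> {mat 1, - mat 1}")
    case False
    then obtain q where q: "q \<in> N" "q \<noteq> mat 1" "q \<noteq> - mat 1" by blast
    have "inv\<^bsub>GL2_F3\<^esub> gl_t = gl_t ** gl_t"
      by (simp add: gl_t_def inv_mat22 F3_eval)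
    then have "gl_t ** q ** (gl_t ** gl_t) \<in> N"
      using conj[OF gl_in_carrier(2) q(1)] by (simp add: GL2_F3_simps(2))
    moreover have "q \<in> q8"
      using q(1) N_q8 by blast
    ultimately have "q8 \<subseteq> N"
      using q8_generated[OF N_mult _ q(2,3) q(1)] by blast
    have "(b ** q, b) \<in> G" if b: "b \<in> carrier GL2_F3" and q: "q \<in> q8" for b q
    proof -
      obtain a where a: "(a, b) \<in> G" using surj2 b by blast
      then obtain p where p: "p \<in> q8" "a = b ** p" using rel by blast
      have "inv\<^bsub>GL2_F3\<^esub> p ** q \<in> N"
        using \<open>q8 \<subseteq> N\<close> q8_mult p(1) q by blast
      then have "(a ** (inv\<^bsub>GL2_F3\<^esub> p ** q), b ** mat 1) \<in> G"
        using mult[OF a] unfolding N_def mem_Collect_eq by blast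
      moreover have "a ** (inv\<^bsub>GL2_F3\<^esub> p ** q) = b ** ((p ** inv\<^bsub>GL2_F3\<^esub> p) ** q)"
        by (simp add: p(2) matrix_mul_assoc)
      ultimately show ?thesis
        using GL.r_inv[OF q8.mem_carrier[OF p(1)]] by (simp add: GL2_F3_simps)
    qed
    then show thesis by (rule that(1))
  next
    case True
    have pm: "a = a' \<or> a = - a'" if "(a, b) \<in> G" "(a', b) \<in> G" for a a' b
    proof -
      have "(a ** inv\<^bsub>GL2_F3\<^esub> a', b ** inv\<^bsub>GL2_F3\<^esub> b) \<in> G"
        by (intro mult inv that)
      then have "a ** inv\<^bsub>GL2_F3\<^esub> a' \<in> N"
        using GL.r_inv[OF car(2)[OF that(1)]] unfolding N_def mem_Collect_eq GL2_F3_simps(2,3) by (simp only:)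
      moreover have "a = (a ** inv\<^bsub>GL2_F3\<^esub> a') ** a'"
        using GL.l_inv[OF car(1)[OF that(2)]] by (simp add: GL2_F3_simps flip: matrix_mul_assoc)
      ultimately show ?thesis
        using True by (auto simp: matrix_mult_minus)
    qed
    obtain u where u: "(u, gl_t) \<in> G"
      using surj2 gl_in_carrier by blast
    then obtain q where q: "q \<in> q8" "u = gl_t ** q" using rel by blast
    have "\<forall>q\<in>q8. \<not> (\<forall>v\<in>q8. \<not> (gl_t ** q ** v = v ** gl_t \<or> gl_t ** q ** v = - (v ** gl_t)))"
      unfolding q8_all gl_defs by (simp add: F3_eval)
    then obtain v where v: "v \<in> q8" "u ** v = v ** gl_t \<or> u ** v = - (v ** gl_t)"
      using q by blast
    define w where "w = inv\<^bsub>GL2_F3\<^esub> v"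
    have w: "w ** v = mat 1" "v ** w = mat 1" "w \<in> q8" "w \<in> carrier GL2_F3" "v \<in> carrier GL2_F3"
      using GL.l_inv[OF q8.mem_carrier[OF v(1)]] GL.r_inv[OF q8.mem_carrier[OF v(1)]] v(1)
      by (simp_all add: w_def GL2_F3_simps(2,3))
    define c where "c a = w ** a ** v" for a
    have c_mult: "c (a ** b) = c a ** c b" for a b
    proof -
      have "c a ** c b = w ** a ** (v ** w) ** b ** v"
        by (simp add: c_def matrix_mul_assoc)
      then show ?thesis by (simp add: w c_def matrix_mul_assoc)
    qed
    have c_minus: "c (- a) = - c a" for a
      by (simp add: c_def matrix_mult_minus)
    \<comment> \<open>Conjugating the first coordinate by an element of \<open>q8\<close> keeps the
      pairs congruent modulo \<open>q8\<close> and makes the partner of t equal to +-t.\<close>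
    define G' where "G' = (\<lambda>(a, b). (c a, b)) ` G"
    have "c a = b \<or> c a = - b" if ab: "(a, b) \<in> G" for a b
    proof (rule pairs_up_to_sign[of G'])
      show "(a ** a', b ** b') \<in> G'" if "(a, b) \<in> G'" "(a', b') \<in> G'" for a b a' b'
        using that mult unfolding G'_def by (force simp: c_mult)
      show "b \<in> carrier GL2_F3 \<and> (\<exists>q\<in>q8. a = b ** q)" if ab': "(a, b) \<in> G'" for a b
      proof -
        obtain a0 where a0: "(a0, b) \<in> G" "a = c a0" using ab' by (auto simp: G'_def)
        then obtain p where p: "p \<in> q8" "a0 = b ** p" using rel by blast
        have b: "b \<in> carrier GL2_F3" using car a0 by blast
        define w' where "w' = inv\<^bsub>GL2_F3\<^esub> b \<otimes>\<^bsub>GL2_F3\<^esub> w \<otimes>\<^bsub>GL2_F3\<^esub> inv\<^bsub>GL2_F3\<^esub> (inv\<^bsub>GL2_F3\<^esub> b)"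
        have "w' \<in> q8"
          unfolding w'_def using b w by (intro q8_conj) simp_all
        then have "w' ** p ** v \<in> q8"
          by (intro q8_mult p(1) v(1))
        moreover have "w ** b = b ** w'"
        proof -
          have "b ** w' = (b ** inv\<^bsub>GL2_F3\<^esub> b) ** w ** b"
            unfolding w'_def using b by (simp add: GL2_F3_simps(2) matrix_mul_assoc)
          then show ?thesis
            using GL.r_inv[OF b] by (simp add: GL2_F3_simps)
        qed
        then have "a = b ** (w' ** p ** v)"
          unfolding a0(2) p(2) c_def by (simp add: matrix_mul_assoc)
        ultimately show ?thesis
          using b by metis
      qed
      show "a = a' \<or> a = - a'" if "(a, b) \<in> G'" "(a', b) \<in> G'" for a a' b
        using that pm unfolding G'_def by (fastforce simp: c_minus)
      show "\<exists>b. (a, b) \<in> G'" if "a \<in> carrier GL2_F3" for a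
      proof -
        have "v ** a ** w \<in> carrier GL2_F3"
          using w that GL.m_closed by (simp add: GL2_F3_simps(2) [symmetric])
        then obtain b where "(v ** a ** w, b) \<in> G" using surj1 by blast
        moreover have "c (v ** a ** w) = (w ** v) ** a ** (w ** v)"
          by (simp add: c_def matrix_mul_assoc)
        ultimately show ?thesis
          unfolding G'_def by (force simp: w)
      qed
      show "\<exists>a. (a, b) \<in> G'" if "b \<in> carrier GL2_F3" for b
        using surj2[OF that] by (force simp: G'_def)
      show "(c u, gl_t) \<in> G'"
        using u by (force simp: G'_def)
      have cu: "c u = w ** (u ** v)"
        by (simp add: c_def matrix_mul_assoc)
      have wv: "w ** (v ** gl_t) = gl_t"
        by (simp add: w matrix_mul_assoc)
      show "c u = gl_t \<or> c u = - gl_t"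
        using v(2) unfolding cu by (elim disjE) (simp_all only: wv matrix_mult_minus simp_thms)
      show "(c a, b) \<in> G'"
        using ab by (force simp: G'_def)
    qed
    then show thesis
      using that(2)[of v] w by (simp add: c_def w_def GL2_F3_simps(2))
  qed
qed

section \<open>The Galois action on the cube roots of the discriminant\<close>

text \<open>The condition from \<open>resolvent_eq_1_iff\<close>. Among the invertible matrices it
  cuts out the stabilizer of one pairing, a subgroup of order 16 that contains
  \<open>q8\<close>.\<close>

definition pairing_stab :: "F3 ^ 2 ^ 2 \<Rightarrow> bool" where
  "pairing_stab A \<longleftrightarrow> (A $ 1 $ 1 * A $ 2 $ 1 = 0 \<longleftrightarrow> A $ 1 $ 2 * A $ 2 $ 2 = 0)"

lemma pairing_stab_mat22: "pairing_stab (mat22 a b c d) \<longleftrightarrow> (a * c = 0 \<longleftrightarrow> b * d = 0)"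
  by (simp add: pairing_stab_def mat22_def)

text \<open>This cyclic group permutes the three pairings simply transitively, so its elements serve
  as names for them. As p ** p is the inverse of p, the test
  \<open>pairing_stab (p ** p ** A)\<close> asks whether A and p select the same pairing.\<close>

definition gl_C3 :: "(F3 ^ 2 ^ 2) set" where
  "gl_C3 = {mat 1, gl_t, gl_t ** gl_t}"

lemma gl_C3_subset: "gl_C3 \<subseteq> carrier GL2_F3"
  using GL.m_closed[OF gl_in_carrier(2) gl_in_carrier(2)] GL.one_closed gl_in_carrier
  by (auto simp: gl_C3_def GL2_F3_simps(2,3))

lemma gl_C3_cube: "p \<in> gl_C3 \<Longrightarrow> p ** (p ** p) = mat 1"
  by (auto simp: gl_C3_def gl_t_def F3_eval mat_1_eq)

lemma gl_C3_cases: "A \<in> carrier GL2_F3 \<Longrightarrow> \<exists>p\<in>gl_C3. pairing_stab (p ** p ** A)"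
proof -
  have "\<forall>A\<in>carrier GL2_F3. \<exists>p\<in>gl_C3. pairing_stab (p ** p ** A)"
    unfolding GL2_F3_all gl_C3_def mat_1_eq gl_t_def by (simp add: F3_eval pairing_stab_mat22)
  then show "A \<in> carrier GL2_F3 \<Longrightarrow> ?thesis" by blast
qed

text \<open>GL_2(F_3) induces all permutations of the three pairings: some g takes those named 1, t,
  t^2 to those named p, q, r. The six candidates form the subgroup generated by \<open>gl_s\<close>
  and \<open>gl_t\<close>.\<close>

lemma gl_C3_permutation:
  assumes "p \<in> gl_C3" "q \<in> gl_C3" "r \<in> gl_C3" "p \<noteq> q" "p \<noteq> r" "q \<noteq> r"
  shows "\<exists>g\<in>carrier GL2_F3. pairing_stab (p ** p ** g) \<and> pairing_stab (q ** q ** (g ** gl_t)) \<and>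
    pairing_stab (r ** r ** (g ** (gl_t ** gl_t)))"
proof -
  let ?S = "{mat22 1 0 0 1, mat22 1 1 0 1, mat22 1 2 0 1, mat22 1 0 0 2, mat22 1 2 0 2, mat22 1 1 0 2}"
  have "\<forall>p\<in>gl_C3. \<forall>q\<in>gl_C3. \<forall>r\<in>gl_C3. p \<noteq> q \<longrightarrow> p \<noteq> r \<longrightarrow> q \<noteq> r \<longrightarrow>
      (\<exists>g\<in>?S. pairing_stab (p ** p ** g) \<and> pairing_stab (q ** q ** (g ** gl_t)) \<and>
        pairing_stab (r ** r ** (g ** (gl_t ** gl_t))))"
    unfolding gl_C3_def gl_t_def mat_1_eq by (simp add: F3_eval pairing_stab_mat22)
  moreover have "?S \<subseteq> carrier GL2_F3"
    by (simp add: GL2_F3_simps(1) invertible_mat22_iff)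
  ultimately show ?thesis
    using assms by (meson subsetD)
qed

lemma q8_pairing_stab: "q \<in> q8 \<Longrightarrow> pairing_stab q"
  by (auto simp: q8_def pairing_stab_mat22)

text \<open>A matrix that fixes all three pairings lies in the kernel of the map to S_3.\<close>

lemma in_q8_if_pairing_stab:
  assumes "C \<in> carrier GL2_F3" "\<And>p. p \<in> gl_C3 \<Longrightarrow> pairing_stab (p ** p ** (C ** p))"
  shows "C \<in> q8"
proof -
  have "\<forall>C\<in>carrier GL2_F3. (\<forall>p\<in>gl_C3. pairing_stab (p ** p ** (C ** p))) \<longrightarrow> C \<in> q8"
    unfolding GL2_F3_all gl_C3_def mat_1_eq gl_t_def
    by (simp add: F3_eval pairing_stab_mat22 mat22_in_q8)
  then show ?thesis using assms by blast
qed

lemma q8_commute: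
  assumes "A \<in> carrier GL2_F3" "q \<in> q8"
  obtains q' where "q' \<in> q8" "q ** A = A ** q'"
proof
  let ?q' = "inv\<^bsub>GL2_F3\<^esub> A \<otimes>\<^bsub>GL2_F3\<^esub> q \<otimes>\<^bsub>GL2_F3\<^esub> inv\<^bsub>GL2_F3\<^esub> (inv\<^bsub>GL2_F3\<^esub> A)"
  show "?q' \<in> q8"
    using assms by (intro q8_conj) simp_all
  have "A ** ?q' = (A ** inv\<^bsub>GL2_F3\<^esub> A) ** q ** A"
    using assms(1) by (simp add: GL2_F3_simps(2) matrix_mul_assoc)
  then show "q ** A = A ** ?q'"
    using GL.r_inv[OF assms(1)] by (simp add: GL2_F3_simps(2,3))
qed

section \<open>Triples of cube roots and their permutation by matrices\<close>

lemma cube_roots_sum: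
  fixes x :: "'a :: field"
  assumes "x ^ 3 = D" "y ^ 3 = D" "z ^ 3 = D" "x \<noteq> y" "x \<noteq> z" "y \<noteq> z"
  shows "x ^ 2 + x * y + y ^ 2 = 0" "x + y + z = 0"
proof -
  have *: "u ^ 2 + u * v + v ^ 2 = 0" if "u ^ 3 = D" "v ^ 3 = D" "u \<noteq> v" for u v
  proof -
    have "(u - v) * (u ^ 2 + u * v + v ^ 2) = u ^ 3 - v ^ 3"
      by Groebner_Basis.algebra
    then show ?thesis using that by simp
  qed
  show xy: "x ^ 2 + x * y + y ^ 2 = 0"
    using * assms by blast
  have "x ^ 2 + x * z + z ^ 2 = 0"
    using * assms by blast
  then have "(y - z) * (x + y + z) = 0"
    using xy by Groebner_Basis.algebra
  then show "x + y + z = 0"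
    using assms by simp
qed

text \<open>The ratios x2 / x1 and y2 / y1 are both roots of X^2 + X + 1, hence equal or inverse to
  each other. The third roots follow because each triple sums to zero.\<close>

lemma cube_roots_proportional:
  fixes x1 :: "'a :: field"
  assumes x: "x1 ^ 3 = D" "x2 ^ 3 = D" "x3 ^ 3 = D" "x1 \<noteq> x2" "x1 \<noteq> x3" "x2 \<noteq> x3"
    and y: "y1 ^ 3 = D'" "y2 ^ 3 = D'" "y3 ^ 3 = D'" "y1 \<noteq> y2" "y1 \<noteq> y3" "y2 \<noteq> y3"
    and nz: "D \<noteq> 0" "D' \<noteq> 0"
  shows "x1 * y1 = x2 * y2 \<and> x1 * y1 = x3 * y3 \<or> x1 / y1 = x2 / y2 \<and> x1 / y1 = x3 / y3"
proof -
  note X = cube_roots_sum[OF x] and Y = cube_roots_sum[OF y]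
  have ne: "x1 \<noteq> 0" "x2 \<noteq> 0" "x3 \<noteq> 0" "y1 \<noteq> 0" "y2 \<noteq> 0" "y3 \<noteq> 0"
    using x y nz by auto
  have "(x1 * y2 - x2 * y1) * (x1 * y1 - x2 * y2) = 0"
    using X(1) Y(1) by Groebner_Basis.algebra
  then consider "x1 * y2 = x2 * y1" | "x1 * y1 = x2 * y2"
    by auto
  then show ?thesis
  proof cases
    case 1
    then have "x1 * y3 = x3 * y1"
      using X(2) Y(2) by Groebner_Basis.algebra
    then show ?thesis
      using 1 ne by (simp add: field_simps)
  next
    case 2
    then have "x2 * (x1 * y2 + x2 * y1 + x2 * y2) = 0"
      using X(1) by Groebner_Basis.algebra
    then have "x1 * y2 + x2 * y1 + x2 * y2 = 0"
      using ne by simp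
    then have "x1 * y1 = x3 * y3"
      using X(2) Y(2) by Groebner_Basis.algebra
    then show ?thesis
      using 2 by simp
  qed
qed

text \<open>\<open>T A\<close> is the cube root of the discriminant that belongs to the pairing
  selected by A.\<close>

locale resolvent_rep =
  fixes \<rho> :: F3_rep and T :: "F3 ^ 2 ^ 2 \<Rightarrow> Qbar" and \<Delta> :: rat
  assumes surj: "\<rho> ` carrier gal_Q = carrier GL2_F3"
    and nonzero: "\<Delta> \<noteq> 0"
    and T_equiv: "\<sigma> \<in> carrier gal_Q \<Longrightarrow> \<sigma> (T A) = T (\<rho> \<sigma> ** A)"
    and T_1: "T (mat 1) ^ 3 = to_ac \<Delta>"
    and T_eq_1_iff: "A \<in> carrier GL2_F3 \<Longrightarrow> T A = T (mat 1) \<longleftrightarrow> pairing_stab A"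
begin

text \<open>By surjectivity A is the image of some \<sigma>, and left multiplication by A becomes
  the injective map \<sigma> on values.\<close>

lemma T_mult_cancel:
  assumes "A \<in> carrier GL2_F3"
  shows "T (A ** B) = T (A ** C) \<longleftrightarrow> T B = T C"
proof -
  obtain \<sigma> where "\<sigma> \<in> carrier gal_Q" "\<rho> \<sigma> = A"
    using surj assms by (metis imageE)
  then show ?thesis
    using T_equiv gal_Q_eq_iff by metis
qed

lemma T_cube:
  assumes "A \<in> carrier GL2_F3"
  shows "T A ^ 3 = to_ac \<Delta>"
proof -
  obtain \<sigma> where \<sigma>: "\<sigma> \<in> carrier gal_Q" "\<rho> \<sigma> = A"
    using surj assms by (metis imageE)
  then have "T A = \<sigma> (T (mat 1))"
    using T_equiv[OF \<sigma>(1), of "mat 1"] by simp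
  then show ?thesis
    by (simp add: T_1 gal_Q_to_ac[OF \<sigma>(1)] flip: gal_Q_power[OF \<sigma>(1)])
qed

lemma T_eq_C3_iff:
  assumes "A \<in> carrier GL2_F3" "p \<in> gl_C3"
  shows "T A = T p \<longleftrightarrow> pairing_stab (p ** p ** A)"
proof -
  have p: "p ** p \<in> carrier GL2_F3"
    using GL.m_closed[of p p] gl_C3_subset assms(2) by (auto simp: GL2_F3_simps(2))
  have "T A = T p \<longleftrightarrow> T (p ** p ** A) = T (p ** p ** p)"
    by (simp add: T_mult_cancel[OF p])
  also have "p ** p ** p = mat 1"
    using gl_C3_cube[OF assms(2)] by (simp add: matrix_mul_assoc)
  finally show ?thesis
    using T_eq_1_iff GL.m_closed[OF p assms(1)] by (simp add: GL2_F3_simps(2))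
qed

text \<open>\<open>T_eq_1_iff\<close> only speaks of the base pairing; normality of
  \<open>q8\<close> moves q past B to the right, where it acts on that pairing.\<close>

lemma T_q8:
  assumes "A \<in> carrier GL2_F3" "B \<in> carrier GL2_F3" "q \<in> q8"
  shows "T (A ** (q ** B)) = T (A ** B)"
proof -
  obtain q' where q': "q' \<in> q8" "q ** B = B ** q'"
    using q8_commute assms by metis
  have "T q' = T (mat 1)"
    using q'(1) q8_subset T_eq_1_iff q8_pairing_stab by blast
  then have "T (B ** q') = T (B ** mat 1)"
    using T_mult_cancel assms by metis
  then show ?thesis
    using q'(2) T_mult_cancel assms by simp
qed

lemma T_C3_distinct: "T (mat 1) \<noteq> T gl_t" "T (mat 1) \<noteq> T (gl_t ** gl_t)" "T gl_t \<noteq> T (gl_t ** gl_t)"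
proof -
  have C: "mat 1 \<in> gl_C3" "gl_t \<in> gl_C3" "gl_t ** gl_t \<in> gl_C3"
    by (simp_all add: gl_C3_def)
  then have "mat 1 \<in> carrier GL2_F3" "gl_t \<in> carrier GL2_F3"
    using gl_C3_subset by blast+
  then show "T (mat 1) \<noteq> T gl_t" "T (mat 1) \<noteq> T (gl_t ** gl_t)" "T gl_t \<noteq> T (gl_t ** gl_t)"
    using C by (simp_all add: T_eq_C3_iff) (simp_all add: gl_t_def mat_1_eq F3_eval pairing_stab_mat22)
qed

text \<open>Three distinct cube roots sum to zero, so the first two values of T determine the third
  and leave no room for a fourth root.\<close>

lemma T_cube_roots:
  assumes "y ^ 3 = to_ac \<Delta>"
  shows "\<exists>p\<in>gl_C3. y = T p"
proof (rule ccontr)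
  have C: "mat 1 \<in> carrier GL2_F3" "gl_t \<in> carrier GL2_F3" "gl_t ** gl_t \<in> carrier GL2_F3"
    using gl_C3_subset by (auto simp: gl_C3_def)
  note cubes = C[THEN T_cube]
  assume "\<not> ?thesis"
  then have "y \<noteq> T (mat 1)" "y \<noteq> T gl_t" "y \<noteq> T (gl_t ** gl_t)"
    by (auto simp: gl_C3_def)
  then have "T (mat 1) + T gl_t + y = 0"
    using cube_roots_sum(2)[OF cubes(1,2) assms] T_C3_distinct by metis
  moreover have "T (mat 1) + T gl_t + T (gl_t ** gl_t) = 0"
    using cube_roots_sum(2)[OF cubes] T_C3_distinct by metis
  ultimately show False
    using \<open>y \<noteq> T (gl_t ** gl_t)\<close> by (metis add_left_cancel)
qed

end

lemma resolvent_rep_mod3_rep: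
  assumes "elliptic_curve E" "torsion3_basis E B" "surjective_rep (mod3_rep E B)"
  obtains T where "resolvent_rep (mod3_rep E B) T (discriminant E)"
proof -
  obtain T where T: "\<And>\<sigma> A. \<sigma> \<in> carrier gal_Q \<Longrightarrow> \<sigma> (T A) = T (mod3_rep E B \<sigma> ** A)"
    "T (mat22 1 0 0 1) ^ 3 = to_ac (discriminant E)"
    "\<And>a b c d. a * d - b * c \<noteq> 0 \<Longrightarrow> T (mat22 a b c d) = T (mat22 1 0 0 1) \<longleftrightarrow> (a * c = 0 \<longleftrightarrow> b * d = 0)"
    using mod3_rep_resolvent[OF assms(2)] by blast
  have "\<forall>A\<in>carrier GL2_F3. T A = T (mat 1) \<longleftrightarrow> pairing_stab A"
    unfolding GL2_F3_all pairing_stab_mat22 mat_1_eq using T(3) by blast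
  then have "resolvent_rep (mod3_rep E B) T (discriminant E)"
    using T(1,2) assms by unfold_locales (simp_all add: mat_1_eq surjective_rep_def elliptic_curve_def)
  then show ?thesis by (rule that)
qed

lemma group_gal_Q: "group gal_Q"
proof (rule groupI)
  fix \<sigma> assume \<sigma>: "\<sigma> \<in> carrier gal_Q"
  have bij: "bij \<sigma>" using \<sigma> by (rule gal_Q_bij)
  note s = surj_f_inv_f[OF bij_is_surj[OF bij]]
  have eqI: "inv_into UNIV \<sigma> x = y" if "x = \<sigma> y" for x y
    using that bij by (simp add: bij_is_inj)
  have "inv_into UNIV \<sigma> \<in> carrier gal_Q"
    using bij by (auto simp: gal_Q_def bij_imp_bij_inv gal_Q_simps[OF \<sigma>] s intro!: eqI)
  moreover have "inv_into UNIV \<sigma> \<circ> \<sigma> = id"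
    using bij by (simp add: bij_is_inj)
  ultimately show "\<exists>\<tau>\<in>carrier gal_Q. \<tau> \<otimes>\<^bsub>gal_Q\<^esub> \<sigma> = \<one>\<^bsub>gal_Q\<^esub>"
    unfolding gal_Q_def by auto
qed (auto simp: gal_Q_def bij_comp)

lemma mod3_rep_hom:
  assumes "torsion3_basis E B" "surjective_rep (mod3_rep E B)"
  shows "mod3_rep E B \<in> hom gal_Q GL2_F3"
proof (rule homI)
  fix \<sigma> \<tau> assume \<sigma>: "\<sigma> \<in> carrier gal_Q" and \<tau>: "\<tau> \<in> carrier gal_Q"
  show "mod3_rep E B \<sigma> \<in> carrier GL2_F3"
    using assms(2) \<sigma> by (auto simp: surjective_rep_def)
  have "\<sigma> \<otimes>\<^bsub>gal_Q\<^esub> \<tau> = \<sigma> \<circ> \<tau>"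
    by (simp add: gal_Q_def)
  then show "mod3_rep E B (\<sigma> \<otimes>\<^bsub>gal_Q\<^esub> \<tau>) = mod3_rep E B \<sigma> \<otimes>\<^bsub>GL2_F3\<^esub> mod3_rep E B \<tau>"
    using mod3_rep_mult[OF assms(1) \<sigma> \<tau>] by (simp add: GL2_F3_simps(2))
qed

text \<open>Prescribing the values of an automorphism on a finite set is an open condition in the
  Krull topology, so \<psi> is locally constant.\<close>

lemma sign_characterI:
  assumes hom: "\<psi> \<in> hom gal_Q sign_img" and "finite F"
    and F: "\<And>\<sigma> \<tau>. \<sigma> \<in> carrier gal_Q \<Longrightarrow> \<tau> \<in> carrier gal_Q \<Longrightarrow> (\<And>x. x \<in> F \<Longrightarrow> \<sigma> x = \<tau> x) \<Longrightarrow> \<psi> \<sigma> = \<psi> \<tau>"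
  shows "sign_character \<psi>"
proof -
  have top: "topspace krull_topology = carrier gal_Q"
    by (simp add: krull_topology_def)
  have "openin krull_topology {\<sigma> \<in> carrier gal_Q. \<psi> \<sigma> \<in> U}" for U
  proof (subst openin_subopen, intro ballI)
    fix \<sigma> assume \<sigma>: "\<sigma> \<in> {\<sigma> \<in> carrier gal_Q. \<psi> \<sigma> \<in> U}"
    define S where "S = (\<Pi>\<^sub>E x\<in>UNIV. if x \<in> F then {\<sigma> x} else UNIV)"
    have "openin (product_topology (\<lambda>_. discrete_topology UNIV) UNIV) S"
      unfolding S_def by (rule product_topology_basis)
        (use \<open>finite F\<close> in \<open>auto intro: finite_subset[of _ F]\<close>)
    then have "openin krull_topology (S \<inter> carrier gal_Q)"
      by (auto simp: krull_topology_def openin_subtopology)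
    moreover have "\<sigma> \<in> S \<inter> carrier gal_Q"
      using \<sigma> by (auto simp: S_def)
    moreover have "S \<inter> carrier gal_Q \<subseteq> {\<sigma> \<in> carrier gal_Q. \<psi> \<sigma> \<in> U}"
    proof
      fix \<tau> assume \<tau>: "\<tau> \<in> S \<inter> carrier gal_Q"
      then have "\<tau> x = \<sigma> x" if "x \<in> F" for x
        using that by (auto simp: S_def PiE_iff split: if_splits)
      then have "\<psi> \<tau> = \<psi> \<sigma>"
        using \<sigma> \<tau> by (intro F) auto
      then show "\<tau> \<in> {\<sigma> \<in> carrier gal_Q. \<psi> \<sigma> \<in> U}"
        using \<sigma> \<tau> by simp
    qed
    ultimately show "\<exists>W. openin krull_topology W \<and> \<sigma> \<in> W \<and> W \<subseteq> {\<sigma> \<in> carrier gal_Q. \<psi> \<sigma> \<in> U}"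
      by blast
  qed
  then show ?thesis
    using hom by (auto simp: sign_character_def continuous_map_def top hom_def)
qed

section \<open>The subgroup H_Q and the two implications\<close>

interpretation GL2: group "GL2_F3 \<times>\<times> GL2_F3"
  by (intro DirProd_group group_GL2_F3)

lemma HQ_iff: "(a, b) \<in> HQ \<longleftrightarrow> b \<in> carrier GL2_F3 \<and> (\<exists>q\<in>q8. a = q ** b)"
proof
  assume ab: "(a, b) \<in> HQ"
  then have car: "a \<in> carrier GL2_F3" "b \<in> carrier GL2_F3" and q: "a \<otimes>\<^bsub>GL2_F3\<^esub> inv\<^bsub>GL2_F3\<^esub> b \<in> q8"
    by (simp_all add: HQ_def Q8_eq)
  have "a = (a \<otimes>\<^bsub>GL2_F3\<^esub> inv\<^bsub>GL2_F3\<^esub> b) \<otimes>\<^bsub>GL2_F3\<^esub> b"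
    using car by (simp add: GL.m_assoc)
  then show "b \<in> carrier GL2_F3 \<and> (\<exists>q\<in>q8. a = q ** b)"
    using car q by (metis GL2_F3_simps(2))
next
  assume "b \<in> carrier GL2_F3 \<and> (\<exists>q\<in>q8. a = q ** b)"
  then obtain q where b: "b \<in> carrier GL2_F3" and q: "q \<in> q8" "a = q \<otimes>\<^bsub>GL2_F3\<^esub> b"
    by (auto simp: GL2_F3_simps(2))
  have qc: "q \<in> carrier GL2_F3"
    using q(1) q8_subset by blast
  then have "a \<otimes>\<^bsub>GL2_F3\<^esub> inv\<^bsub>GL2_F3\<^esub> b = q"
    using b by (simp add: q(2) GL.m_assoc)
  then show "(a, b) \<in> HQ"
    using b q qc by (simp add: HQ_def Q8_eq)
qed

lemma realizes_HQ_iff: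
  "realizes_HQ \<rho>1 \<rho>2 \<longleftrightarrow> (\<exists>g\<in>carrier GL2_F3. \<exists>h\<in>carrier GL2_F3.
     (\<lambda>\<sigma>. (\<rho>1 \<sigma>, \<rho>2 \<sigma>)) ` carrier gal_Q =
     (\<lambda>(a, b). (g \<otimes>\<^bsub>GL2_F3\<^esub> a \<otimes>\<^bsub>GL2_F3\<^esub> inv\<^bsub>GL2_F3\<^esub> g, h \<otimes>\<^bsub>GL2_F3\<^esub> b \<otimes>\<^bsub>GL2_F3\<^esub> inv\<^bsub>GL2_F3\<^esub> h)) ` HQ)"
proof -
  have "(\<lambda>x. (g, h) \<otimes>\<^bsub>GL2_F3 \<times>\<times> GL2_F3\<^esub> x \<otimes>\<^bsub>GL2_F3 \<times>\<times> GL2_F3\<^esub> inv\<^bsub>GL2_F3 \<times>\<times> GL2_F3\<^esub> (g, h)) =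
      (\<lambda>(a, b). (g \<otimes>\<^bsub>GL2_F3\<^esub> a \<otimes>\<^bsub>GL2_F3\<^esub> inv\<^bsub>GL2_F3\<^esub> g, h \<otimes>\<^bsub>GL2_F3\<^esub> b \<otimes>\<^bsub>GL2_F3\<^esub> inv\<^bsub>GL2_F3\<^esub> h))"
    if "g \<in> carrier GL2_F3" "h \<in> carrier GL2_F3" for g h
    using that by (auto simp: inv_DirProd[OF group_GL2_F3 group_GL2_F3] fun_eq_iff)
  then show ?thesis
    unfolding realizes_HQ_def conjugate_in_def by (simp add: DirProd_def Bex_def) (metis (no_types, lifting))
qed

lemma twist_rep_cases:
  assumes "\<psi> \<in> hom gal_Q sign_img" "\<sigma> \<in> carrier gal_Q"
  shows "\<psi> \<sigma> = 1 \<and> twist_rep \<psi> \<rho> \<sigma> = \<rho> \<sigma> \<or> \<psi> \<sigma> = - 1 \<and> twist_rep \<psi> \<rho> \<sigma> = - \<rho> \<sigma>"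
proof -
  have "\<psi> \<sigma> = 1 \<or> \<psi> \<sigma> = - 1"
    using assms by (auto simp: hom_def sign_img_def)
  then show ?thesis
    by (auto simp: twist_rep_def vec_eq_iff)
qed

text \<open>H_Q contains (1, \<open>gl_i\<close>). So some \<sigma> acts trivially through \<rho>1
  and with order 4 through \<rho>2, whereas in a twist of \<rho>1 it would act as +-1.\<close>

lemma realizes_HQ_not_twist:
  assumes "realizes_HQ \<rho>1 \<rho>2" "sign_character \<psi>"
  shows "\<not> isomorphic_reps \<rho>2 (twist_rep \<psi> \<rho>1)"
proof
  assume "isomorphic_reps \<rho>2 (twist_rep \<psi> \<rho>1)"
  then obtain k where k: "k \<in> carrier GL2_F3" and iso: "\<And>\<sigma>. \<sigma> \<in> carrier gal_Q \<Longrightarrow>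
      twist_rep \<psi> \<rho>1 \<sigma> = k \<otimes>\<^bsub>GL2_F3\<^esub> \<rho>2 \<sigma> \<otimes>\<^bsub>GL2_F3\<^esub> inv\<^bsub>GL2_F3\<^esub> k"
    unfolding isomorphic_reps_def by blast
  obtain g h where gh: "g \<in> carrier GL2_F3" "h \<in> carrier GL2_F3" and
    img: "(\<lambda>\<sigma>. (\<rho>1 \<sigma>, \<rho>2 \<sigma>)) ` carrier gal_Q =
     (\<lambda>(a, b). (g \<otimes>\<^bsub>GL2_F3\<^esub> a \<otimes>\<^bsub>GL2_F3\<^esub> inv\<^bsub>GL2_F3\<^esub> g, h \<otimes>\<^bsub>GL2_F3\<^esub> b \<otimes>\<^bsub>GL2_F3\<^esub> inv\<^bsub>GL2_F3\<^esub> h)) ` HQ"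
    using assms(1) unfolding realizes_HQ_iff by blast
  have "- gl_i ** gl_i = mat 1" "- gl_i \<in> q8"
    by (simp_all add: gl_i_def F3_eval mat_1_eq mat22_in_q8)
  then have "(mat 1, gl_i) \<in> HQ"
    unfolding HQ_iff using gl_in_carrier by metis
  then have "(g \<otimes>\<^bsub>GL2_F3\<^esub> mat 1 \<otimes>\<^bsub>GL2_F3\<^esub> inv\<^bsub>GL2_F3\<^esub> g, h \<otimes>\<^bsub>GL2_F3\<^esub> gl_i \<otimes>\<^bsub>GL2_F3\<^esub> inv\<^bsub>GL2_F3\<^esub> h)
      \<in> (\<lambda>\<sigma>. (\<rho>1 \<sigma>, \<rho>2 \<sigma>)) ` carrier gal_Q"
    unfolding img by force
  then obtain \<sigma> where \<sigma>: "\<sigma> \<in> carrier gal_Q" "\<rho>1 \<sigma> = g \<otimes>\<^bsub>GL2_F3\<^esub> mat 1 \<otimes>\<^bsub>GL2_F3\<^esub> inv\<^bsub>GL2_F3\<^esub> g"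
    "\<rho>2 \<sigma> = h \<otimes>\<^bsub>GL2_F3\<^esub> gl_i \<otimes>\<^bsub>GL2_F3\<^esub> inv\<^bsub>GL2_F3\<^esub> h"
    by auto
  have "\<rho>1 \<sigma> = mat 1"
    using \<sigma>(2) gh GL.r_inv[of g] by (simp add: GL2_F3_simps(2,3))
  then have tw: "twist_rep \<psi> \<rho>1 \<sigma> = mat 1 \<or> twist_rep \<psi> \<rho>1 \<sigma> = - mat 1"
    using twist_rep_cases[of \<psi> \<sigma> \<rho>1] \<sigma>(1) assms(2) by (auto simp: sign_character_def)
  define m where "m = k \<otimes>\<^bsub>GL2_F3\<^esub> h"
  have m: "m \<in> carrier GL2_F3" using k gh by (simp add: m_def)
  have "twist_rep \<psi> \<rho>1 \<sigma> = m \<otimes>\<^bsub>GL2_F3\<^esub> gl_i \<otimes>\<^bsub>GL2_F3\<^esub> inv\<^bsub>GL2_F3\<^esub> m"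
    unfolding iso[OF \<sigma>(1)] \<sigma>(3) m_def
    using k gh gl_in_carrier by (simp add: GL.inv_mult_group GL.m_assoc)
  then have "gl_i = inv\<^bsub>GL2_F3\<^esub> m ** twist_rep \<psi> \<rho>1 \<sigma> ** m"
    using m gl_in_carrier by (simp add: GL.m_assoc GL.inv_solve_left flip: GL2_F3_simps(2))
  then have "gl_i = mat 1 \<or> gl_i = - mat 1"
    using tw GL.l_inv[OF m] by (auto simp: matrix_mult_minus GL2_F3_simps(2,3))
  then show False
    using gl_i_not_scalar by simp
qed

lemma realizes_HQ_imp_cube:
  assumes R1: "resolvent_rep \<rho>1 T1 \<Delta>1" and R2: "resolvent_rep \<rho>2 T2 \<Delta>2" and HQ: "realizes_HQ \<rho>1 \<rho>2"
  shows "\<exists>s\<in>{1, - 1 :: int}. \<Delta>1 * \<Delta>2 powi s \<in> nonzero_cubes"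
proof -
  interpret R1: resolvent_rep \<rho>1 T1 \<Delta>1 by (rule R1)
  interpret R2: resolvent_rep \<rho>2 T2 \<Delta>2 by (rule R2)
  obtain g h where gh: "g \<in> carrier GL2_F3" "h \<in> carrier GL2_F3" and
    img: "(\<lambda>\<sigma>. (\<rho>1 \<sigma>, \<rho>2 \<sigma>)) ` carrier gal_Q =
     (\<lambda>(a, b). (g \<otimes>\<^bsub>GL2_F3\<^esub> a \<otimes>\<^bsub>GL2_F3\<^esub> inv\<^bsub>GL2_F3\<^esub> g, h \<otimes>\<^bsub>GL2_F3\<^esub> b \<otimes>\<^bsub>GL2_F3\<^esub> inv\<^bsub>GL2_F3\<^esub> h)) ` HQ"
    using HQ unfolding realizes_HQ_iff by blast
  define x where "x p = T1 (g ** p)" for p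
  define y where "y p = T2 (h ** p)" for p
  have car: "u ** v \<in> carrier GL2_F3" if "u \<in> carrier GL2_F3" "v \<in> carrier GL2_F3" for u v
    using GL.m_closed[OF that] by (simp add: GL2_F3_simps(2))
  have C: "mat 1 \<in> gl_C3" "gl_t \<in> gl_C3" "gl_t ** gl_t \<in> gl_C3"
    by (simp_all add: gl_C3_def)
  \<comment> \<open>Elements of H_Q permute the pairings on both sides in the same way, because
    \<open>q8\<close> fixes every pairing. The shifts by g and h in \<open>x\<close> and
    \<open>y\<close> undo the conjugation of the image.\<close>
  have act: "\<exists>q\<in>gl_C3. \<sigma> (x p) = x q \<and> \<sigma> (y p) = y q" if \<sigma>: "\<sigma> \<in> carrier gal_Q" and p: "p \<in> gl_C3" for \<sigma> p
  proof -
    have p': "p \<in> carrier GL2_F3" using p gl_C3_subset by blast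
    have "(\<rho>1 \<sigma>, \<rho>2 \<sigma>) \<in> (\<lambda>(a, b). (g \<otimes>\<^bsub>GL2_F3\<^esub> a \<otimes>\<^bsub>GL2_F3\<^esub> inv\<^bsub>GL2_F3\<^esub> g, h \<otimes>\<^bsub>GL2_F3\<^esub> b \<otimes>\<^bsub>GL2_F3\<^esub> inv\<^bsub>GL2_F3\<^esub> h)) ` HQ"
      unfolding img[symmetric] using \<sigma> by blast
    then obtain a b where ab: "(a, b) \<in> HQ" "\<rho>1 \<sigma> = g ** a ** inv\<^bsub>GL2_F3\<^esub> g" "\<rho>2 \<sigma> = h ** b ** inv\<^bsub>GL2_F3\<^esub> h"
      by (auto simp: GL2_F3_simps(2))
    then obtain q where q: "q \<in> q8" "a = q ** b" and b: "b \<in> carrier GL2_F3"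
      unfolding HQ_iff by blast
    have "\<rho>1 \<sigma> ** (g ** p) = g ** a ** (inv\<^bsub>GL2_F3\<^esub> g ** g) ** p" "\<rho>2 \<sigma> ** (h ** p) = h ** b ** (inv\<^bsub>GL2_F3\<^esub> h ** h) ** p"
      by (simp_all add: ab matrix_mul_assoc)
    then have "\<rho>1 \<sigma> ** (g ** p) = g ** (q ** (b ** p))" "\<rho>2 \<sigma> ** (h ** p) = h ** (b ** p)"
      unfolding GL.l_inv[OF gh(1), unfolded GL2_F3_simps(2,3)] GL.l_inv[OF gh(2), unfolded GL2_F3_simps(2,3)]
        matrix_mul_rid by (simp_all add: q(2) matrix_mul_assoc)
    moreover have bp: "b ** p \<in> carrier GL2_F3"
      using car b p' by blast
    ultimately have *: "\<sigma> (x p) = T1 (g ** (b ** p))" "\<sigma> (y p) = T2 (h ** (b ** p))"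
      unfolding x_def y_def R1.T_equiv[OF \<sigma>] R2.T_equiv[OF \<sigma>]
      using R1.T_q8[OF gh(1) bp q(1)] by simp_all
    obtain m where m: "m \<in> gl_C3" "pairing_stab (m ** m ** (b ** p))"
      using gl_C3_cases[OF bp] by blast
    then have "T1 (b ** p) = T1 m" "T2 (b ** p) = T2 m"
      using R1.T_eq_C3_iff[OF bp m(1)] R2.T_eq_C3_iff[OF bp m(1)] by simp_all
    then have "\<sigma> (x p) = x m" "\<sigma> (y p) = y m"
      unfolding * by (simp_all add: x_def y_def R1.T_mult_cancel[OF gh(1)] R2.T_mult_cancel[OF gh(2)])
    then show ?thesis using m(1) by blast
  qed
  have cubes: "x p ^ 3 = to_ac \<Delta>1" "y p ^ 3 = to_ac \<Delta>2" if "p \<in> gl_C3" for p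
    using that gl_C3_subset car gh R1.T_cube R2.T_cube unfolding x_def y_def by blast+
  have "x (mat 1) * y (mat 1) = x gl_t * y gl_t \<and> x (mat 1) * y (mat 1) = x (gl_t ** gl_t) * y (gl_t ** gl_t) \<or>
      x (mat 1) / y (mat 1) = x gl_t / y gl_t \<and> x (mat 1) / y (mat 1) = x (gl_t ** gl_t) / y (gl_t ** gl_t)"
  proof (rule cube_roots_proportional)
    show "to_ac \<Delta>1 \<noteq> 0" "to_ac \<Delta>2 \<noteq> 0"
      using R1.nonzero R2.nonzero by simp_all
  qed (use C cubes R1.T_C3_distinct R2.T_C3_distinct in
      \<open>simp_all only: x_def y_def R1.T_mult_cancel[OF gh(1)] R2.T_mult_cancel[OF gh(2)] not_False_eq_True\<close>)
  then have "(\<forall>p\<in>gl_C3. x (mat 1) * y (mat 1) = x p * y p) \<or> (\<forall>p\<in>gl_C3. x (mat 1) / y (mat 1) = x p / y p)"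
    unfolding gl_C3_def ball_simps by blast
  then consider "\<And>p. p \<in> gl_C3 \<Longrightarrow> x p * y p = x (mat 1) * y (mat 1)"
    | "\<And>p. p \<in> gl_C3 \<Longrightarrow> x p / y p = x (mat 1) / y (mat 1)"
    by metis
  then show ?thesis
  proof cases
    case 1
    have "x (mat 1) * y (mat 1) \<in> range to_ac"
    proof (rule gal_Q_fixed_field)
      fix \<sigma> assume \<sigma>: "\<sigma> \<in> carrier gal_Q"
      obtain q where "q \<in> gl_C3" "\<sigma> (x (mat 1)) = x q" "\<sigma> (y (mat 1)) = y q"
        using act[OF \<sigma> C(1)] by blast
      then show "\<sigma> (x (mat 1) * y (mat 1)) = x (mat 1) * y (mat 1)"
        using 1 by (simp add: gal_Q_mult[OF \<sigma>])
    qed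
    then obtain c where c: "x (mat 1) * y (mat 1) = to_ac c" by blast
    have "to_ac (c ^ 3) = to_ac (\<Delta>1 * \<Delta>2)"
      using cubes[OF C(1)] by (simp add: power_mult_distrib flip: c)
    then have "\<Delta>1 * \<Delta>2 = c ^ 3"
      unfolding to_ac_eq_iff by simp
    moreover from this have "c \<noteq> 0"
      using R1.nonzero R2.nonzero by auto
    ultimately have "\<Delta>1 * \<Delta>2 powi 1 \<in> nonzero_cubes"
      by (auto simp: nonzero_cubes_def)
    then show ?thesis by blast
  next
    case 2
    have "x (mat 1) / y (mat 1) \<in> range to_ac"
    proof (rule gal_Q_fixed_field)
      fix \<sigma> assume \<sigma>: "\<sigma> \<in> carrier gal_Q"
      obtain q where "q \<in> gl_C3" "\<sigma> (x (mat 1)) = x q" "\<sigma> (y (mat 1)) = y q"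
        using act[OF \<sigma> C(1)] by blast
      then show "\<sigma> (x (mat 1) / y (mat 1)) = x (mat 1) / y (mat 1)"
        using 2 by (simp add: gal_Q_divide[OF \<sigma>])
    qed
    then obtain c where c: "x (mat 1) / y (mat 1) = to_ac c" by blast
    have "to_ac (c ^ 3) = to_ac (\<Delta>1 / \<Delta>2)"
      using cubes[OF C(1)] by (simp add: power_divide flip: c)
    then have "\<Delta>1 / \<Delta>2 = c ^ 3"
      unfolding to_ac_eq_iff by simp
    moreover from this have "c \<noteq> 0"
      using R1.nonzero R2.nonzero by auto
    ultimately have "\<Delta>1 * \<Delta>2 powi (- 1) \<in> nonzero_cubes"
      by (auto simp: nonzero_cubes_def power_int_minus divide_inverse)
    then show ?thesis by blast
  qed
qed

text \<open>
  The Galois-equivariant bijection \<open>z \<mapsto> (c / z)\<^bsup>s\<^esup>\<close> between the cube roots of the two discriminants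
  is induced by an element of \<open>GL\<^sub>2(F\<^sub>3)\<close>, since the latter acts on three pairings as the full symmetric group.
\<close>

lemma cube_imp_congruent_mod_q8:
  assumes R1: "resolvent_rep \<rho>1 T1 \<Delta>1" and R2: "resolvent_rep \<rho>2 T2 \<Delta>2"
    and cube: "\<exists>s\<in>{1, - 1 :: int}. \<Delta>1 * \<Delta>2 powi s \<in> nonzero_cubes"
  obtains g where "g \<in> carrier GL2_F3"
    "\<And>\<sigma>. \<sigma> \<in> carrier gal_Q \<Longrightarrow> \<exists>q\<in>q8. \<rho>2 \<sigma> ** g = g ** \<rho>1 \<sigma> ** q"
proof -
  interpret R1: resolvent_rep \<rho>1 T1 \<Delta>1 by (rule R1)
  interpret R2: resolvent_rep \<rho>2 T2 \<Delta>2 by (rule R2)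
  have car: "u ** v \<in> carrier GL2_F3" if "u \<in> carrier GL2_F3" "v \<in> carrier GL2_F3" for u v
    using GL.m_closed[OF that] by (simp add: GL2_F3_simps(2))
  have C: "mat 1 \<in> gl_C3" "gl_t \<in> gl_C3" "gl_t ** gl_t \<in> gl_C3"
    by (simp_all add: gl_C3_def)
  note C' = subsetD[OF gl_C3_subset]
  obtain \<beta> :: "Qbar \<Rightarrow> Qbar" where \<beta>: "\<And>z. z ^ 3 = to_ac \<Delta>1 \<Longrightarrow> \<beta> z ^ 3 = to_ac \<Delta>2"
      "\<And>\<sigma> z. \<sigma> \<in> carrier gal_Q \<Longrightarrow> \<sigma> (\<beta> z) = \<beta> (\<sigma> z)"
      "\<And>z w. \<beta> z = \<beta> w \<Longrightarrow> z = w"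
  proof -
    consider c where "c \<noteq> 0" "\<Delta>1 * \<Delta>2 = c ^ 3" | c where "c \<noteq> 0" "\<Delta>1 / \<Delta>2 = c ^ 3"
      using cube by (auto simp: nonzero_cubes_def power_int_minus divide_inverse)
    then show thesis
    proof cases
      case (1 c)
      show thesis
      proof (rule that[of "\<lambda>z. to_ac c / z"])
        fix z :: Qbar assume z: "z ^ 3 = to_ac \<Delta>1"
        have "(to_ac c / z) ^ 3 = to_ac (c ^ 3 / \<Delta>1)"
          by (simp add: power_divide z)
        also have "c ^ 3 / \<Delta>1 = \<Delta>2"
          using R1.nonzero by (simp flip: 1(2))
        finally show "(to_ac c / z) ^ 3 = to_ac \<Delta>2" .
      qed (use 1(1) in \<open>auto simp: gal_Q_divide gal_Q_to_ac\<close>)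
    next
      case (2 c)
      show thesis
      proof (rule that[of "\<lambda>z. z / to_ac c"])
        fix z :: Qbar assume z: "z ^ 3 = to_ac \<Delta>1"
        have "(z / to_ac c) ^ 3 = to_ac (\<Delta>1 / c ^ 3)"
          by (simp add: power_divide z)
        also have "\<Delta>1 / c ^ 3 = \<Delta>2"
          using R1.nonzero by (simp flip: 2(2))
        finally show "(z / to_ac c) ^ 3 = to_ac \<Delta>2" .
      qed (use 2(1) in \<open>auto simp: gal_Q_divide gal_Q_to_ac\<close>)
    qed
  qed
  have "\<exists>q\<in>gl_C3. \<beta> (T1 p) = T2 q" if "p \<in> gl_C3" for p
    using R2.T_cube_roots \<beta>(1) R1.T_cube C'[OF that] by blast
  then obtain f where f: "\<And>p. p \<in> gl_C3 \<Longrightarrow> f p \<in> gl_C3 \<and> \<beta> (T1 p) = T2 (f p)"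
    by metis
  have f_ne: "f p \<noteq> f q" if "p \<in> gl_C3" "q \<in> gl_C3" "T1 p \<noteq> T1 q" for p q
    using f[OF that(1)] f[OF that(2)] \<beta>(3) that(3) by metis
  obtain g where g: "g \<in> carrier GL2_F3" "pairing_stab (f (mat 1) ** f (mat 1) ** g)"
      "pairing_stab (f gl_t ** f gl_t ** (g ** gl_t))"
      "pairing_stab (f (gl_t ** gl_t) ** f (gl_t ** gl_t) ** (g ** (gl_t ** gl_t)))"
    using gl_C3_permutation[of "f (mat 1)" "f gl_t" "f (gl_t ** gl_t)"] C f f_ne R1.T_C3_distinct by metis
  have "T2 (g ** p) = T2 (f p)" if "p \<in> gl_C3" for p
    using that g R2.T_eq_C3_iff[OF car[OF g(1) C'[OF that]]] f[OF that] by (auto simp: gl_C3_def)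
  then have \<beta>_T: "\<beta> (T1 p) = T2 (g ** p)" if "p \<in> gl_C3" for p
    using f that by simp
  \<comment> \<open>Every invertible A selects the same pairing as some m in \<open>gl_C3\<close>,
    so agreement on these representatives suffices.\<close>
  have \<beta>_T': "\<beta> (T1 A) = T2 (g ** A)" if A: "A \<in> carrier GL2_F3" for A
  proof -
    obtain m where m: "m \<in> gl_C3" "pairing_stab (m ** m ** A)"
      using gl_C3_cases[OF A] by blast
    then have "T1 A = T1 m" "T2 A = T2 m"
      using R1.T_eq_C3_iff[OF A m(1)] R2.T_eq_C3_iff[OF A m(1)] by simp_all
    then show ?thesis
      using \<beta>_T[OF m(1)] R2.T_mult_cancel[OF g(1), of A m] by simp
  qed
  have "\<exists>q\<in>q8. \<rho>2 \<sigma> ** g = g ** \<rho>1 \<sigma> ** q" if \<sigma>: "\<sigma> \<in> carrier gal_Q" for \<sigma>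
  proof
    have \<rho>: "\<rho>1 \<sigma> \<in> carrier GL2_F3" "\<rho>2 \<sigma> \<in> carrier GL2_F3"
      using R1.surj R2.surj \<sigma> by blast+
    define Y where "Y = g ** \<rho>1 \<sigma>"
    \<comment> \<open>The discrepancy between \<rho>2 \<sigma> ** g and g ** \<rho>1 \<sigma>. Since
      \<beta> commutes with \<sigma>, it fixes all three pairings.\<close>
    define q where "q = inv\<^bsub>GL2_F3\<^esub> Y ** (\<rho>2 \<sigma> ** g)"
    have Y: "Y \<in> carrier GL2_F3"
      unfolding Y_def by (intro car g \<rho>)
    have "Y ** q = (Y ** inv\<^bsub>GL2_F3\<^esub> Y) ** (\<rho>2 \<sigma> ** g)"
      by (simp add: q_def matrix_mul_assoc)
    then have Yq: "Y ** q = \<rho>2 \<sigma> ** g"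
      using GL.r_inv[OF Y] by (simp add: GL2_F3_simps(2,3))
    then show "\<rho>2 \<sigma> ** g = g ** \<rho>1 \<sigma> ** q"
      by (simp add: Y_def)
    have q: "q \<in> carrier GL2_F3"
      unfolding q_def by (intro car GL.inv_closed Y \<rho> g)
    show "q \<in> q8"
    proof (rule in_q8_if_pairing_stab[OF q])
      fix p assume p: "p \<in> gl_C3"
      have "T2 (Y ** (q ** p)) = T2 (\<rho>2 \<sigma> ** (g ** p))"
        by (simp add: matrix_mul_assoc Yq)
      also have "\<dots> = \<sigma> (\<beta> (T1 p))"
        by (simp add: R2.T_equiv[OF \<sigma>] \<beta>_T[OF p])
      also have "\<dots> = \<beta> (T1 (\<rho>1 \<sigma> ** p))"
        by (simp add: \<beta>(2)[OF \<sigma>] R1.T_equiv[OF \<sigma>])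
      also have "\<dots> = T2 (Y ** p)"
        using \<beta>_T'[OF car[OF \<rho>(1) C'[OF p]]] by (simp add: Y_def matrix_mul_assoc)
      finally have "T2 (q ** p) = T2 p"
        by (simp add: R2.T_mult_cancel[OF Y])
      then show "pairing_stab (p ** p ** (q ** p))"
        using R2.T_eq_C3_iff[OF car[OF q C'[OF p]] p] by simp
    qed
  qed
  then show thesis
    using that g(1) by blast
qed

text \<open>In the dichotomy \<open>pairs_mod_q8_cases\<close>, the large case is H_Q itself and the
  small case would produce a twisting character.\<close>

lemma realizes_HQ_if_cube:
  assumes R1: "resolvent_rep \<rho>1 T1 \<Delta>1" and R2: "resolvent_rep \<rho>2 T2 \<Delta>2"
    and cube: "\<exists>s\<in>{1, - 1 :: int}. \<Delta>1 * \<Delta>2 powi s \<in> nonzero_cubes"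
    and hom: "\<rho>1 \<in> hom gal_Q GL2_F3" "\<rho>2 \<in> hom gal_Q GL2_F3"
    and fin: "finite F1" "\<And>\<sigma> \<tau>. (\<And>x. x \<in> F1 \<Longrightarrow> \<sigma> x = \<tau> x) \<Longrightarrow> \<rho>1 \<sigma> = \<rho>1 \<tau>"
      "finite F2" "\<And>\<sigma> \<tau>. (\<And>x. x \<in> F2 \<Longrightarrow> \<sigma> x = \<tau> x) \<Longrightarrow> \<rho>2 \<sigma> = \<rho>2 \<tau>"
    and no_twist: "\<And>\<psi>. sign_character \<psi> \<Longrightarrow> \<not> isomorphic_reps \<rho>2 (twist_rep \<psi> \<rho>1)"
  shows "realizes_HQ \<rho>1 \<rho>2"
proof -
  interpret R1: resolvent_rep \<rho>1 T1 \<Delta>1 by (rule R1)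
  interpret R2: resolvent_rep \<rho>2 T2 \<Delta>2 by (rule R2)
  interpret q8: subgroup q8 GL2_F3
    using q8_normal by (simp add: GL.normal_inv_iff)
  obtain g where g: "g \<in> carrier GL2_F3"
    "\<And>\<sigma>. \<sigma> \<in> carrier gal_Q \<Longrightarrow> \<exists>q\<in>q8. \<rho>2 \<sigma> ** g = g ** \<rho>1 \<sigma> ** q"
    using cube_imp_congruent_mod_q8[OF R1 R2 cube] by blast
  \<comment> \<open>The conjugate of \<rho>2 that agrees with \<rho>1 modulo
    \<open>q8\<close>.\<close>
  define \<rho>' where "\<rho>' \<sigma> = inv\<^bsub>GL2_F3\<^esub> g \<otimes>\<^bsub>GL2_F3\<^esub> \<rho>2 \<sigma> \<otimes>\<^bsub>GL2_F3\<^esub> g" for \<sigma>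
  have \<rho>: "\<rho>1 \<sigma> \<in> carrier GL2_F3" "\<rho>2 \<sigma> \<in> carrier GL2_F3" "\<rho>' \<sigma> \<in> carrier GL2_F3" if "\<sigma> \<in> carrier gal_Q" for \<sigma>
    using hom_in_carrier[OF hom(1) that] hom_in_carrier[OF hom(2) that] g(1) by (simp_all add: \<rho>'_def)
  have \<rho>2: "\<rho>2 \<sigma> = g \<otimes>\<^bsub>GL2_F3\<^esub> \<rho>' \<sigma> \<otimes>\<^bsub>GL2_F3\<^esub> inv\<^bsub>GL2_F3\<^esub> g" if "\<sigma> \<in> carrier gal_Q" for \<sigma>
  proof -
    have "g \<otimes>\<^bsub>GL2_F3\<^esub> \<rho>' \<sigma> \<otimes>\<^bsub>GL2_F3\<^esub> inv\<^bsub>GL2_F3\<^esub> g =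
        (g \<otimes>\<^bsub>GL2_F3\<^esub> inv\<^bsub>GL2_F3\<^esub> g) \<otimes>\<^bsub>GL2_F3\<^esub> \<rho>2 \<sigma> \<otimes>\<^bsub>GL2_F3\<^esub> (g \<otimes>\<^bsub>GL2_F3\<^esub> inv\<^bsub>GL2_F3\<^esub> g)"
      unfolding \<rho>'_def GL2_F3_simps(2) by (simp only: matrix_mul_assoc)
    then show ?thesis
      using g(1) \<rho>(2)[OF that] by simp
  qed
  have \<rho>'_mult: "\<rho>' (\<sigma> \<otimes>\<^bsub>gal_Q\<^esub> \<tau>) = \<rho>' \<sigma> \<otimes>\<^bsub>GL2_F3\<^esub> \<rho>' \<tau>"
    if "\<sigma> \<in> carrier gal_Q" "\<tau> \<in> carrier gal_Q" for \<sigma> \<tau>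
  proof -
    have "\<rho>' \<sigma> \<otimes>\<^bsub>GL2_F3\<^esub> \<rho>' \<tau> =
        inv\<^bsub>GL2_F3\<^esub> g \<otimes>\<^bsub>GL2_F3\<^esub> \<rho>2 \<sigma> \<otimes>\<^bsub>GL2_F3\<^esub> (g \<otimes>\<^bsub>GL2_F3\<^esub> inv\<^bsub>GL2_F3\<^esub> g) \<otimes>\<^bsub>GL2_F3\<^esub> \<rho>2 \<tau> \<otimes>\<^bsub>GL2_F3\<^esub> g"
      unfolding \<rho>'_def GL2_F3_simps(2) by (simp only: matrix_mul_assoc)
    then show ?thesis
      using g(1) \<rho>(2) that hom(2) by (simp add: \<rho>'_def hom_mult GL.m_assoc)
  qed
  define G where "G = (\<lambda>\<sigma>. (\<rho>1 \<sigma>, \<rho>' \<sigma>)) ` carrier gal_Q"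
  have "(\<lambda>\<sigma>. (\<rho>1 \<sigma>, \<rho>' \<sigma>)) \<in> hom gal_Q (GL2_F3 \<times>\<times> GL2_F3)"
    using \<rho> \<rho>'_mult hom(1) by (intro homI) (simp_all add: hom_mult)
  then interpret G: group_hom gal_Q "GL2_F3 \<times>\<times> GL2_F3" "\<lambda>\<sigma>. (\<rho>1 \<sigma>, \<rho>' \<sigma>)"
    by (intro group_hom.intro group_hom_axioms.intro group_gal_Q GL2.is_group)
  have sub: "subgroup G (GL2_F3 \<times>\<times> GL2_F3)"
    unfolding G_def by (rule G.img_is_subgroup)
  have rel: "\<exists>q\<in>q8. a = b ** q" if ab: "(a, b) \<in> G" for a b
  proof -
    obtain \<sigma> where \<sigma>: "\<sigma> \<in> carrier gal_Q" "a = \<rho>1 \<sigma>" "b = \<rho>' \<sigma>"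
      using ab by (auto simp: G_def)
    obtain q where q: "q \<in> q8" "\<rho>2 \<sigma> ** g = g ** \<rho>1 \<sigma> ** q"
      using g(2)[OF \<sigma>(1)] by blast
    have "b = (inv\<^bsub>GL2_F3\<^esub> g ** g) ** a ** q"
      unfolding \<sigma>(2,3) \<rho>'_def GL2_F3_simps(2) using q(2) by (simp flip: matrix_mul_assoc)
    then have "b = a ** q"
      using GL.l_inv[OF g(1)] by (simp add: GL2_F3_simps(2,3))
    then have "b ** inv\<^bsub>GL2_F3\<^esub> q = a ** (q ** inv\<^bsub>GL2_F3\<^esub> q)"
      by (simp add: matrix_mul_assoc)
    then have "a = b ** inv\<^bsub>GL2_F3\<^esub> q"
      using GL.r_inv[OF q8.mem_carrier[OF q(1)]] by (simp add: GL2_F3_simps(2,3))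
    then show ?thesis
      using q(1) by blast
  qed
  have surj1: "\<exists>b. (a, b) \<in> G" if a: "a \<in> carrier GL2_F3" for a
  proof -
    obtain \<sigma> where "\<sigma> \<in> carrier gal_Q" "a = \<rho>1 \<sigma>"
      using a unfolding R1.surj[symmetric] by (rule imageE)
    then have "(a, \<rho>' \<sigma>) \<in> G"
      by (simp add: G_def)
    then show ?thesis ..
  qed
  have surj2: "\<exists>a. (a, b) \<in> G" if b: "b \<in> carrier GL2_F3" for b
  proof -
    have "g \<otimes>\<^bsub>GL2_F3\<^esub> b \<otimes>\<^bsub>GL2_F3\<^esub> inv\<^bsub>GL2_F3\<^esub> g \<in> \<rho>2 ` carrier gal_Q"
      unfolding R2.surj using g(1) b by simp
    then obtain \<sigma> where \<sigma>: "\<sigma> \<in> carrier gal_Q" "\<rho>2 \<sigma> = g \<otimes>\<^bsub>GL2_F3\<^esub> b \<otimes>\<^bsub>GL2_F3\<^esub> inv\<^bsub>GL2_F3\<^esub> g"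
      by (metis imageE)
    have "\<rho>' \<sigma> = (inv\<^bsub>GL2_F3\<^esub> g \<otimes>\<^bsub>GL2_F3\<^esub> g) \<otimes>\<^bsub>GL2_F3\<^esub> b \<otimes>\<^bsub>GL2_F3\<^esub> (inv\<^bsub>GL2_F3\<^esub> g \<otimes>\<^bsub>GL2_F3\<^esub> g)"
      unfolding \<rho>'_def \<sigma>(2) GL2_F3_simps(2) by (simp only: matrix_mul_assoc)
    then have "\<rho>' \<sigma> = b"
      using g(1) b by simp
    then show ?thesis
      using \<sigma>(1) by (auto simp: G_def)
  qed
  show ?thesis
  proof (rule pairs_mod_q8_cases[OF sub rel surj1 surj2])
    assume full: "\<And>b q. b \<in> carrier GL2_F3 \<Longrightarrow> q \<in> q8 \<Longrightarrow> (b ** q, b) \<in> G"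
    have "G = HQ"
    proof (rule Set.set_eqI)
      fix x :: "(F3 ^ 2 ^ 2) \<times> (F3 ^ 2 ^ 2)"
      obtain a b where [simp]: "x = (a, b)" by fastforce
      show "x \<in> G \<longleftrightarrow> x \<in> HQ"
      proof
        assume ab: "x \<in> G"
        then have b: "b \<in> carrier GL2_F3"
          using \<rho> by (auto simp: G_def)
        obtain q where q: "q \<in> q8" "a = b ** q"
          using rel ab by auto
        define q' where "q' = b \<otimes>\<^bsub>GL2_F3\<^esub> q \<otimes>\<^bsub>GL2_F3\<^esub> inv\<^bsub>GL2_F3\<^esub> b"
        have "q' \<in> q8"
          unfolding q'_def by (intro q8_conj b q)
        moreover have "q' \<otimes>\<^bsub>GL2_F3\<^esub> b = a"
          using b q8.mem_carrier[OF q(1)] unfolding q'_def q(2) GL2_F3_simps(2)[symmetric] by (simp add: GL.m_assoc)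
        ultimately show "x \<in> HQ"
          using b by (auto simp: HQ_iff GL2_F3_simps(2))
      next
        assume "x \<in> HQ"
        then obtain q where b: "b \<in> carrier GL2_F3" and q: "q \<in> q8" "a = q ** b"
          by (auto simp: HQ_iff)
        obtain q' where "q' \<in> q8" "q ** b = b ** q'"
          by (rule q8_commute[OF b q(1)])
        then show "x \<in> G"
          using full[OF b] q(2) by simp
      qed
    qed
    have "(\<lambda>\<sigma>. (\<rho>1 \<sigma>, \<rho>2 \<sigma>)) ` carrier gal_Q =
       (\<lambda>(a, b). (\<one>\<^bsub>GL2_F3\<^esub> \<otimes>\<^bsub>GL2_F3\<^esub> a \<otimes>\<^bsub>GL2_F3\<^esub> inv\<^bsub>GL2_F3\<^esub> \<one>\<^bsub>GL2_F3\<^esub>, g \<otimes>\<^bsub>GL2_F3\<^esub> b \<otimes>\<^bsub>GL2_F3\<^esub> inv\<^bsub>GL2_F3\<^esub> g)) ` G"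
      unfolding G_def image_image by (rule image_cong) (use \<rho> \<rho>2 in \<open>simp_all\<close>)
    then show ?thesis
      unfolding realizes_HQ_iff \<open>G = HQ\<close> using g(1) by blast
  next
    fix v
    assume v: "v \<in> carrier GL2_F3" and pm: "\<And>a b. (a, b) \<in> G \<Longrightarrow>
        inv\<^bsub>GL2_F3\<^esub> v \<otimes>\<^bsub>GL2_F3\<^esub> a \<otimes>\<^bsub>GL2_F3\<^esub> v = b \<or> inv\<^bsub>GL2_F3\<^esub> v \<otimes>\<^bsub>GL2_F3\<^esub> a \<otimes>\<^bsub>GL2_F3\<^esub> v = - b"
    define c where "c \<sigma> = inv\<^bsub>GL2_F3\<^esub> v \<otimes>\<^bsub>GL2_F3\<^esub> \<rho>1 \<sigma> \<otimes>\<^bsub>GL2_F3\<^esub> v" for \<sigma>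
    \<comment> \<open>After conjugation by v the representations agree up to sign, and \<psi>
      records this sign.\<close>
    define \<psi> :: "(Qbar \<Rightarrow> Qbar) \<Rightarrow> int" where "\<psi> \<sigma> = (if c \<sigma> = \<rho>' \<sigma> then 1 else - 1)" for \<sigma>
    have c: "c \<sigma> = (if \<psi> \<sigma> = 1 then \<rho>' \<sigma> else - \<rho>' \<sigma>)" if "\<sigma> \<in> carrier gal_Q" for \<sigma>
      using pm[of "\<rho>1 \<sigma>" "\<rho>' \<sigma>"] that by (auto simp: G_def c_def \<psi>_def)
    have c_mult: "c (\<sigma> \<otimes>\<^bsub>gal_Q\<^esub> \<tau>) = c \<sigma> ** c \<tau>"
      if "\<sigma> \<in> carrier gal_Q" "\<tau> \<in> carrier gal_Q" for \<sigma> \<tau>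
    proof -
      have "c \<sigma> ** c \<tau> = inv\<^bsub>GL2_F3\<^esub> v \<otimes>\<^bsub>GL2_F3\<^esub> \<rho>1 \<sigma> \<otimes>\<^bsub>GL2_F3\<^esub> (v \<otimes>\<^bsub>GL2_F3\<^esub> inv\<^bsub>GL2_F3\<^esub> v) \<otimes>\<^bsub>GL2_F3\<^esub> \<rho>1 \<tau> \<otimes>\<^bsub>GL2_F3\<^esub> v"
        unfolding c_def GL2_F3_simps(2) by (simp only: matrix_mul_assoc)
      then show ?thesis
        using v \<rho>(1) that hom(1) by (simp add: c_def hom_mult GL.m_assoc)
    qed
    \<comment> \<open>The sign is unique because the characteristic is odd; this makes \<psi>
      multiplicative.\<close>
    have neg: "- b \<noteq> b" if "b \<in> carrier GL2_F3" for b
    proof -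
      have "\<forall>b\<in>carrier GL2_F3. - b \<noteq> b"
        unfolding GL2_F3_all by (simp add: F3_eval)
      then show ?thesis using that by blast
    qed
    have \<psi>_hom: "\<psi> \<in> hom gal_Q sign_img"
    proof (rule homI)
      show "\<psi> \<sigma> \<in> carrier sign_img" for \<sigma>
        by (simp add: \<psi>_def sign_img_def)
      fix \<sigma> \<tau> assume st: "\<sigma> \<in> carrier gal_Q" "\<tau> \<in> carrier gal_Q"
      then have "\<sigma> \<otimes>\<^bsub>gal_Q\<^esub> \<tau> \<in> carrier gal_Q"
        by (rule G.m_closed)
      then have "\<rho>' \<sigma> ** \<rho>' \<tau> \<noteq> - (\<rho>' \<sigma> ** \<rho>' \<tau>)"
        using neg[OF \<rho>(3)] \<rho>'_mult[OF st] by (metis GL2_F3_simps(2))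
      then have "\<psi> (\<sigma> \<otimes>\<^bsub>gal_Q\<^esub> \<tau>) = \<psi> \<sigma> * \<psi> \<tau>"
        unfolding \<psi>_def[of "\<sigma> \<otimes>\<^bsub>gal_Q\<^esub> \<tau>"] c_mult[OF st] c[OF st(1)] c[OF st(2)] \<rho>'_mult[OF st] GL2_F3_simps(2)
        by (auto simp: \<psi>_def matrix_mult_minus)
      then show "\<psi> (\<sigma> \<otimes>\<^bsub>gal_Q\<^esub> \<tau>) = \<psi> \<sigma> \<otimes>\<^bsub>sign_img\<^esub> \<psi> \<tau>"
        by (simp add: sign_img_def)
    qed
    have \<psi>_F: "\<psi> \<sigma> = \<psi> \<tau>" if "\<And>x. x \<in> F1 \<union> F2 \<Longrightarrow> \<sigma> x = \<tau> x" for \<sigma> \<tau>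
      using fin(2)[of \<sigma> \<tau>] fin(4)[of \<sigma> \<tau>] that by (simp add: \<psi>_def c_def \<rho>'_def)
    have "finite (F1 \<union> F2)"
      using fin(1,3) by simp
    then have "sign_character \<psi>"
      using \<psi>_F by (rule sign_characterI[OF \<psi>_hom])
    moreover have "isomorphic_reps \<rho>2 (twist_rep \<psi> \<rho>1)"
      unfolding isomorphic_reps_def
    proof (intro bexI ballI)
      \<comment> \<open>Conjugation by the inverse of g turns \<rho>2 into \<rho>', which is \<psi>
        times c; conjugation by v turns c into \<rho>1.\<close>
      define h where "h = v \<otimes>\<^bsub>GL2_F3\<^esub> inv\<^bsub>GL2_F3\<^esub> g"
      show h: "h \<in> carrier GL2_F3"
        using v g(1) by (simp add: h_def)
      fix \<sigma> assume \<sigma>: "\<sigma> \<in> carrier gal_Q"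
      have "h \<otimes>\<^bsub>GL2_F3\<^esub> \<rho>2 \<sigma> \<otimes>\<^bsub>GL2_F3\<^esub> inv\<^bsub>GL2_F3\<^esub> h = v \<otimes>\<^bsub>GL2_F3\<^esub> \<rho>' \<sigma> \<otimes>\<^bsub>GL2_F3\<^esub> inv\<^bsub>GL2_F3\<^esub> v"
        using v g(1) \<rho>(2)[OF \<sigma>] by (simp add: h_def \<rho>'_def GL.inv_mult_group GL.m_assoc)
      moreover have "v \<otimes>\<^bsub>GL2_F3\<^esub> c \<sigma> \<otimes>\<^bsub>GL2_F3\<^esub> inv\<^bsub>GL2_F3\<^esub> v = \<rho>1 \<sigma>"
      proof -
        have "v \<otimes>\<^bsub>GL2_F3\<^esub> c \<sigma> \<otimes>\<^bsub>GL2_F3\<^esub> inv\<^bsub>GL2_F3\<^esub> v =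
            (v \<otimes>\<^bsub>GL2_F3\<^esub> inv\<^bsub>GL2_F3\<^esub> v) \<otimes>\<^bsub>GL2_F3\<^esub> \<rho>1 \<sigma> \<otimes>\<^bsub>GL2_F3\<^esub> (v \<otimes>\<^bsub>GL2_F3\<^esub> inv\<^bsub>GL2_F3\<^esub> v)"
          unfolding c_def GL2_F3_simps(2) by (simp only: matrix_mul_assoc)
        then show ?thesis
          using v \<rho>(1)[OF \<sigma>] by simp
      qed
      ultimately show "twist_rep \<psi> \<rho>1 \<sigma> = h \<otimes>\<^bsub>GL2_F3\<^esub> \<rho>2 \<sigma> \<otimes>\<^bsub>GL2_F3\<^esub> inv\<^bsub>GL2_F3\<^esub> h"
        using twist_rep_cases[OF \<psi>_hom \<sigma>, of \<rho>1] c[OF \<sigma>]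
        by (auto simp: GL2_F3_simps(2) matrix_mult_minus) (metis minus_minus)
    qed
    ultimately show ?thesis
      using no_twist by blast
  qed
qed

theorem theorem4p2:
  fixes E1 E2 :: "rat weierstrass" and B1 B2 :: "Qbar ec_point ^ 2"
  assumes "elliptic_curve E1" and "elliptic_curve E2"
    and "torsion3_basis E1 B1" and "torsion3_basis E2 B2"
    and "surjective_rep (mod3_rep E1 B1)" and "surjective_rep (mod3_rep E2 B2)"
  shows "realizes_HQ (mod3_rep E1 B1) (mod3_rep E2 B2) \<longleftrightarrow>
    \<not> (\<exists>\<psi>. sign_character \<psi> \<and>
           isomorphic_reps (mod3_rep E2 B2) (twist_rep \<psi> (mod3_rep E1 B1))) \<and>
    (\<exists>s \<in> {1, -1 :: int}. discriminant E1 * discriminant E2 powi s \<in> nonzero_cubes)"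
proof -
  obtain T1 T2 where R1: "resolvent_rep (mod3_rep E1 B1) T1 (discriminant E1)"
    and R2: "resolvent_rep (mod3_rep E2 B2) T2 (discriminant E2)"
    using resolvent_rep_mod3_rep assms by metis
  obtain F1 F2 where "finite F1" "\<And>\<sigma> \<tau>. (\<And>x. x \<in> F1 \<Longrightarrow> \<sigma> x = \<tau> x) \<Longrightarrow> mod3_rep E1 B1 \<sigma> = mod3_rep E1 B1 \<tau>"
    "finite F2" "\<And>\<sigma> \<tau>. (\<And>x. x \<in> F2 \<Longrightarrow> \<sigma> x = \<tau> x) \<Longrightarrow> mod3_rep E2 B2 \<sigma> = mod3_rep E2 B2 \<tau>"
    using mod3_rep_finite_dependence assms(3,4) by metis
  then have "realizes_HQ (mod3_rep E1 B1) (mod3_rep E2 B2)"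
    if "\<And>\<psi>. sign_character \<psi> \<Longrightarrow> \<not> isomorphic_reps (mod3_rep E2 B2) (twist_rep \<psi> (mod3_rep E1 B1))"
      and "\<exists>s\<in>{1, - 1 :: int}. discriminant E1 * discriminant E2 powi s \<in> nonzero_cubes"
    using that(1) by (rule realizes_HQ_if_cube[OF R1 R2 that(2) mod3_rep_hom[OF assms(3,5)] mod3_rep_hom[OF assms(4,6)]])
  then show ?thesis
    using realizes_HQ_not_twist realizes_HQ_imp_cube[OF R1 R2] by metis
qed

end
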